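(* Let $d\ge1$ and $\rho\in[0,1]$, and let $\eta_0$ be a hard-core point process on $\mathbb{R}^d$. With probability one, there exists a hard-core birth-death process $(\eta_t)_{t\in[0,\infty)}$ with initial value $\eta_0$, with arrivals from the Poisson process $N$ and local interactions given by the transition rules (1) and (2) of the context. Further, for any time $t>0$, $\eta_t$ is spatially stationary and ergodic (with respect to translations of $\mathbb{R}^d$) if $\eta_0$ is spatially stationary and ergodic.
   Context: $M(E)$ is the space of simple locally finite counting measures on $E$, identified with locally finite subsets of $E$. $B(x,r)$ is the closed ball of radius $r$ centered at $x$ in $\mathbb{R}^d$, and $\oplus$ is Minkowski sum. A configuration in $M(\mathbb{R}^d)$ is hard-core if any two of its distinct points are at distance greater than $1$; a point process is hard-core if it is almost surely a hard-core configuration. Arrivals: $N$ is a homogeneous Poisson point process on $\mathbb{R}^d\times\mathbb{R}^+$ with intensity $\lambda=1$; a point $p=(x_p,t_p)\in N$ arrives at location $x_p$ at time $t_p$. Points of the initial configuration $\eta_0$ are given arrival time $0$. $\eta_0$ is independent of $N$. Marks: for each pair $p\in N$, $q\in N\cup\eta_0$ with $t_q<t_p$, $I_{p,q}$ is a Bernoulli random variable with parameter $\rho$ and $I_{q,p}=1-I_{p,q}$. These are independent over different pairs $\{p,q\}$ and independent of $N$ and $\eta_0$. ($I_{p,q}=1$ means that the arriving point $p$ kills $q$ if they interact, and $I_{q,p}=1$ means that $q$ kills $p$.) Dynamics: a hard-core birth-death process is a process $\eta_t\in M(\mathbb{R}^d)$ with hard-core configurations as values, such that for every compact $K\subset\mathbb{R}^d$: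 (1) $\eta_t|_K$ is a right-continuous jump process with values in $M(K)$, which changes only at times of arrivals of points $p\in N$ with $x_p\in K\oplus B(0,1)$; (2) if a point $p=(x_p,t_p)\in N$ arrives at time $t=t_p$ with $x_p\in K\oplus B(0,1)$, then $\eta_t|_{K\setminus B(x_p,1)}=\eta_{t-}|_{K\setminus B(x_p,1)}$, and $\eta_t|_{K\cap B(x_p,1)}$ is the restriction to $K$ of $$\delta_{x_p}\prod_{x_q\in\eta_{t-}\cap B(x_p,1)}I_{p,q}+\sum_{x_q\in\eta_{t-}\cap B(x_p,1)}\delta_{x_q}I_{q,p}.$$ That is, each existing point $q$ in $B(x_p,1)$ is deleted iff $I_{p,q}=1$, and $p$ is accepted iff $I_{p,q}=1$ for all existing points $q$ in $B(x_p,1)$. *)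

theory Defs
  imports "HOL-Probability.Probability"
begin

section \<open>Configurations and point processes\<close>

text \<open>Simple locally finite counting measures are represented by their supports.\<close>

definition locally_finite_set :: "'a::topological_space set \<Rightarrow> bool" where
  "locally_finite_set \<xi> \<longleftrightarrow> (\<forall>K. compact K \<longrightarrow> finite (\<xi> \<inter> K))"

definition configurations :: "'a::euclidean_space set measure" where
  "configurations = sigma {\<xi>. locally_finite_set \<xi>}
     {{\<xi>. locally_finite_set \<xi> \<and> card (\<xi> \<inter> B) = k} | B k. B \<in> sets borel \<and> bounded B}"

definition hard_core :: "'a::metric_space set \<Rightarrow> bool" where
  "hard_core \<xi> \<longleftrightarrow> (\<forall>x\<in>\<xi>. \<forall>y\<in>\<xi>. x \<noteq> y \<longrightarrow> dist x y > 1)"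

definition hard_core_point_process :: "'w measure \<Rightarrow> ('w \<Rightarrow> 'a::euclidean_space set) \<Rightarrow> bool" where
  "hard_core_point_process M \<xi> \<longleftrightarrow> \<xi> \<in> M \<rightarrow>\<^sub>M configurations \<and> (AE \<omega> in M. hard_core (\<xi> \<omega>))"

definition stationary :: "'w measure \<Rightarrow> ('w \<Rightarrow> 'a::euclidean_space set) \<Rightarrow> bool" where
  "stationary M \<xi> \<longleftrightarrow>
     (\<forall>v. distr M configurations (\<lambda>\<omega>. (+) v ` \<xi> \<omega>) = distr M configurations \<xi>)"

definition ergodic :: "'w measure \<Rightarrow> ('w \<Rightarrow> 'a::euclidean_space set) \<Rightarrow> bool" where
  "ergodic M \<xi> \<longleftrightarrow>
     (\<forall>A \<in> sets configurations.
        (\<forall>v. \<forall>\<zeta> \<in> space configurations. (+) v ` \<zeta> \<in> A \<longleftrightarrow> \<zeta> \<in> A) \<longrightarrow>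
        measure (distr M configurations \<xi>) A \<in> {0, 1})"

section \<open>Arrivals and marks\<close>

text \<open>A space-time point is a pair of a location and an arrival time; the half-line of times is
  \<open>{0..}\<close>. The intensity measure is Lebesgue measure. The Poisson probabilities are written out, since
  \<open>poisson_pmf\<close> is specified for positive rates only and \<open>B\<close> may be a null set.\<close>

definition unit_poisson_process ::
    "'w measure \<Rightarrow> ('w \<Rightarrow> ('a::euclidean_space \<times> real) set) \<Rightarrow> bool" where
  "unit_poisson_process M N \<longleftrightarrow>
     N \<in> M \<rightarrow>\<^sub>M configurations \<and>
     (\<forall>\<omega> \<in> space M. N \<omega> \<subseteq> UNIV \<times> {0..}) \<and>
     (\<forall>B \<in> sets borel. bounded B \<and> B \<subseteq> UNIV \<times> {0..} \<longrightarrow>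
        (\<forall>k. measure M {\<omega> \<in> space M. card (N \<omega> \<inter> B) = k} =
             measure lborel B ^ k / fact k * exp (- measure lborel B))) \<and>
     (\<forall>n (B :: nat \<Rightarrow> ('a \<times> real) set).
        (\<forall>i<n. B i \<in> sets borel \<and> bounded (B i) \<and> B i \<subseteq> UNIV \<times> {0..}) \<and>
        disjoint_family_on B {..<n} \<longrightarrow>
        prob_space.indep_vars M (\<lambda>_. count_space UNIV) (\<lambda>i \<omega>. card (N \<omega> \<inter> B i)) {..<n})"

text \<open>All space-time points: the arrivals, and the initial points with arrival time \<open>0\<close>.\<close>

definition all_points :: "('a \<times> real) set \<Rightarrow> 'a set \<Rightarrow> ('a \<times> real) set" where
  "all_points N h = N \<union> h \<times> {0}"

definition marked_pairs ::
    "('a \<times> real) set \<Rightarrow> 'a set \<Rightarrow> (('a \<times> real) \<times> ('a \<times> real)) set" where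
  "marked_pairs N h = {(p, q). p \<in> N \<and> q \<in> all_points N h \<and> snd q < snd p}"

text \<open>The mark \<open>I \<omega> p q\<close> is true iff $I_{p,q} = 1$. The pairs carrying marks are themselves
  random, so ``Bernoulli, independent over different pairs and independent of the point
  processes \<open>N\<close> and \<open>h\<close>'' is expressed through selections: whenever \<open>k\<close> marked pairs are chosen
  measurably as functions of \<open>(N, h)\<close> and are distinct on an event \<open>A\<close> determined by \<open>(N, h)\<close>,
  their marks are, on \<open>A\<close>, independent Bernoulli variables that are independent of \<open>(N, h)\<close>.
  Since the first component of a marked pair is the later one, distinct ordered pairs are
  distinct unordered pairs.\<close>

definition independent_marks ::
    "'w measure \<Rightarrow> real \<Rightarrow> ('w \<Rightarrow> ('a::euclidean_space \<times> real) set) \<Rightarrow> ('w \<Rightarrow> 'a set) \<Rightarrow>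
     ('w \<Rightarrow> 'a \<times> real \<Rightarrow> 'a \<times> real \<Rightarrow> bool) \<Rightarrow> bool" where
  "independent_marks M \<rho> N h I \<longleftrightarrow>
     (\<forall>\<omega> \<in> space M. \<forall>(p, q) \<in> marked_pairs (N \<omega>) (h \<omega>). I \<omega> q p \<longleftrightarrow> \<not> I \<omega> p q) \<and>
     (let G = vimage_algebra (space M) (\<lambda>\<omega>. (N \<omega>, h \<omega>)) (configurations \<Otimes>\<^sub>M configurations) in
      \<forall>(k::nat) P Q. \<forall>A \<in> sets G. \<forall>b :: nat \<Rightarrow> bool.
        (\<forall>i<k. P i \<in> G \<rightarrow>\<^sub>M borel \<and> Q i \<in> G \<rightarrow>\<^sub>M borel) \<and>
        (\<forall>\<omega>\<in>A. (\<forall>i<k. (P i \<omega>, Q i \<omega>) \<in> marked_pairs (N \<omega>) (h \<omega>)) \<and>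
               inj_on (\<lambda>i. (P i \<omega>, Q i \<omega>)) {..<k}) \<longrightarrow>
        {\<omega>\<in>A. \<forall>i<k. I \<omega> (P i \<omega>) (Q i \<omega>) = b i} \<in> sets M \<and>
        measure M {\<omega>\<in>A. \<forall>i<k. I \<omega> (P i \<omega>) (Q i \<omega>) = b i} =
          measure M A * (\<Prod>i<k. pmf (bernoulli_pmf \<rho>) (b i)))"

section \<open>The dynamics\<close>

text \<open>The left limit $\eta_{t-}$. Condition (1) of the dynamics forces every restriction to a
  compact set to be eventually equal to that of this set as time increases to \<open>t\<close>.\<close>

definition left_lim :: "(real \<Rightarrow> 'a set) \<Rightarrow> real \<Rightarrow> 'a set" where
  "left_lim \<eta> t = {x. \<forall>\<^sub>F s in at_left t. x \<in> \<eta> s}"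

definition jump_condition ::
    "('a::euclidean_space \<times> real) set \<Rightarrow> (real \<Rightarrow> 'a set) \<Rightarrow> 'a set \<Rightarrow> bool" where
  "jump_condition N \<eta> K \<longleftrightarrow>
     (\<forall>t\<ge>0. \<forall>\<^sub>F s in at_right t. \<eta> s \<inter> K = \<eta> t \<inter> K) \<and>
     (\<forall>t>0. \<forall>\<^sub>F s in at_left t. \<eta> s \<inter> K = left_lim \<eta> t \<inter> K) \<and>
     (\<forall>t>0. \<eta> t \<inter> K \<noteq> left_lim \<eta> t \<inter> K \<longrightarrow>
        (\<exists>p\<in>N. snd p = t \<and> fst p \<in> K + cball 0 1))"

text \<open>The points \<open>q\<close> present just before the arrival of \<open>p\<close> and interacting with it. Almost
  surely distinct space-time points have distinct locations, so that a point of $\eta_{t-}$ is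
  the location of exactly one \<open>q\<close>.\<close>

definition interacting_points ::
    "('a::euclidean_space \<times> real) set \<Rightarrow> 'a set \<Rightarrow> (real \<Rightarrow> 'a set) \<Rightarrow> 'a \<times> real \<Rightarrow> ('a \<times> real) set"
  where
  "interacting_points N h \<eta> p =
     {q \<in> all_points N h. snd q < snd p \<and> fst q \<in> left_lim \<eta> (snd p) \<inter> cball (fst p) 1}"

text \<open>Arrivals at time \<open>0\<close>, which almost surely do not occur, are not subject to the rule, as
  $\eta_{0-}$ is not defined.\<close>

definition transition_rule ::
    "('a::euclidean_space \<times> real) set \<Rightarrow> 'a set \<Rightarrow> ('a \<times> real \<Rightarrow> 'a \<times> real \<Rightarrow> bool) \<Rightarrow>
     (real \<Rightarrow> 'a set) \<Rightarrow> 'a set \<Rightarrow> bool" where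
  "transition_rule N h I \<eta> K \<longleftrightarrow>
     (\<forall>p\<in>N. snd p > 0 \<and> fst p \<in> K + cball 0 1 \<longrightarrow>
        \<eta> (snd p) \<inter> (K - cball (fst p) 1) = left_lim \<eta> (snd p) \<inter> (K - cball (fst p) 1) \<and>
        \<eta> (snd p) \<inter> (K \<inter> cball (fst p) 1) =
          K \<inter> ((if \<forall>q \<in> interacting_points N h \<eta> p. I p q then {fst p} else {}) \<union>
               {fst q | q. q \<in> interacting_points N h \<eta> p \<and> I q p}))"

definition hard_core_birth_death ::
    "('a::euclidean_space \<times> real) set \<Rightarrow> 'a set \<Rightarrow> ('a \<times> real \<Rightarrow> 'a \<times> real \<Rightarrow> bool) \<Rightarrow>
     (real \<Rightarrow> 'a set) \<Rightarrow> bool" where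
  "hard_core_birth_death N h I \<eta> \<longleftrightarrow>
     \<eta> 0 = h \<and>
     (\<forall>t\<ge>0. locally_finite_set (\<eta> t) \<and> hard_core (\<eta> t)) \<and>
     (\<forall>K. compact K \<longrightarrow> jump_condition N \<eta> K \<and> transition_rule N h I \<eta> K)"

end

theory Submission
  imports Defs
begin

text \<open>An arrival \<open>p\<close> deletes every present neighbour \<open>q\<close> with $I_{p,q} = 1$, whether or not \<open>p\<close>
  itself is accepted. Hence an accepted point lives until the first later arrival within distance 1
  whose mark is against it, and an arrival is accepted iff no accepted earlier point that survives it
  lies within distance 1. The accepted points thus form the kernel of a relation that is well founded
  as soon as, from every arrival, chains of arrivals with decreasing times and steps of length at most 1
  have bounded length. Almost surely they do: chains of \<open>i\<close> steps within time \<open>T\<close> that start in a given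
  unit cube have probability at most \<open>(\<kappa> * T) ^ i / fact i\<close>, where \<open>\<kappa>\<close> counts the neighbours of a cube.

  The process is an equivariant measurable function of \<open>(N, \<eta>\<^sub>0, Z)\<close>, where \<open>Z\<close> is the set of pairs with
  mark 1, a thinning of the marked pairs. The law of such a triple is determined by the probabilities
  of avoiding bounded sets, which gives stationarity. For ergodicity, a local event and a distant
  translate of another one are conditionally independent given \<open>\<eta>\<^sub>0\<close>; so a translation invariant event
  is, up to a null set, an event of \<open>\<eta>\<^sub>0\<close> alone, and the ergodicity of \<open>\<eta>\<^sub>0\<close> applies.\<close>

section \<open>Configurations\<close>

text \<open>Independent ergodic systems need not be jointly ergodic, and
  \<open>\<eta>\<^sub>0\<close> is only ergodic, so the triple cannot be expected to mix. What mixes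
  is the randomness left once \<open>\<eta>\<^sub>0\<close> is frozen: counts of \<open>N\<close> in
  disjoint sets are independent, and given \<open>(N, \<eta>\<^sub>0)\<close> the marks are
  independent coins. Hence the correction term \<open>mean_weight\<close>, which removes the
  dependence through \<open>\<eta>\<^sub>0\<close>.

  The marks are indexed by random pairs. As a random set \<open>Z\<close> they become a
  configuration, on which translations act. Given \<open>(N, \<eta>\<^sub>0)\<close>, this set
  avoids \<open>D\<close> with probability \<open>(1 - \<rho>) ^ k\<close>, where \<open>k\<close>
  counts the marked pairs in \<open>D\<close>; the law of the marks enters through this formula
  only.

  For chains, a bound \<open>(\<kappa> * T) ^ i\<close> would be useful for short times only. The
  factorial comes from the ordering of the times and covers every horizon \<open>T\<close>. It is
  obtained by cutting time into slabs of width \<open>1 / m\<close>: the number of chains of cells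
  grows like \<open>m ^ i\<close>, each is occupied with probability of order
  \<open>m ^ (-i)\<close>, and \<open>m\<close> tends to infinity.\<close>

lemma locally_finite_set_bounded:
  fixes \<xi> :: "'a::euclidean_space set"
  assumes "locally_finite_set \<xi>" "bounded B"
  shows "finite (\<xi> \<inter> B)"
proof -
  have "compact (closure B)" using assms(2) by (simp add: compact_closure)
  then have "finite (\<xi> \<inter> closure B)" using assms(1) by (simp add: locally_finite_set_def)
  then show ?thesis by (rule finite_subset[rotated]) (use closure_subset in auto)
qed

lemma locally_finite_set_iff_bounded:
  fixes \<xi> :: "'a::euclidean_space set"
  shows "locally_finite_set \<xi> \<longleftrightarrow> (\<forall>B. bounded B \<longrightarrow> finite (\<xi> \<inter> B))"
  using locally_finite_set_bounded compact_imp_bounded unfolding locally_finite_set_def by blast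

lemma locally_finite_set_mono:
  "locally_finite_set \<xi> \<Longrightarrow> \<zeta> \<subseteq> \<xi> \<Longrightarrow> locally_finite_set \<zeta>"
  unfolding locally_finite_set_def by (meson Int_mono finite_subset order_refl)

lemma locally_finite_set_empty [simp]: "locally_finite_set {}"
  by (simp add: locally_finite_set_def)

lemma locally_finite_set_Un:
  "locally_finite_set \<xi> \<Longrightarrow> locally_finite_set \<zeta> \<Longrightarrow> locally_finite_set (\<xi> \<union> \<zeta>)"
  by (simp add: locally_finite_set_def Int_Un_distrib2)

lemma locally_finite_set_translation:
  fixes \<xi> :: "'a::euclidean_space set"
  assumes "locally_finite_set \<xi>"
  shows "locally_finite_set ((+) v ` \<xi>)"
  unfolding locally_finite_set_iff_bounded
proof (intro allI impI)
  fix B :: "'a set" assume "bounded B"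
  have "finite (\<xi> \<inter> (+) (- v) ` B)"
    using assms \<open>bounded B\<close> by (intro locally_finite_set_bounded bounded_translation)
  then have "finite ((+) v ` (\<xi> \<inter> (+) (- v) ` B))" by simp
  moreover have "(+) v ` \<xi> \<inter> B \<subseteq> (+) v ` (\<xi> \<inter> (+) (- v) ` B)"
  proof
    fix x assume "x \<in> (+) v ` \<xi> \<inter> B"
    then obtain y where "x = v + y" "y \<in> \<xi>" "v + y \<in> B" by auto
    moreover from this have "y = - v + (v + y)" by simp
    ultimately show "x \<in> (+) v ` (\<xi> \<inter> (+) (- v) ` B)" by blast
  qed
  ultimately show "finite ((+) v ` \<xi> \<inter> B)" by (rule finite_subset[rotated])
qed

lemma locally_finite_set_countable:
  fixes \<xi> :: "'a::euclidean_space set"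
  assumes "locally_finite_set \<xi>"
  shows "countable \<xi>"
proof -
  have "\<exists>n::nat. x \<in> cball 0 (real n)" for x :: 'a
    using real_arch_simple[of "norm x"] by simp
  then have "\<xi> = (\<Union>n::nat. \<xi> \<inter> cball 0 (real n))" by auto
  moreover have "countable (\<Union>n::nat. \<xi> \<inter> cball 0 (real n))"
    by (rule countable_UN, rule countableI_type)
      (rule countable_finite[OF locally_finite_set_bounded[OF assms bounded_cball]])
  ultimately show ?thesis by simp
qed

lemma space_configurations: "space configurations = {\<xi>. locally_finite_set \<xi>}"
  unfolding configurations_def by (intro space_measure_of) auto

lemma sets_configurations:
  "sets configurations = sigma_sets {\<xi>. locally_finite_set \<xi>}
     {{\<xi>. locally_finite_set \<xi> \<and> card (\<xi> \<inter> B) = k} | B k. B \<in> sets borel \<and> bounded B}"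
  unfolding configurations_def by (intro sets_measure_of) auto

lemma sets_count [measurable]:
  assumes "B \<in> sets borel" "bounded B"
  shows "{\<xi> \<in> space configurations. card (\<xi> \<inter> B) = k} \<in> sets configurations"
  unfolding sets_configurations space_configurations
  using assms by (intro sigma_sets.Basic) auto

section \<open>Avoidance events and separating cells\<close>

definition avoiding :: "'a::euclidean_space set \<Rightarrow> 'a set set" where
  "avoiding B = {\<xi>. locally_finite_set \<xi> \<and> \<xi> \<inter> B = {}}"

definition avoiding_events :: "'a::euclidean_space set set set" where
  "avoiding_events = {avoiding B | B. B \<in> sets borel \<and> bounded B}"

lemma avoiding_Int: "avoiding B \<inter> avoiding C = avoiding (B \<union> C)"
  by (auto simp: avoiding_def)

lemma avoiding_empty: "avoiding {} = space configurations"
  by (simp add: avoiding_def space_configurations)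

lemma Int_stable_avoiding_events: "Int_stable avoiding_events"
  unfolding Int_stable_def avoiding_events_def
  by (auto simp: avoiding_Int) (metis bounded_Un sets.Un)

lemma avoiding_eq_count:
  assumes "bounded B"
  shows "avoiding B = {\<xi>. locally_finite_set \<xi> \<and> card (\<xi> \<inter> B) = 0}"
  using locally_finite_set_bounded[OF _ assms] by (auto simp: avoiding_def)

definition cell_base :: "'a::euclidean_space set set" where
  "cell_base = (SOME \<B>. countable \<B> \<and> topological_basis \<B>)"

lemma cell_base: "countable cell_base" "topological_basis cell_base"
  unfolding cell_base_def using someI_ex[OF ex_countable_basis] by auto

text \<open>The bounded members of a countable base of the topology, numbered. They overlap and come
  in all small sizes, so that any finite set can be separated by disjoint cells while statements
  about cells stay countable.\<close>

definition cell :: "nat \<Rightarrow> 'a::euclidean_space set" where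
  "cell = from_nat_into {U \<in> cell_base. bounded U}"

lemma cell_nbhd:
  fixes x :: "'a::euclidean_space"
  assumes "open U" "x \<in> U"
  shows "\<exists>j. x \<in> cell j \<and> cell j \<subseteq> U"
proof -
  have "open (U \<inter> ball x 1)" "x \<in> U \<inter> ball x 1" using assms by auto
  then obtain V where V: "V \<in> cell_base" "x \<in> V" "V \<subseteq> U \<inter> ball x 1"
    using topological_basisE[OF cell_base(2)] by blast
  then have "bounded V" using bounded_subset[OF bounded_ball, of V x 1] by auto
  then have "V \<in> {U \<in> cell_base. bounded U}" using V by simp
  moreover have "countable {U \<in> cell_base. bounded (U::'a set)}"
    using cell_base(1) by (rule countable_subset[rotated]) auto
  ultimately obtain j where "cell j = V" unfolding cell_def using from_nat_into_surj by metis
  then show ?thesis using V by auto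
qed

lemma cell_mem: "cell j \<in> {U \<in> cell_base. bounded (U::'a::euclidean_space set)}"
proof -
  have "{U \<in> cell_base. bounded (U::'a set)} \<noteq> {}"
  proof
    assume "{U \<in> cell_base. bounded (U::'a set)} = {}"
    obtain V where V: "V \<in> cell_base" "(0::'a) \<in> V" "V \<subseteq> ball 0 1"
      using topological_basisE[OF cell_base(2) open_ball, of "0::'a" 0 1] by auto
    then have "bounded V" using bounded_subset[OF bounded_ball] by auto
    then show False using V \<open>_ = {}\<close> by auto
  qed
  then show ?thesis unfolding cell_def by (rule from_nat_into)
qed

lemma open_cell: "open (cell j)"
  using cell_mem[of j] topological_basis_open[OF cell_base(2)] by auto

lemma bounded_cell: "bounded (cell j)"
  using cell_mem[of j] by auto

lemma cell_sets_borel [measurable]: "cell j \<in> sets borel"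
  by (simp add: open_cell)

text \<open>Cells inside balls of half the minimal distance are disjoint for distinct
  points.\<close>

lemma finite_disjoint_cells:
  fixes F :: "'a::euclidean_space set"
  assumes "finite F"
  shows "\<exists>c. disjoint_family_on (\<lambda>x. cell (c x) :: 'a set) F \<and> inj_on c F \<and> (\<forall>x\<in>F. x \<in> cell (c x))"
proof -
  obtain r where r: "r > 0" "\<And>x y. x \<in> F \<Longrightarrow> y \<in> F \<Longrightarrow> x \<noteq> y \<Longrightarrow> r \<le> dist x y"
  proof -
    let ?D = "{dist x y | x y. x \<in> F \<and> y \<in> F \<and> x \<noteq> y}"
    have fin: "finite ?D"
      by (rule finite_subset[of _ "(\<lambda>(x, y). dist x y) ` (F \<times> F)"]) (use assms in auto)
    show ?thesis
    \<comment> \<open>The inserted 1 keeps the minimum defined when \<open>F\<close> has fewer than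
      two points.\<close>
    proof (rule that[of "Min (insert 1 ?D)"])
      show "0 < Min (insert 1 ?D)" using fin by (subst Min_gr_iff) auto
      show "Min (insert 1 ?D) \<le> dist x y" if "x \<in> F" "y \<in> F" "x \<noteq> y" for x y
        using fin that by (intro Min_le) auto
    qed
  qed
  have "\<forall>x::'a. \<exists>j. x \<in> cell j \<and> cell j \<subseteq> ball x (r / 2)"
    using r(1) by (intro allI cell_nbhd) auto
  from choice[OF this] obtain c
    where c': "\<forall>x::'a. x \<in> cell (c x) \<and> cell (c x) \<subseteq> ball x (r / 2)" ..
  then have c: "\<And>x::'a. x \<in> cell (c x)" "\<And>x::'a. cell (c x) \<subseteq> ball x (r / 2)" by simp_all
  have dis: "cell (c x) \<inter> cell (c y) = ({} :: 'a set)" if "x \<in> F" "y \<in> F" "x \<noteq> y" for x y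
  proof -
    have "ball x (r / 2) \<inter> ball y (r / 2) = {}"
      using r(2)[OF that] by (intro disjoint_ballI) auto
    then show ?thesis using c(2)[of x] c(2)[of y] by blast
  qed
  have "inj_on c F"
  proof (rule inj_onI, rule ccontr)
    fix x y assume "x \<in> F" "y \<in> F" "c x = c y" "x \<noteq> y"
    then show False using dis[of x y] c(1)[of x] by auto
  qed
  then show ?thesis using dis c(1) by (intro exI[of _ c]) (auto simp: disjoint_family_on_def)
qed

text \<open>Counting is reduced to emptiness: distinct points have disjoint cells, and disjoint
  cells that are hit supply distinct points. There are only countably many finite sets
  \<open>J\<close> of naturals, so for random \<open>F\<close> the right-hand side is a countable
  combination of avoidance events.\<close>

lemma le_card_iff_disjoint_cells:
  fixes F :: "'a::euclidean_space set"
  assumes "finite F"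
  shows "k \<le> card F \<longleftrightarrow>
    (\<exists>J. finite J \<and> card J = k \<and> disjoint_family_on (cell :: nat \<Rightarrow> 'a set) J \<and>
         (\<forall>j\<in>J. F \<inter> cell j \<noteq> {}))"
proof
  assume "k \<le> card F"
  then obtain G where G: "G \<subseteq> F" "card G = k" "finite G"
    by (rule obtain_subset_with_card_n)
  obtain c where c: "disjoint_family_on (\<lambda>x. cell (c x) :: 'a set) G" "inj_on c G" "\<forall>x\<in>G. x \<in> cell (c x)"
    using finite_disjoint_cells[OF G(3)] by auto
  show "\<exists>J. finite J \<and> card J = k \<and> disjoint_family_on (cell :: nat \<Rightarrow> 'a set) J \<and>
         (\<forall>j\<in>J. F \<inter> cell j \<noteq> {})"
  proof (intro exI[of _ "c ` G"] conjI ballI)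
    show "card (c ` G) = k" using card_image[OF c(2)] G(2) by simp
    show "disjoint_family_on (cell :: nat \<Rightarrow> 'a set) (c ` G)"
      unfolding disjoint_family_on_def
    proof (intro ballI impI)
      fix i j assume "i \<in> c ` G" "j \<in> c ` G" "i \<noteq> j"
      then obtain x y where "x \<in> G" "y \<in> G" "i = c x" "j = c y" "x \<noteq> y" by blast
      then show "cell i \<inter> cell j = ({} :: 'a set)"
        using disjoint_family_onD[OF c(1)] by simp
    qed
    show "F \<inter> cell j \<noteq> {}" if "j \<in> c ` G" for j using that G(1) c(3) by blast
    show "finite (c ` G)" using G(3) by simp
  qed
next
  assume "\<exists>J. finite J \<and> card J = k \<and> disjoint_family_on (cell :: nat \<Rightarrow> 'a set) J \<and>
         (\<forall>j\<in>J. F \<inter> cell j \<noteq> {})"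
  then obtain J where J: "finite J" "card J = k" "disjoint_family_on (cell :: nat \<Rightarrow> 'a set) J"
    "\<forall>j\<in>J. F \<inter> cell j \<noteq> {}" by auto
  then have "\<forall>j\<in>J. \<exists>x. x \<in> F \<inter> cell j" by blast
  then obtain f where f: "\<forall>j\<in>J. f j \<in> F \<inter> cell j" using bchoice[of J "\<lambda>j x. x \<in> F \<inter> cell j"] by blast
  have "inj_on f J"
  proof (rule inj_onI, rule ccontr)
    fix i j assume "i \<in> J" "j \<in> J" "f i = f j" "i \<noteq> j"
    moreover have "f i \<in> cell i" "f j \<in> cell j" using f \<open>i \<in> J\<close> \<open>j \<in> J\<close> by blast+
    ultimately show False using disjoint_family_onD[OF J(3), of i j] by auto
  qed
  then have "card (f ` J) = k" using J by (simp add: card_image)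
  moreover have "card (f ` J) \<le> card F" using f by (intro card_mono[OF assms]) auto
  ultimately show "k \<le> card F" by simp
qed

text \<open>A configuration is a set, not a counting measure with multiplicities: hence the avoidance
  events, a \<open>\<pi>\<close>-system, already generate the \<open>\<sigma>\<close>-algebra.\<close>

lemma sets_configurations_avoiding:
  "sets (configurations :: 'a::euclidean_space set measure) =
     sigma_sets {\<xi>. locally_finite_set \<xi>} avoiding_events"
proof (rule antisym)
  let ?S = "sigma_sets {\<xi>::'a set. locally_finite_set \<xi>} avoiding_events"
  interpret A: sigma_algebra "{\<xi>::'a set. locally_finite_set \<xi>}"
    ?S
    by (rule sigma_algebra_sigma_sets) (auto simp: avoiding_events_def avoiding_def)
  have av: "{\<xi> \<in> {\<xi>. locally_finite_set \<xi>}. \<xi> \<inter> B = {}} \<in> ?S"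
    if "B \<in> sets borel" "bounded B" for B :: "'a set"
    using that by (intro sigma_sets.Basic) (auto simp: avoiding_events_def avoiding_def)
  have ge: "{\<xi> \<in> {\<xi>. locally_finite_set \<xi>}. k \<le> card (\<xi> \<inter> B)} \<in> ?S"
    if B: "B \<in> sets borel" "bounded B" for B :: "'a set" and k
  proof -
    have cell: "{\<xi> \<in> {\<xi>. locally_finite_set \<xi>}. \<xi> \<inter> B \<inter> cell j \<noteq> {}} \<in> ?S" for j
      using B by (intro A.sets_Collect_neg) (unfold Int_assoc, intro av, auto intro: bounded_Int)
    have "{\<xi> \<in> {\<xi>. locally_finite_set \<xi>}. k \<le> card (\<xi> \<inter> B)} =
      (\<Union>J\<in>{J. finite J \<and> card J = k \<and> disjoint_family_on (cell :: nat \<Rightarrow> 'a set) J}.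
        {\<xi> \<in> {\<xi>. locally_finite_set \<xi>}. \<forall>j\<in>J. \<xi> \<inter> B \<inter> cell j \<noteq> {}})"
      using le_card_iff_disjoint_cells[OF locally_finite_set_bounded[OF _ B(2)]] by auto
    moreover have "{J::nat set. finite J \<and> card J = k \<and> disjoint_family_on (cell :: nat \<Rightarrow> 'a set) J} \<subseteq> Collect finite"
      by auto
    then have "countable {J::nat set. finite J \<and> card J = k \<and> disjoint_family_on (cell :: nat \<Rightarrow> 'a set) J}"
      using countable_Collect_finite countable_subset by blast
    ultimately show ?thesis
      using A.sets_Collect_finite_All[OF cell]
      by (auto intro!: A.countable_UN')
  qed
  show "sets (configurations :: 'a set measure) \<subseteq> ?S"
    unfolding sets_configurations
  proof (rule A.sigma_sets_subset, safe)
    fix B :: "'a set" and k assume B: "B \<in> sets borel" "bounded B"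
    have "{\<xi>. locally_finite_set \<xi> \<and> card (\<xi> \<inter> B) = k} =
      {\<xi> \<in> {\<xi>. locally_finite_set \<xi>}. k \<le> card (\<xi> \<inter> B)} - {\<xi> \<in> {\<xi>. locally_finite_set \<xi>}. Suc k \<le> card (\<xi> \<inter> B)}"
      by auto
    then show "{\<xi>. locally_finite_set \<xi> \<and> card (\<xi> \<inter> B) = k} \<in> ?S"
      using A.Diff[OF ge[OF B, of k] ge[OF B, of "Suc k"]] by simp
  qed
next
  show "sigma_sets {\<xi>. locally_finite_set \<xi>} avoiding_events \<subseteq> sets (configurations :: 'a set measure)"
    unfolding sets_configurations
  proof (rule sigma_sets_mono, safe)
    fix A assume "A \<in> (avoiding_events :: 'a set set set)"
    then obtain B :: "'a set" where B: "A = avoiding B" "B \<in> sets borel" "bounded B"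
      by (auto simp: avoiding_events_def)
    show "A \<in> sigma_sets {\<xi>. locally_finite_set \<xi>}
      {{\<xi>. locally_finite_set \<xi> \<and> card (\<xi> \<inter> B) = k} | B k. B \<in> sets borel \<and> bounded B}"
      using B(2,3) unfolding B(1) avoiding_eq_count[OF B(3)] by (intro sigma_sets.Basic) blast
  qed
qed

lemma avoiding_sets [measurable]:
  "B \<in> sets borel \<Longrightarrow> bounded B \<Longrightarrow> avoiding B \<in> sets configurations"
  unfolding sets_configurations_avoiding avoiding_events_def by (intro sigma_sets.Basic) auto

text \<open>The criterion asks for hitting events, the complements of avoidance events: they are
  existential statements over points, the form that \<open>pred_bex_configuration\<close>
  treats.\<close>

lemma measurable_configurationsI:
  assumes "\<And>\<omega>. \<omega> \<in> space M \<Longrightarrow> locally_finite_set (\<xi> \<omega>)"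
    and "\<And>B. B \<in> sets borel \<Longrightarrow> bounded B \<Longrightarrow> {\<omega> \<in> space M. \<exists>x\<in>\<xi> \<omega>. x \<in> B} \<in> sets M"
  shows "\<xi> \<in> M \<rightarrow>\<^sub>M configurations"
proof (rule measurable_sigma_sets[OF sets_configurations_avoiding])
  show "avoiding_events \<subseteq> Pow {\<xi>. locally_finite_set \<xi>}"
    by (auto simp: avoiding_events_def avoiding_def)
  show "\<xi> \<in> space M \<rightarrow> {\<xi>. locally_finite_set \<xi>}" using assms(1) by auto
  fix A assume "A \<in> (avoiding_events :: 'b set set set)"
  then obtain B where B: "A = avoiding B" "B \<in> sets borel" "bounded B"
    by (auto simp: avoiding_events_def)
  have "\<xi> -` A \<inter> space M = space M - {\<omega> \<in> space M. \<exists>x\<in>\<xi> \<omega>. x \<in> B}"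
    using assms(1) by (auto simp: B(1) avoiding_def)
  then show "\<xi> -` A \<inter> space M \<in> sets M" using assms(2)[OF B(2,3)] by simp
qed

text \<open>The points of a configuration are enumerated measurably by the cells that contain exactly
  one of them; for the other cells \<open>pt\<close> returns the junk value 0.\<close>

definition pt :: "nat \<Rightarrow> 'a::euclidean_space set \<Rightarrow> 'a" where
  "pt j \<xi> = (if card (\<xi> \<inter> cell j) = 1 then the_elem (\<xi> \<inter> cell j) else 0)"

lemma pt_mem: "card (\<xi> \<inter> cell j) = 1 \<Longrightarrow> pt j \<xi> \<in> \<xi>"
  unfolding pt_def by (metis Int_iff card_1_singletonE insertI1 the_elem_eq)

lemma pt_measurable [measurable]: "pt j \<in> configurations \<rightarrow>\<^sub>M borel"
proof (rule measurableI)
  fix A :: "'a set" assume A: "A \<in> sets borel"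
  let ?S = "\<lambda>B k. {\<xi> \<in> space configurations. card (\<xi> \<inter> B) = k}"
  \<comment> \<open>If the cell holds one point, this point lies in \<open>A\<close> iff the
    intersection of the cell with \<open>A\<close> still holds one point. The last set is the
    contribution of the default value 0.\<close>
  have eq: "pt j -` A \<inter> space configurations =
    (?S (cell j) 1 \<inter> ?S (cell j \<inter> A) 1) \<union>
    (if 0 \<in> A then space configurations - ?S (cell j) 1 else {})"
  proof -
    have "pt j \<xi> \<in> A \<longleftrightarrow> card (\<xi> \<inter> (cell j \<inter> A)) = 1" if one: "card (\<xi> \<inter> cell j) = 1" for \<xi>
    proof -
      obtain x where x: "\<xi> \<inter> cell j = {x}" using one by (metis card_1_singletonE)
      then have "pt j \<xi> = x" by (simp add: pt_def)
      moreover have "\<xi> \<inter> (cell j \<inter> A) = {x} \<inter> A" using x by auto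
      ultimately show ?thesis by (cases "x \<in> A") auto
    qed
    then have "pt j \<xi> \<in> A \<longleftrightarrow> (if card (\<xi> \<inter> cell j) = 1 then card (\<xi> \<inter> (cell j \<inter> A)) = 1 else 0 \<in> A)" for \<xi>
      by (simp add: pt_def)
    then show ?thesis by (auto split: if_splits)
  qed
  have "cell j \<inter> A \<in> sets borel" "bounded (cell j \<inter> A)" using A by (auto intro: bounded_Int bounded_cell)
  then show "pt j -` A \<inter> space configurations \<in> sets configurations"
    unfolding eq using sets_count[of "cell j" 1] sets_count[of "cell j \<inter> A" 1]
    by (simp add: bounded_cell)
qed simp

lemma ex_pt:
  assumes "locally_finite_set \<xi>" "x \<in> \<xi>"
  shows "\<exists>j. card (\<xi> \<inter> cell j) = 1 \<and> pt j \<xi> = x"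
proof -
  have fin: "finite (\<xi> \<inter> ball x 1)" using assms(1) by (intro locally_finite_set_bounded) auto
  \<comment> \<open>Finitely many points are closed; deleting the other points near \<open>x\<close>
    leaves an open set, and a cell around \<open>x\<close> inside it isolates
    \<open>x\<close>.\<close>
  define U where "U = ball x 1 - (\<xi> \<inter> ball x 1 - {x})"
  have "open U" unfolding U_def using fin by (intro open_Diff finite_imp_closed) auto
  moreover have "x \<in> U" by (simp add: U_def)
  ultimately obtain j where j: "x \<in> cell j" "cell j \<subseteq> U" using cell_nbhd by blast
  then have "\<xi> \<inter> cell j = {x}" using assms(2) by (auto simp: U_def)
  then show ?thesis by (intro exI[of _ j]) (simp add: pt_def)
qed

section \<open>Measurable quantification over the points of a configuration\<close>

lemma bex_configuration_iff:
  assumes "locally_finite_set \<xi>"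
  shows "(\<exists>x\<in>\<xi>. P x) \<longleftrightarrow> (\<exists>j. card (\<xi> \<inter> cell j) = 1 \<and> P (pt j \<xi>))"
  using ex_pt[OF assms] pt_mem by metis

lemma pred_slot [measurable]: "Measurable.pred configurations (\<lambda>\<xi>. card (\<xi> \<inter> cell j) = 1)"
  using sets_count[OF cell_sets_borel bounded_cell] by (simp add: pred_def)

text \<open>Quantification over a random set becomes a countable disjunction over the enumeration
  \<open>pt\<close>. This lets the measurability prover handle every later definition that
  quantifies over arrivals, initial points or marked pairs.\<close>

lemma pred_bex_configuration [measurable (raw)]:
  assumes \<xi> [measurable]: "\<xi> \<in> M \<rightarrow>\<^sub>M configurations"
    and P: "Measurable.pred (M \<Otimes>\<^sub>M borel) (\<lambda>x. P (fst x) (snd x))"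
  shows "Measurable.pred M (\<lambda>\<omega>. \<exists>x\<in>\<xi> \<omega>. P \<omega> x)"
proof -
  have [measurable]: "Measurable.pred M (\<lambda>\<omega>. P \<omega> (pt j (\<xi> \<omega>)))" for j
    using measurable_compose[of "\<lambda>\<omega>. (\<omega>, pt j (\<xi> \<omega>))", OF _ P] by simp
  have "Measurable.pred M (\<lambda>\<omega>. \<exists>j. card (\<xi> \<omega> \<inter> cell j) = 1 \<and> P \<omega> (pt j (\<xi> \<omega>)))"
    by (intro pred_intros_countable pred_intros_logic measurable_compose[OF \<xi> pred_slot]) simp
  moreover have "locally_finite_set (\<xi> \<omega>)" if "\<omega> \<in> space M" for \<omega>
    using measurable_space[OF \<xi> that] by (simp add: space_configurations)
  ultimately show ?thesis
    by (subst measurable_cong[where g="\<lambda>\<omega>. \<exists>j. card (\<xi> \<omega> \<inter> cell j) = 1 \<and> P \<omega> (pt j (\<xi> \<omega>))"])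
      (auto simp: bex_configuration_iff)
qed

lemma pred_ball_configuration [measurable (raw)]:
  assumes [measurable]: "\<xi> \<in> M \<rightarrow>\<^sub>M configurations"
    and [measurable]: "Measurable.pred (M \<Otimes>\<^sub>M borel) (\<lambda>x. P (fst x) (snd x))"
  shows "Measurable.pred M (\<lambda>\<omega>. \<forall>x\<in>\<xi> \<omega>. P \<omega> x)"
proof -
  have "Measurable.pred M (\<lambda>\<omega>. \<not> (\<exists>x\<in>\<xi> \<omega>. \<not> P \<omega> x))" by measurable
  then show ?thesis by simp
qed

lemma pred_mem_configuration [measurable (raw)]:
  fixes \<xi> :: "'b \<Rightarrow> 'a::euclidean_space set"
  assumes [measurable]: "\<xi> \<in> M \<rightarrow>\<^sub>M configurations" "f \<in> M \<rightarrow>\<^sub>M borel"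
  shows "Measurable.pred M (\<lambda>\<omega>. f \<omega> \<in> \<xi> \<omega>)"
proof -
  have "Measurable.pred M (\<lambda>\<omega>. \<exists>x\<in>\<xi> \<omega>. x = f \<omega>)" by measurable
  then show ?thesis by simp
qed

lemma measurable_image_configuration:
  assumes \<xi> [measurable]: "\<xi> \<in> M \<rightarrow>\<^sub>M configurations"
    and [measurable]: "Measurable.pred (M \<Otimes>\<^sub>M borel) (\<lambda>x. P (fst x) (snd x))"
    and [measurable]: "(\<lambda>x. g (fst x) (snd x)) \<in> M \<Otimes>\<^sub>M borel \<rightarrow>\<^sub>M borel"
    and lf: "\<And>\<omega>. \<omega> \<in> space M \<Longrightarrow> locally_finite_set {g \<omega> x | x. x \<in> \<xi> \<omega> \<and> P \<omega> x}"
  shows "(\<lambda>\<omega>. {g \<omega> x | x. x \<in> \<xi> \<omega> \<and> P \<omega> x}) \<in> M \<rightarrow>\<^sub>M configurations"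
proof (rule measurable_configurationsI[OF lf])
  fix B :: "'c set" assume [measurable]: "B \<in> sets borel" and "bounded B"
  have "Measurable.pred M (\<lambda>\<omega>. \<exists>x\<in>\<xi> \<omega>. P \<omega> x \<and> g \<omega> x \<in> B)" by measurable
  then have "{\<omega> \<in> space M. \<exists>x\<in>\<xi> \<omega>. P \<omega> x \<and> g \<omega> x \<in> B} \<in> sets M" by (simp add: pred_def)
  moreover have "{\<omega> \<in> space M. \<exists>x\<in>{g \<omega> x | x. x \<in> \<xi> \<omega> \<and> P \<omega> x}. x \<in> B} =
    {\<omega> \<in> space M. \<exists>x\<in>\<xi> \<omega>. P \<omega> x \<and> g \<omega> x \<in> B}" by auto
  ultimately show "{\<omega> \<in> space M. \<exists>x\<in>{g \<omega> x | x. x \<in> \<xi> \<omega> \<and> P \<omega> x}. x \<in> B} \<in> sets M" by simp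
qed

lemma measurable_translation [measurable (raw)]:
  fixes \<xi> :: "'b \<Rightarrow> 'a::euclidean_space set"
  assumes [measurable]: "\<xi> \<in> M \<rightarrow>\<^sub>M configurations" "v \<in> M \<rightarrow>\<^sub>M borel"
  shows "(\<lambda>\<omega>. (+) (v \<omega>) ` \<xi> \<omega>) \<in> M \<rightarrow>\<^sub>M configurations"
proof -
  have "(\<lambda>\<omega>. {v \<omega> + x | x. x \<in> \<xi> \<omega> \<and> True}) \<in> M \<rightarrow>\<^sub>M configurations"
  proof (rule measurable_image_configuration)
    show "locally_finite_set {v \<omega> + x | x. x \<in> \<xi> \<omega> \<and> True}" if "\<omega> \<in> space M" for \<omega>
    proof -
      have "locally_finite_set (\<xi> \<omega>)"
        using measurable_space[OF assms(1) that] by (simp add: space_configurations)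
      then show ?thesis
        using locally_finite_set_translation[of "\<xi> \<omega>" "v \<omega>"] by (simp add: Setcompr_eq_image)
    qed
  qed measurable
  moreover have "(\<lambda>\<omega>. {v \<omega> + x | x. x \<in> \<xi> \<omega> \<and> True}) = (\<lambda>\<omega>. (+) (v \<omega>) ` \<xi> \<omega>)" by auto
  ultimately show ?thesis by simp
qed

lemma measurable_Int_configuration [measurable (raw)]:
  fixes \<xi> :: "'b \<Rightarrow> 'a::euclidean_space set"
  assumes \<xi> [measurable]: "\<xi> \<in> M \<rightarrow>\<^sub>M configurations" and [measurable]: "B \<in> sets borel"
  shows "(\<lambda>\<omega>. \<xi> \<omega> \<inter> B) \<in> M \<rightarrow>\<^sub>M configurations"
proof -
  have "(\<lambda>\<omega>. {x | x. x \<in> \<xi> \<omega> \<and> x \<in> B}) \<in> M \<rightarrow>\<^sub>M configurations"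
  proof (rule measurable_image_configuration)
    show "locally_finite_set {x | x. x \<in> \<xi> \<omega> \<and> x \<in> B}" if "\<omega> \<in> space M" for \<omega>
      using measurable_space[OF \<xi> that] unfolding space_configurations
      by (auto intro: locally_finite_set_mono[of "\<xi> \<omega>"])
  qed measurable
  then show ?thesis by (simp add: Int_def)
qed

section \<open>The process driven by a regular realization\<close>

text \<open>The window of times is open at the birth of \<open>q\<close> and closed at
  \<open>t\<close>: a state includes the effect of an arrival at its own time, as right-continuity
  demands.\<close>

definition survives :: "('a::metric_space \<times> real) set \<Rightarrow> (('a \<times> real) \<times> ('a \<times> real)) set \<Rightarrow>
    'a \<times> real \<Rightarrow> real \<Rightarrow> bool" where
  "survives n Z q t \<longleftrightarrow>
     (\<forall>p\<in>n. snd q < snd p \<and> snd p \<le> t \<and> dist (fst p) (fst q) \<le> 1 \<longrightarrow> (p, q) \<notin> Z)"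

text \<open>Survival up to \<open>snd p\<close> inclusive covers the mark of \<open>p\<close>
  itself. So \<open>q\<close>, if accepted, is still present when \<open>p\<close> arrives and wins
  against it.\<close>

definition blocks :: "('a::metric_space \<times> real) set \<Rightarrow> (('a \<times> real) \<times> ('a \<times> real)) set \<Rightarrow>
    'a \<times> real \<Rightarrow> 'a \<times> real \<Rightarrow> bool" where
  "blocks n Z q p \<longleftrightarrow>
     snd q < snd p \<and> dist (fst p) (fst q) \<le> 1 \<and> survives n Z q (snd p)"

text \<open>The iterates oscillate around the kernel of the relation \<open>blocks\<close>; at a point from which no
  chain of \<open>i\<close> arrivals descends they are constant from the \<open>i\<close>-th on.\<close>

primrec candidate :: "nat \<Rightarrow> ('a::metric_space \<times> real) set \<Rightarrow> 'a set \<Rightarrow>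
    (('a \<times> real) \<times> ('a \<times> real)) set \<Rightarrow> 'a \<times> real \<Rightarrow> bool" where
  "candidate 0 n h Z p \<longleftrightarrow> True"
| "candidate (Suc i) n h Z p \<longleftrightarrow>
     (\<forall>q\<in>all_points n h. blocks n Z q p \<longrightarrow> \<not> candidate i n h Z q)"

text \<open>Eventual truth of the iterates makes sense for every realization, also where they keep
  oscillating. As a countable combination of measurable, equivariant predicates it keeps the process
  measurable and equivariant off the regular realizations too.\<close>

definition accepted :: "('a::metric_space \<times> real) set \<Rightarrow> 'a set \<Rightarrow>
    (('a \<times> real) \<times> ('a \<times> real)) set \<Rightarrow> 'a \<times> real \<Rightarrow> bool" where
  "accepted n h Z p \<longleftrightarrow> (\<exists>i. \<forall>j\<ge>i. candidate j n h Z p)"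

text \<open>The lower bound 0 on the times confines the points alive at \<open>t\<close> to a
  bounded time interval, so that the state is locally finite for every locally finite
  \<open>n\<close>, regular or not.\<close>

definition alive :: "('a::metric_space \<times> real) set \<Rightarrow> 'a set \<Rightarrow>
    (('a \<times> real) \<times> ('a \<times> real)) set \<Rightarrow> real \<Rightarrow> ('a \<times> real) set" where
  "alive n h Z t =
     {q \<in> all_points n h. 0 \<le> snd q \<and> snd q \<le> t \<and> accepted n h Z q \<and> survives n Z q t}"

definition birth_death :: "('a::metric_space \<times> real) set \<Rightarrow> 'a set \<Rightarrow>
    (('a \<times> real) \<times> ('a \<times> real)) set \<Rightarrow> real \<Rightarrow> 'a set" where
  "birth_death n h Z t = fst ` alive n h Z t"

text \<open>Marks are ignored, so that finiteness of chains is a property of the arrivals alone and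
  serves every choice of marks.\<close>

primrec descending_chain :: "nat \<Rightarrow> ('a::metric_space \<times> real) set \<Rightarrow> 'a \<times> real \<Rightarrow> bool" where
  "descending_chain 0 n p \<longleftrightarrow> True"
| "descending_chain (Suc i) n p \<longleftrightarrow>
     (\<exists>q\<in>n. snd q < snd p \<and> dist (fst p) (fst q) \<le> 1 \<and> descending_chain i n q)"

lemma all_points_cases:
  assumes "q \<in> all_points n h"
  obtains "q \<in> n" | "fst q \<in> h" "snd q = 0"
  using assms by (auto simp: all_points_def)

text \<open>The almost sure properties on which the pathwise construction rests. The set
  \<open>Z\<close> is left arbitrary; only the transition rule ties it to marks
  \<open>I\<close>.\<close>

locale regular_arrivals =
  fixes n :: "('a::euclidean_space \<times> real) set" and h :: "'a set"
  assumes locally_finite_arrivals: "locally_finite_set n"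
    and locally_finite_initial: "locally_finite_set h"
    and hard_core_initial: "hard_core h"
    and arrival_pos: "p \<in> n \<Longrightarrow> 0 < snd p"
    and arrival_times: "inj_on snd n"
    and arrival_places: "inj_on fst n"
    and new_places: "p \<in> n \<Longrightarrow> fst p \<notin> h"
    and finite_chains: "p \<in> n \<Longrightarrow> \<exists>i. \<not> descending_chain i n p"
begin

lemma all_points_nonneg: "q \<in> all_points n h \<Longrightarrow> 0 \<le> snd q"
  using arrival_pos by (fastforce simp: all_points_def)

text \<open>States record locations, whereas marks belong to space-time points. Injectivity recovers
  the point from its location.\<close>

lemma inj_on_fst_all_points: "inj_on fst (all_points n h)"
proof (rule inj_onI)
  fix p q assume pq: "p \<in> all_points n h" "q \<in> all_points n h" "fst p = fst q"
  consider "p \<in> n" "q \<in> n" | "p \<in> n" "fst q \<in> h" | "fst p \<in> h" "q \<in> n"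
    | "snd p = 0" "snd q = 0"
    using pq(1,2) by (elim all_points_cases) blast+
  then show "p = q"
  proof cases
    case 1 then show ?thesis using inj_onD[OF arrival_places pq(3)] by blast
  next
    case 2 then show ?thesis using new_places[of p] pq(3) by simp
  next
    case 3 then show ?thesis using new_places[of q] pq(3) by simp
  next
    case 4 then show ?thesis using pq(3) by (simp add: prod_eq_iff)
  qed
qed

section \<open>The kernel equation\<close>

lemma candidate_initial:
  assumes "snd q = 0"
  shows "candidate k n h Z q"
proof (cases k)
  case (Suc l)
  have "\<not> blocks n Z r q" if "r \<in> all_points n h" for r
    using all_points_nonneg[OF that] assms by (simp add: blocks_def)
  then show ?thesis using Suc by simp
qed simp

lemma accepted_initial: "snd q = 0 \<Longrightarrow> accepted n h Z q"
  by (simp add: accepted_def candidate_initial)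

text \<open>Each unfolding of \<open>candidate\<close> passes to an earlier point within distance 1.
  If no chain of \<open>i\<close> arrivals descends from \<open>p\<close>, every branch ends within
  \<open>i\<close> unfoldings at a point of time 0, where all iterates agree, or at a point with no
  blocker. The case \<open>i = 0\<close> is void, since a chain of no steps always exists.\<close>

lemma candidate_stable:
  assumes "\<not> descending_chain i n p" "i \<le> j"
  shows "candidate j n h Z p = candidate i n h Z p"
  using assms
proof (induction i arbitrary: p j)
  case (Suc i)
  obtain j' where j': "j = Suc j'" "i \<le> j'" using Suc.prems(2) by (cases j) auto
  have "candidate j' n h Z q = candidate i n h Z q"
    if q: "q \<in> all_points n h" "blocks n Z q p" for q
    using q(1)
  proof (cases rule: all_points_cases)
    case 1
    then have "\<not> descending_chain i n q" using Suc.prems(1) q(2) by (auto simp: blocks_def)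
    then show ?thesis using Suc.IH j'(2) by blast
  qed (simp add: candidate_initial)
  then show ?case unfolding j'(1) candidate.simps by blast
qed simp

text \<open>Beyond the length of the chains from \<open>p\<close> the iterates at \<open>p\<close>
  and at its blockers are constant, so the alternating recursion passes to the limit and becomes an
  equation for the kernel.\<close>

lemma accepted_iff:
  assumes "p \<in> n"
  shows "accepted n h Z p \<longleftrightarrow> (\<forall>q\<in>all_points n h. blocks n Z q p \<longrightarrow> \<not> accepted n h Z q)"
proof -
  obtain i where i: "\<not> descending_chain i n p" using finite_chains[OF assms] by blast
  then obtain k where k: "i = Suc k" by (cases i) auto
  have stab: "candidate k n h Z q = accepted n h Z q" if q: "q \<in> all_points n h" "blocks n Z q p" for q
    using q(1)
  proof (cases rule: all_points_cases)
    case 1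
    then have "\<not> descending_chain k n q" using i k q(2) by (auto simp: blocks_def)
    then have "\<forall>j\<ge>k. candidate j n h Z q = candidate k n h Z q" using candidate_stable by blast
    then show ?thesis unfolding accepted_def by (metis le_refl nle_le)
  qed (simp add: candidate_initial accepted_initial)
  have "\<forall>j\<ge>i. candidate j n h Z p = candidate i n h Z p" using candidate_stable[OF i] by blast
  then have "accepted n h Z p \<longleftrightarrow> candidate i n h Z p"
    unfolding accepted_def by (metis le_refl nle_le)
  also have "\<dots> \<longleftrightarrow> (\<forall>q\<in>all_points n h. blocks n Z q p \<longrightarrow> \<not> accepted n h Z q)"
    unfolding k candidate.simps using stab by blast
  finally show ?thesis .
qed

text \<open>The explicit left limit of \<open>alive\<close>: births and killings strictly before
  \<open>t\<close>.\<close>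

definition alive_before :: "(('a \<times> real) \<times> ('a \<times> real)) set \<Rightarrow> real \<Rightarrow> ('a \<times> real) set" where
  "alive_before Z t = {q \<in> all_points n h. snd q < t \<and> accepted n h Z q \<and>
     (\<forall>p\<in>n. snd q < snd p \<and> snd p < t \<and> dist (fst p) (fst q) \<le> 1 \<longrightarrow> (p, q) \<notin> Z)}"

lemma birth_death_initial: "birth_death n h Z 0 = h"
proof -
  have "alive n h Z 0 = h \<times> {0}"
    using arrival_pos accepted_initial
    by (force simp: alive_def all_points_def survives_def)
  then show ?thesis by (simp add: birth_death_def)
qed

text \<open>Of two close points alive at \<open>t\<close>, the earlier one survives beyond the
  arrival of the later one and therefore blocks it, against the kernel equation. Equal times occur
  only among initial points, which are hard-core by assumption.\<close>

lemma hard_core_birth_death_state: "hard_core (birth_death n h Z t)"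
  unfolding hard_core_def birth_death_def
proof (clarify, rule ccontr)
  fix x s y r
  assume xy: "(x, s) \<in> alive n h Z t" "(y, r) \<in> alive n h Z t" "fst (x, s) \<noteq> fst (y, r)"
    and near: "\<not> 1 < dist (fst (x, s)) (fst (y, r))"
  have key: False
    if pq: "p \<in> alive n h Z t" "q \<in> alive n h Z t" "dist (fst p) (fst q) \<le> 1" "snd q < snd p" for p q
  proof -
    have "p \<in> n"
      using pq(1,4) all_points_nonneg[of q] pq(2) by (auto simp: alive_def all_points_def)
    have "blocks n Z q p" using pq by (auto simp: blocks_def alive_def survives_def)
    then show False using accepted_iff[OF \<open>p \<in> n\<close>] pq by (auto simp: alive_def)
  qed
  consider "s < r" | "r < s" | "s = r" by linarith
  then show False
  proof cases
    case 1 then show False using key[of "(y, r)" "(x, s)"] xy near by (simp add: dist_commute)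
  next
    case 2 then show False using key[of "(x, s)" "(y, r)"] xy near by simp
  next
    case 3
    have "(x, s) \<notin> n \<or> (y, r) \<notin> n"
      using inj_onD[OF arrival_times, of "(x, s)" "(y, r)"] 3 xy(3) by auto
    moreover have "(x, s) \<in> all_points n h" "(y, r) \<in> all_points n h" using xy by (auto simp: alive_def)
    ultimately have "x \<in> h" "y \<in> h"
      using arrival_pos[of "(x, s)"] arrival_pos[of "(y, r)"] 3 by (auto simp: all_points_def)
    then show False using hard_core_initial xy(3) near by (auto simp: hard_core_def)
  qed
qed

end

lemma locally_finite_birth_death:
  fixes n :: "('a::euclidean_space \<times> real) set"
  assumes "locally_finite_set n" "locally_finite_set h"
  shows "locally_finite_set (birth_death n h Z t)"
  unfolding locally_finite_set_iff_bounded
proof (intro allI impI)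
  fix B :: "'a set" assume "bounded B"
  then have "finite (n \<inter> (B \<times> {0..t}))" "finite (h \<inter> B)"
    using assms by (auto intro!: locally_finite_set_bounded bounded_Times)
  then have "finite (fst ` (n \<inter> (B \<times> {0..t})) \<union> (h \<inter> B))" by simp
  moreover have "birth_death n h Z t \<inter> B \<subseteq> fst ` (n \<inter> (B \<times> {0..t})) \<union> (h \<inter> B)"
    by (force simp: birth_death_def alive_def all_points_def)
  ultimately show "finite (birth_death n h Z t \<inter> B)" by (rule finite_subset[rotated])
qed

context regular_arrivals
begin

section \<open>Evolution between arrivals\<close>

lemma finite_arrivals_near:
  assumes "compact K"
  shows "finite {p \<in> n. fst p \<in> K + cball 0 1 \<and> snd p \<le> t}"
proof -
  have "bounded (K + cball 0 1)"
  proof -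
    have "K + cball 0 1 = (\<Union>x\<in>K. \<Union>y\<in>cball 0 1. {x + y})" by (auto simp: set_plus_def)
    then show ?thesis
      using bounded_sums[OF compact_imp_bounded[OF assms] bounded_cball[of "0::'a" 1]] by simp
  qed
  then have "finite (n \<inter> ((K + cball 0 1) \<times> {0..t}))"
    by (intro locally_finite_set_bounded locally_finite_arrivals bounded_Times) auto
  then show ?thesis by (rule finite_subset[rotated]) (use arrival_pos in force)
qed

lemma near_mem: "x \<in> K \<Longrightarrow> dist y x \<le> 1 \<Longrightarrow> y \<in> K + cball 0 (1::real)"
  for x y :: 'a
  using set_plus_intro[of x K "y - x" "cball 0 1"] by (simp add: dist_norm norm_minus_commute)

lemma all_points_mem_near:
  assumes "q \<in> all_points n h" "fst q \<in> K" "0 < snd q"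
  shows "q \<in> n \<and> fst q \<in> K + cball 0 1"
  using assms near_mem[of "fst q" K "fst q"] by (auto simp: all_points_def)

text \<open>A birth in \<open>K\<close> and the death of a point of \<open>K\<close> both require an
  arrival in \<open>K + cball 0 1\<close>; the window \<open>t < snd p \<le> s\<close> contains
  none.\<close>

lemma birth_death_eq_right:
  assumes "0 \<le> t" "t \<le> s"
    and none: "\<And>p. p \<in> n \<Longrightarrow> fst p \<in> K + cball 0 1 \<Longrightarrow> snd p \<le> t \<or> s < snd p"
  shows "birth_death n h Z s \<inter> K = birth_death n h Z t \<inter> K"
proof -
  have "q \<in> alive n h Z s \<longleftrightarrow> q \<in> alive n h Z t" if q: "fst q \<in> K" for q
  proof
    assume s: "q \<in> alive n h Z s"
    have "snd q \<le> t"
    proof (rule ccontr)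
      assume "\<not> snd q \<le> t"
      then show False
        using s none[of q] all_points_mem_near[of q K] q \<open>0 \<le> t\<close> by (auto simp: alive_def)
    qed
    then show "q \<in> alive n h Z t" using s \<open>t \<le> s\<close> by (auto simp: alive_def survives_def)
  next
    assume t: "q \<in> alive n h Z t"
    have "survives n Z q s" unfolding survives_def
    proof (intro ballI impI)
      fix p assume p: "p \<in> n" "snd q < snd p \<and> snd p \<le> s \<and> dist (fst p) (fst q) \<le> 1"
      then have "snd p \<le> t" using none[of p] near_mem[OF q, of "fst p"] by auto
      then show "(p, q) \<notin> Z" using t p by (auto simp: alive_def survives_def)
    qed
    then show "q \<in> alive n h Z s" using t \<open>t \<le> s\<close> by (auto simp: alive_def)
  qed
  then show ?thesis unfolding birth_death_def by blast
qed

lemma birth_death_eq_left: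
  assumes "0 \<le> s" "s < t"
    and none: "\<And>p. p \<in> n \<Longrightarrow> fst p \<in> K + cball 0 1 \<Longrightarrow> snd p \<le> s \<or> t \<le> snd p"
  shows "birth_death n h Z s \<inter> K = fst ` alive_before Z t \<inter> K"
proof -
  have "q \<in> alive n h Z s \<longleftrightarrow> q \<in> alive_before Z t" if q: "fst q \<in> K" for q
  proof
    assume s: "q \<in> alive n h Z s"
    have "(p, q) \<notin> Z" if p: "p \<in> n" "snd q < snd p \<and> snd p < t \<and> dist (fst p) (fst q) \<le> 1" for p
    proof -
      have "snd p \<le> s" using none[of p] near_mem[OF q, of "fst p"] p by auto
      then show ?thesis using s p by (auto simp: alive_def survives_def)
    qed
    then show "q \<in> alive_before Z t" using s \<open>s < t\<close> by (auto simp: alive_def alive_before_def)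
  next
    assume t: "q \<in> alive_before Z t"
    then have all: "q \<in> all_points n h" by (simp add: alive_before_def)
    have "snd q \<le> s"
    proof (rule ccontr)
      assume "\<not> snd q \<le> s"
      then show False
        using t none[of q] all_points_mem_near[OF all q] \<open>0 \<le> s\<close> by (auto simp: alive_before_def)
    qed
    then show "q \<in> alive n h Z s"
      using t \<open>s < t\<close> all_points_nonneg[OF all] by (auto simp: alive_def alive_before_def survives_def)
  qed
  then show ?thesis unfolding birth_death_def by blast
qed

lemma birth_death_eq_before:
  assumes "0 \<le> t"
    and none: "\<And>p. p \<in> n \<Longrightarrow> snd p = t \<Longrightarrow> fst p \<in> K + cball 0 1 \<Longrightarrow> False" and "0 < t"
  shows "birth_death n h Z t \<inter> K = fst ` alive_before Z t \<inter> K"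
proof -
  have "q \<in> alive n h Z t \<longleftrightarrow> q \<in> alive_before Z t" if q: "fst q \<in> K" for q
  proof
    assume s: "q \<in> alive n h Z t"
    then have all: "q \<in> all_points n h" by (simp add: alive_def)
    have "snd q \<noteq> t" using all_points_mem_near[OF all q] none[of q] \<open>0 < t\<close> by auto
    then show "q \<in> alive_before Z t" using s by (auto simp: alive_def alive_before_def survives_def)
  next
    assume t: "q \<in> alive_before Z t"
    then have all: "q \<in> all_points n h" by (simp add: alive_before_def)
    have "survives n Z q t" unfolding survives_def
    proof (intro ballI impI)
      fix p assume p: "p \<in> n" "snd q < snd p \<and> snd p \<le> t \<and> dist (fst p) (fst q) \<le> 1"
      then have "snd p \<noteq> t" using none[of p] near_mem[OF q, of "fst p"] by auto
      then show "(p, q) \<notin> Z" using t p by (auto simp: alive_before_def)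
    qed
    then show "q \<in> alive n h Z t"
      using t all_points_nonneg[OF all] by (auto simp: alive_def alive_before_def)
  qed
  then show ?thesis unfolding birth_death_def by blast
qed

lemma eventually_no_arrival_right:
  assumes "compact K"
  shows "\<forall>\<^sub>F s in at_right t. \<forall>p\<in>n. fst p \<in> K + cball 0 1 \<longrightarrow> snd p \<le> t \<or> s < snd p"
proof -
  \<comment> \<open>The horizon \<open>t + 1\<close> leaves finitely many arrivals near
    \<open>K\<close>, and each of them is avoided by all \<open>s\<close> close enough to
    \<open>t\<close>.\<close>
  let ?F = "{p \<in> n. fst p \<in> K + cball 0 1 \<and> snd p \<le> t + 1}"
  have "\<forall>\<^sub>F s in at_right t. snd p \<le> t \<or> s < snd p" for p :: "'a \<times> real"
    by (cases "snd p \<le> t") (auto simp: eventually_at_right_field not_le)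
  then have "\<forall>\<^sub>F s in at_right t. \<forall>p\<in>?F. snd p \<le> t \<or> s < snd p"
    by (intro eventually_ball_finite finite_arrivals_near[OF assms]) blast
  moreover have "\<forall>\<^sub>F s in at_right t. s < t + 1" by (auto simp: eventually_at_right_field intro: exI[of _ "t+1"])
  ultimately show ?thesis
    by eventually_elim force
qed

lemma eventually_no_arrival_left:
  assumes "compact K"
  shows "\<forall>\<^sub>F s in at_left t. \<forall>p\<in>n. fst p \<in> K + cball 0 1 \<longrightarrow> snd p \<le> s \<or> t \<le> snd p"
proof -
  let ?F = "{p \<in> n. fst p \<in> K + cball 0 1 \<and> snd p \<le> t}"
  have "\<forall>\<^sub>F s in at_left t. snd p \<le> s \<or> t \<le> snd p" for p :: "'a \<times> real"
  proof (cases "t \<le> snd p")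
    case False
    then show ?thesis
      by (auto simp: eventually_at_left_field intro!: exI[of _ "snd p"])
  qed auto
  then have "\<forall>\<^sub>F s in at_left t. \<forall>p\<in>?F. snd p \<le> s \<or> t \<le> snd p"
    by (intro eventually_ball_finite finite_arrivals_near[OF assms]) blast
  then show ?thesis
    by eventually_elim force
qed

lemma eventually_birth_death_left:
  assumes "0 < t" "compact K"
  shows "\<forall>\<^sub>F s in at_left t. birth_death n h Z s \<inter> K = fst ` alive_before Z t \<inter> K"
proof -
  have "\<forall>\<^sub>F s in at_left t. s < t" by (simp add: eventually_at_filter)
  moreover have "\<forall>\<^sub>F s in at_left t. 0 \<le> s"
    using assms(1) by (auto simp: eventually_at_left_field intro: exI[of _ 0])
  ultimately show ?thesis
    using eventually_no_arrival_left[OF assms(2), of t]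
    by eventually_elim (intro birth_death_eq_left, auto)
qed

lemma left_lim_birth_death:
  assumes "0 < t"
  shows "left_lim (birth_death n h Z) t = fst ` alive_before Z t"
proof (rule set_eqI)
  fix x
  \<comment> \<open>\<open>left_lim\<close> is defined point by point, so the eventual equality on
    compact sets is used for singletons.\<close>
  have ev: "\<forall>\<^sub>F s in at_left t. x \<in> birth_death n h Z s \<longleftrightarrow> x \<in> fst ` alive_before Z t"
    using eventually_birth_death_left[OF assms compact_sing[of x], of Z]
    by eventually_elim auto
  have "x \<in> left_lim (birth_death n h Z) t \<longleftrightarrow> (\<forall>\<^sub>F s in at_left t. x \<in> birth_death n h Z s)"
    by (simp add: left_lim_def)
  also have "\<dots> \<longleftrightarrow> (\<forall>\<^sub>F s in at_left t. x \<in> fst ` alive_before Z t)"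
    by (rule eventually_cong[OF ev]) simp
  also have "\<dots> \<longleftrightarrow> x \<in> fst ` alive_before Z t" by simp
  finally show "x \<in> left_lim (birth_death n h Z) t \<longleftrightarrow> x \<in> fst ` alive_before Z t" .
qed

lemma jump_condition_birth_death:
  assumes "compact K"
  shows "jump_condition n (birth_death n h Z) K"
  unfolding jump_condition_def
proof (intro conjI allI impI)
  fix t :: real assume t: "0 \<le> t"
  have "\<forall>\<^sub>F s in at_right t. t < s" by (simp add: eventually_at_filter)
  then show "\<forall>\<^sub>F s in at_right t. birth_death n h Z s \<inter> K = birth_death n h Z t \<inter> K"
    using eventually_no_arrival_right[OF assms, of t]
    by eventually_elim (intro birth_death_eq_right, use t in auto)
next
  fix t :: real assume t: "0 < t"
  show "\<forall>\<^sub>F s in at_left t. birth_death n h Z s \<inter> K = left_lim (birth_death n h Z) t \<inter> K"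
    unfolding left_lim_birth_death[OF t] by (rule eventually_birth_death_left[OF t assms])
  assume ne: "birth_death n h Z t \<inter> K \<noteq> left_lim (birth_death n h Z) t \<inter> K"
  show "\<exists>p\<in>n. snd p = t \<and> fst p \<in> K + cball 0 1"
  proof (rule ccontr)
    assume "\<not> ?thesis"
    then have "birth_death n h Z t \<inter> K = fst ` alive_before Z t \<inter> K"
      using t by (intro birth_death_eq_before) auto
    then show False using ne left_lim_birth_death[OF t] by simp
  qed
qed

section \<open>The update at an arrival\<close>

text \<open>Arrival times are distinct, so between the left limit and the state at time
  \<open>snd p\<close> only the marks of \<open>p\<close> act, and only \<open>p\<close> can be
  new.\<close>

lemma alive_at_arrival:
  assumes "p \<in> n" "q \<in> all_points n h"
  shows "q \<in> alive n h Z (snd p) \<longleftrightarrow>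
    (q = p \<and> accepted n h Z p) \<or>
    (q \<in> alive_before Z (snd p) \<and> (dist (fst p) (fst q) \<le> 1 \<longrightarrow> (p, q) \<notin> Z))"
proof -
  have eq: "p' = p" if "p' \<in> n" "snd p' = snd p" for p'
    using arrival_times assms(1) that by (auto simp: inj_on_def)
  have q0: "q \<in> n" if "snd q = snd p"
    using assms(2) arrival_pos[OF assms(1)] that by (auto simp: all_points_def)
  have "0 < snd p" using arrival_pos[OF assms(1)] .
  show ?thesis
  proof (cases "snd q < snd p")
    case True
    then have "q \<noteq> p" by auto
    have "survives n Z q (snd p) \<longleftrightarrow>
      (\<forall>p'\<in>n. snd q < snd p' \<and> snd p' < snd p \<and> dist (fst p') (fst q) \<le> 1 \<longrightarrow> (p', q) \<notin> Z) \<and>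
      (dist (fst p) (fst q) \<le> 1 \<longrightarrow> (p, q) \<notin> Z)"
      unfolding survives_def using eq assms(1) True by (metis linorder_le_less_linear order_le_less)
    then show ?thesis
      using \<open>q \<noteq> p\<close> assms(2) True all_points_nonneg[OF assms(2)]
      by (auto simp: alive_def alive_before_def)
  next
    case False
    have "q = p" if "q \<in> alive n h Z (snd p)"
      using that False eq[of q] q0 by (auto simp: alive_def)
    moreover have "p \<in> alive n h Z (snd p)" if "accepted n h Z p"
      using that assms(1) arrival_pos[OF assms(1)] by (auto simp: alive_def all_points_def survives_def)
    ultimately show ?thesis using False by (auto simp: alive_def alive_before_def)
  qed
qed

lemma transition_rule_birth_death:
  assumes anti: "\<And>p q. (p, q) \<in> marked_pairs n h \<Longrightarrow> I q p \<longleftrightarrow> \<not> I p q"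
    and Z: "Z = {(p, q) \<in> marked_pairs n h. I p q}"
  shows "transition_rule n h I (birth_death n h Z) K"
  unfolding transition_rule_def
proof (intro ballI impI)
  fix p assume p: "p \<in> n" "0 < snd p \<and> fst p \<in> K + cball 0 1"
  let ?L = "alive_before Z (snd p)"
  have L: "left_lim (birth_death n h Z) (snd p) = fst ` ?L"
    using left_lim_birth_death p by blast
  have Lall: "?L \<subseteq> all_points n h" "\<And>q. q \<in> ?L \<Longrightarrow> snd q < snd p" by (auto simp: alive_before_def)
  \<comment> \<open>A point whose location is occupied in the left limit is itself alive there,
    because locations identify space-time points.\<close>
  have inter: "interacting_points n h (birth_death n h Z) p = {q \<in> ?L. dist (fst p) (fst q) \<le> 1}"
  proof -
    have "q \<in> ?L" if "q \<in> all_points n h" "fst q \<in> fst ` ?L" for q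
    proof -
      obtain r where "r \<in> ?L" "fst q = fst r" using \<open>fst q \<in> fst ` ?L\<close> by auto
      then have "q = r" using inj_on_fst_all_points that(1) Lall(1) by (meson inj_onD subsetD)
      then show ?thesis using \<open>r \<in> ?L\<close> by simp
    qed
    then show ?thesis unfolding interacting_points_def L using Lall by auto
  qed
  have mark: "(p, q) \<in> Z \<longleftrightarrow> I p q" "I q p \<longleftrightarrow> \<not> I p q" if "q \<in> ?L" for q
  proof -
    have "(p, q) \<in> marked_pairs n h" using p(1) that Lall by (auto simp: marked_pairs_def)
    then show "(p, q) \<in> Z \<longleftrightarrow> I p q" "I q p \<longleftrightarrow> \<not> I p q" using anti unfolding Z by auto
  qed
  \<comment> \<open>Being an accepted blocker of \<open>p\<close> means being alive at time
    \<open>snd p\<close>, earlier than \<open>p\<close> and near it. This translates the kernel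
    equation into the acceptance rule.\<close>
  have acc: "accepted n h Z p \<longleftrightarrow> (\<forall>q\<in>interacting_points n h (birth_death n h Z) p. I p q)"
  proof -
    have "accepted n h Z p \<longleftrightarrow> (\<forall>q\<in>all_points n h. blocks n Z q p \<longrightarrow> \<not> accepted n h Z q)"
      by (rule accepted_iff[OF p(1)])
    also have "\<dots> \<longleftrightarrow> (\<forall>q\<in>?L. dist (fst p) (fst q) \<le> 1 \<longrightarrow> (p, q) \<in> Z)"
    proof -
      have "blocks n Z q p \<and> accepted n h Z q \<longleftrightarrow> q \<in> ?L \<and> dist (fst p) (fst q) \<le> 1 \<and> (p, q) \<notin> Z"
        if q: "q \<in> all_points n h" for q
      proof -
        have "blocks n Z q p \<and> accepted n h Z q \<longleftrightarrow>
            snd q < snd p \<and> dist (fst p) (fst q) \<le> 1 \<and> q \<in> alive n h Z (snd p)"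
          using q all_points_nonneg[OF q] by (auto simp: blocks_def alive_def)
        also have "\<dots> \<longleftrightarrow> q \<in> ?L \<and> dist (fst p) (fst q) \<le> 1 \<and> (p, q) \<notin> Z"
          using alive_at_arrival[OF p(1) q, of Z] Lall(2)[of q] Lall(2)[of p] by blast
        finally show ?thesis .
      qed
      then show ?thesis using Lall(1) by blast
    qed
    also have "\<dots> \<longleftrightarrow> (\<forall>q\<in>interacting_points n h (birth_death n h Z) p. I p q)"
      unfolding inter using mark(1) by auto
    finally show ?thesis .
  qed
  have alive: "q \<in> alive n h Z (snd p) \<longleftrightarrow>
      (q = p \<and> accepted n h Z p) \<or> (q \<in> ?L \<and> (dist (fst p) (fst q) \<le> 1 \<longrightarrow> I q p))" for q
  proof (cases "q \<in> all_points n h")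
    case True
    then show ?thesis using alive_at_arrival[OF p(1) True, of Z] mark by blast
  next
    case False
    then show ?thesis using Lall(1) p(1) by (auto simp: alive_def all_points_def)
  qed
  have bd: "birth_death n h Z (snd p) = (if accepted n h Z p then {fst p} else {}) \<union>
      {fst q | q. q \<in> ?L \<and> (dist (fst p) (fst q) \<le> 1 \<longrightarrow> I q p)}"
  proof -
    have "alive n h Z (snd p) = (if accepted n h Z p then {p} else {}) \<union>
        {q \<in> ?L. dist (fst p) (fst q) \<le> 1 \<longrightarrow> I q p}"
      by (rule set_eqI) (simp add: alive)
    then have "birth_death n h Z (snd p) = (if accepted n h Z p then {fst p} else {}) \<union>
        fst ` {q \<in> ?L. dist (fst p) (fst q) \<le> 1 \<longrightarrow> I q p}"
      by (simp add: birth_death_def image_Un)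
    then show ?thesis by (simp only: image_Collect)
  qed
  \<comment> \<open>Outside the ball \<open>p\<close> is neither added nor able to kill; inside it
    the distance condition on \<open>q\<close> holds automatically.\<close>
  have out: "x \<in> birth_death n h Z (snd p) \<longleftrightarrow> x \<in> fst ` ?L" if "x \<notin> cball (fst p) 1" for x
  proof -
    have "x \<notin> (if accepted n h Z p then {fst p} else {})" using that by auto
    then have "x \<in> birth_death n h Z (snd p) \<longleftrightarrow> (\<exists>q\<in>?L. x = fst q \<and> (dist (fst p) (fst q) \<le> 1 \<longrightarrow> I q p))"
      unfolding bd by blast
    then show ?thesis using that by auto
  qed
  have ins: "x \<in> birth_death n h Z (snd p) \<longleftrightarrow> x \<in> (if accepted n h Z p then {fst p} else {}) \<union>
      {fst q | q. q \<in> {q \<in> ?L. dist (fst p) (fst q) \<le> 1} \<and> I q p}" if "x \<in> cball (fst p) 1" for x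
  proof -
    have "(\<exists>q\<in>?L. x = fst q \<and> (dist (fst p) (fst q) \<le> 1 \<longrightarrow> I q p)) \<longleftrightarrow>
      (\<exists>q\<in>?L. x = fst q \<and> dist (fst p) (fst q) \<le> 1 \<and> I q p)"
      using that by (intro bex_cong) auto
    then show ?thesis unfolding bd by blast
  qed
  show "birth_death n h Z (snd p) \<inter> (K - cball (fst p) 1) =
      left_lim (birth_death n h Z) (snd p) \<inter> (K - cball (fst p) 1) \<and>
    birth_death n h Z (snd p) \<inter> (K \<inter> cball (fst p) 1) =
      K \<inter> ((if \<forall>q\<in>interacting_points n h (birth_death n h Z) p. I p q then {fst p} else {}) \<union>
        {fst q |q. q \<in> interacting_points n h (birth_death n h Z) p \<and> I q p})"
  proof (intro conjI)
    show "birth_death n h Z (snd p) \<inter> (K - cball (fst p) 1) =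
      left_lim (birth_death n h Z) (snd p) \<inter> (K - cball (fst p) 1)"
      unfolding L using out by blast
    have sub: "(if accepted n h Z p then {fst p} else {}) \<union>
      {fst q | q. q \<in> {q \<in> ?L. dist (fst p) (fst q) \<le> 1} \<and> I q p} \<subseteq> cball (fst p) 1"
      by auto
    show "birth_death n h Z (snd p) \<inter> (K \<inter> cball (fst p) 1) =
      K \<inter> ((if \<forall>q\<in>interacting_points n h (birth_death n h Z) p. I p q then {fst p} else {}) \<union>
        {fst q |q. q \<in> interacting_points n h (birth_death n h Z) p \<and> I q p})"
      unfolding acc[symmetric] unfolding inter
    proof (rule set_eqI)
      fix x
      show "x \<in> birth_death n h Z (snd p) \<inter> (K \<inter> cball (fst p) 1) \<longleftrightarrow>
        x \<in> K \<inter> ((if accepted n h Z p then {fst p} else {}) \<union>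
          {fst q | q. q \<in> {q \<in> ?L. dist (fst p) (fst q) \<le> 1} \<and> I q p})"
      proof (cases "x \<in> cball (fst p) 1")
        case True
        then show ?thesis unfolding Int_iff ins[OF True] by (metis (no_types))
      next
        case False
        with sub have "x \<notin> (if accepted n h Z p then {fst p} else {}) \<union>
          {fst q | q. q \<in> {q \<in> ?L. dist (fst p) (fst q) \<le> 1} \<and> I q p}" by (rule contra_subsetD)
        with False show ?thesis unfolding Int_iff by (metis (no_types))
      qed
    qed
  qed
qed

lemma hard_core_birth_death_process:
  assumes "\<And>p q. (p, q) \<in> marked_pairs n h \<Longrightarrow> I q p \<longleftrightarrow> \<not> I p q"
    and "Z = {(p, q) \<in> marked_pairs n h. I p q}"
  shows "hard_core_birth_death n h I (birth_death n h Z)"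
  unfolding hard_core_birth_death_def
  using birth_death_initial hard_core_birth_death_state jump_condition_birth_death
    transition_rule_birth_death[OF assms]
    locally_finite_birth_death[OF locally_finite_arrivals locally_finite_initial]
  by blast

end

section \<open>Measurability and equivariance\<close>

lemma borel_measurable_fst' [measurable (raw)]:
  fixes f :: "'b \<Rightarrow> 'a::second_countable_topology \<times> 'c::second_countable_topology"
  shows "f \<in> M \<rightarrow>\<^sub>M borel \<Longrightarrow> (\<lambda>x. fst (f x)) \<in> M \<rightarrow>\<^sub>M borel"
  by (rule measurable_compose[OF _ borel_measurable_continuous_onI]) (auto intro: continuous_intros)

lemma borel_measurable_snd' [measurable (raw)]:
  fixes f :: "'b \<Rightarrow> 'a::second_countable_topology \<times> 'c::second_countable_topology"
  shows "f \<in> M \<rightarrow>\<^sub>M borel \<Longrightarrow> (\<lambda>x. snd (f x)) \<in> M \<rightarrow>\<^sub>M borel"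
  by (rule measurable_compose[OF _ borel_measurable_continuous_onI]) (auto intro: continuous_intros)

lemma pred_survives [measurable (raw)]:
  assumes [measurable]: "n \<in> M \<rightarrow>\<^sub>M configurations" "Z \<in> M \<rightarrow>\<^sub>M configurations"
    "q \<in> M \<rightarrow>\<^sub>M borel" "t \<in> M \<rightarrow>\<^sub>M borel"
  shows "Measurable.pred M (\<lambda>\<omega>. survives (n \<omega>) (Z \<omega>) (q \<omega> :: 'a::euclidean_space \<times> real) (t \<omega>))"
  unfolding survives_def by measurable

lemma pred_blocks [measurable (raw)]:
  assumes [measurable]: "n \<in> M \<rightarrow>\<^sub>M configurations" "Z \<in> M \<rightarrow>\<^sub>M configurations"
    "q \<in> M \<rightarrow>\<^sub>M borel" "p \<in> M \<rightarrow>\<^sub>M borel"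
  shows "Measurable.pred M (\<lambda>\<omega>. blocks (n \<omega>) (Z \<omega>) (q \<omega> :: 'a::euclidean_space \<times> real) (p \<omega>))"
  unfolding blocks_def by measurable

lemma ball_all_points:
  "(\<forall>q\<in>all_points n h. P q) \<longleftrightarrow> (\<forall>q\<in>n. P q) \<and> (\<forall>x\<in>h. P (x, 0))"
  by (auto simp: all_points_def)

lemma bex_all_points:
  "(\<exists>q\<in>all_points n h. P q) \<longleftrightarrow> (\<exists>q\<in>n. P q) \<or> (\<exists>x\<in>h. P (x, 0))"
  by (auto simp: all_points_def)

text \<open>The point is a coordinate of the space because the recursion quantifies over it; initial
  points enter as \<open>(x, 0)\<close>.\<close>

lemma pred_candidate_aux:
  "Measurable.pred (configurations \<Otimes>\<^sub>M configurations \<Otimes>\<^sub>M configurations \<Otimes>\<^sub>M borel)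
     (\<lambda>(n, h, Z, p :: 'a::euclidean_space \<times> real). candidate i n h Z p)"
proof (induction i)
  case (Suc i)
  let ?M = "configurations \<Otimes>\<^sub>M configurations \<Otimes>\<^sub>M configurations \<Otimes>\<^sub>M borel ::
    (('a \<times> real) set \<times> 'a set \<times> (('a \<times> real) \<times> 'a \<times> real) set \<times> 'a \<times> real) measure"
  have [measurable]: "Measurable.pred (?M \<Otimes>\<^sub>M borel) (\<lambda>y. candidate i (fst (fst y)) (fst (snd (fst y)))
      (fst (snd (snd (fst y)))) (snd y))"
    using measurable_compose[OF _ Suc.IH, of "\<lambda>y. (fst (fst y), fst (snd (fst y)),
      fst (snd (snd (fst y))), snd y)" "?M \<Otimes>\<^sub>M borel"] by simp
  have [measurable]: "Measurable.pred (?M \<Otimes>\<^sub>M borel) (\<lambda>y. candidate i (fst (fst y)) (fst (snd (fst y)))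
      (fst (snd (snd (fst y)))) (snd y, 0))"
    using measurable_compose[OF _ Suc.IH, of "\<lambda>y. (fst (fst y), fst (snd (fst y)),
      fst (snd (snd (fst y))), (snd y, 0))" "?M \<Otimes>\<^sub>M borel"] by simp
  show ?case unfolding candidate.simps ball_all_points split_beta' by measurable
qed simp

lemma pred_candidate [measurable (raw)]:
  fixes p :: "'b \<Rightarrow> 'a::euclidean_space \<times> real"
  assumes [measurable]: "n \<in> M \<rightarrow>\<^sub>M configurations" "h \<in> M \<rightarrow>\<^sub>M configurations"
    "Z \<in> M \<rightarrow>\<^sub>M configurations" "p \<in> M \<rightarrow>\<^sub>M borel"
  shows "Measurable.pred M (\<lambda>\<omega>. candidate i (n \<omega>) (h \<omega>) (Z \<omega>) (p \<omega>))"
  using measurable_compose[OF _ pred_candidate_aux, of "\<lambda>\<omega>. (n \<omega>, h \<omega>, Z \<omega>, p \<omega>)" M] by simp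

lemma pred_accepted [measurable (raw)]:
  fixes p :: "'b \<Rightarrow> 'a::euclidean_space \<times> real"
  assumes [measurable]: "n \<in> M \<rightarrow>\<^sub>M configurations" "h \<in> M \<rightarrow>\<^sub>M configurations"
    "Z \<in> M \<rightarrow>\<^sub>M configurations" "p \<in> M \<rightarrow>\<^sub>M borel"
  shows "Measurable.pred M (\<lambda>\<omega>. accepted (n \<omega>) (h \<omega>) (Z \<omega>) (p \<omega>))"
  unfolding accepted_def by measurable

lemma measurable_birth_death [measurable (raw)]:
  fixes h :: "'b \<Rightarrow> 'a::euclidean_space set"
  assumes n [measurable]: "n \<in> M \<rightarrow>\<^sub>M configurations" and h [measurable]: "h \<in> M \<rightarrow>\<^sub>M configurations"
    and [measurable]: "Z \<in> M \<rightarrow>\<^sub>M configurations"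
  shows "(\<lambda>\<omega>. birth_death (n \<omega>) (h \<omega>) (Z \<omega>) t) \<in> M \<rightarrow>\<^sub>M configurations"
proof (rule measurable_configurationsI)
  show "locally_finite_set (birth_death (n \<omega>) (h \<omega>) (Z \<omega>) t)" if "\<omega> \<in> space M" for \<omega>
    using measurable_space[OF n that] measurable_space[OF h that]
    by (simp add: space_configurations locally_finite_birth_death)
  fix B :: "'a set" assume [measurable]: "B \<in> sets borel"
  have "(\<exists>x\<in>birth_death n h Z t. x \<in> B) \<longleftrightarrow>
    (\<exists>q\<in>all_points n h. fst q \<in> B \<and> 0 \<le> snd q \<and> snd q \<le> t \<and> accepted n h Z q \<and> survives n Z q t)"
    for n :: "('a \<times> real) set" and h Z
    unfolding birth_death_def alive_def by blast
  then have "{\<omega> \<in> space M. \<exists>x\<in>birth_death (n \<omega>) (h \<omega>) (Z \<omega>) t. x \<in> B} =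
    {\<omega> \<in> space M. \<exists>q\<in>all_points (n \<omega>) (h \<omega>). fst q \<in> B \<and> 0 \<le> snd q \<and> snd q \<le> t \<and>
       accepted (n \<omega>) (h \<omega>) (Z \<omega>) q \<and> survives (n \<omega>) (Z \<omega>) q t}" by simp
  also have "\<dots> \<in> sets M"
    unfolding bex_all_points by measurable
  finally show "{\<omega> \<in> space M. \<exists>x\<in>birth_death (n \<omega>) (h \<omega>) (Z \<omega>) t. x \<in> B} \<in> sets M" .
qed

lemma locally_finite_Times:
  fixes \<xi> :: "'a::euclidean_space set" and \<zeta> :: "'b::euclidean_space set"
  assumes "locally_finite_set \<xi>" "locally_finite_set \<zeta>"
  shows "locally_finite_set (\<xi> \<times> \<zeta>)"
  unfolding locally_finite_set_iff_bounded
proof (intro allI impI)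
  fix B :: "('a \<times> 'b) set" assume "bounded B"
  then have "bounded (fst ` B)" "bounded (snd ` B)" by (rule bounded_fst, rule bounded_snd)
  then have "finite ((\<xi> \<inter> fst ` B) \<times> (\<zeta> \<inter> snd ` B))"
    using assms by (simp add: locally_finite_set_bounded)
  then show "finite (\<xi> \<times> \<zeta> \<inter> B)" by (rule finite_subset[rotated]) force
qed

lemma locally_finite_all_points:
  fixes n :: "('a::euclidean_space \<times> real) set"
  assumes "locally_finite_set n" "locally_finite_set h"
  shows "locally_finite_set (all_points n h)"
  unfolding all_points_def
  by (intro locally_finite_set_Un locally_finite_Times assms) (simp add: locally_finite_set_def)

lemma locally_finite_marked_pairs:
  fixes n :: "('a::euclidean_space \<times> real) set"
  assumes "locally_finite_set n" "locally_finite_set h"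
  shows "locally_finite_set (marked_pairs n h)"
  by (rule locally_finite_set_mono[of "n \<times> all_points n h"])
    (auto simp: marked_pairs_def intro!: locally_finite_Times locally_finite_all_points assms)

lemma measurable_marked_pairs [measurable (raw)]:
  fixes h :: "'b \<Rightarrow> 'a::euclidean_space set"
  assumes n [measurable]: "n \<in> M \<rightarrow>\<^sub>M configurations" and h [measurable]: "h \<in> M \<rightarrow>\<^sub>M configurations"
  shows "(\<lambda>\<omega>. marked_pairs (n \<omega>) (h \<omega>)) \<in> M \<rightarrow>\<^sub>M configurations"
proof (rule measurable_configurationsI)
  show "locally_finite_set (marked_pairs (n \<omega>) (h \<omega>))" if "\<omega> \<in> space M" for \<omega>
    using measurable_space[OF n that] measurable_space[OF h that]
    by (simp add: space_configurations locally_finite_marked_pairs)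
  fix B :: "(('a \<times> real) \<times> ('a \<times> real)) set" assume [measurable]: "B \<in> sets borel"
  have "(\<exists>x\<in>marked_pairs n h. x \<in> B) \<longleftrightarrow>
    (\<exists>p\<in>n. \<exists>q\<in>all_points n h. snd q < snd p \<and> (p, q) \<in> B)"
    for n :: "('a \<times> real) set" and h
    unfolding marked_pairs_def by blast
  then have "{\<omega> \<in> space M. \<exists>x\<in>marked_pairs (n \<omega>) (h \<omega>). x \<in> B} =
    {\<omega> \<in> space M. \<exists>p\<in>n \<omega>. \<exists>q\<in>all_points (n \<omega>) (h \<omega>). snd q < snd p \<and> (p, q) \<in> B}" by simp
  also have "\<dots> \<in> sets M"
    unfolding bex_all_points by measurable
  finally show "{\<omega> \<in> space M. \<exists>x\<in>marked_pairs (n \<omega>) (h \<omega>). x \<in> B} \<in> sets M" .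
qed

section \<open>Equivariance under spatial translations\<close>

text \<open>Only the order of times, distances and membership of pairs in \<open>Z\<close> enter.
  The shift has time component 0 and moves both ends of every pair.\<close>

lemma shift_survives:
  fixes n :: "('a::euclidean_space \<times> real) set"
  shows "survives ((+) (v, 0) ` n) ((+) ((v, 0), (v, 0)) ` Z) ((v, 0) + q) t = survives n Z q t"
proof -
  have "((v, 0) + p, (v, 0) + q) \<in> (+) ((v, 0), (v, 0)) ` Z \<longleftrightarrow> (p, q) \<in> Z" for p
    by (auto simp: image_iff prod_eq_iff Bex_def)
  then show ?thesis by (simp add: survives_def dist_norm)
qed

lemma shift_blocks:
  fixes n :: "('a::euclidean_space \<times> real) set"
  shows "blocks ((+) (v, 0) ` n) ((+) ((v, 0), (v, 0)) ` Z) ((v, 0) + q) ((v, 0) + p) = blocks n Z q p"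
  unfolding blocks_def shift_survives by (simp add: dist_norm shift_survives)

lemma shift_all_points:
  fixes n :: "('a::euclidean_space \<times> real) set"
  shows "all_points ((+) (v, 0) ` n) ((+) v ` h) = (+) (v, 0) ` all_points n h"
proof -
  have "(+) v ` h \<times> {0::real} = (+) (v, 0) ` (h \<times> {0})" by force
  then show ?thesis by (simp add: all_points_def image_Un)
qed

lemma shift_candidate:
  fixes n :: "('a::euclidean_space \<times> real) set"
  shows "candidate i ((+) (v, 0) ` n) ((+) v ` h) ((+) ((v, 0), (v, 0)) ` Z) ((v, 0) + p) =
    candidate i n h Z p"
  by (induction i arbitrary: p) (simp_all add: shift_all_points shift_blocks)

lemma shift_birth_death:
  fixes n :: "('a::euclidean_space \<times> real) set"
  shows "birth_death ((+) (v, 0) ` n) ((+) v ` h) ((+) ((v, 0), (v, 0)) ` Z) t =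
    (+) v ` birth_death n h Z t"
proof -
  have "alive ((+) (v, 0) ` n) ((+) v ` h) ((+) ((v, 0), (v, 0)) ` Z) t =
    (+) (v, 0) ` alive n h Z t"
  proof -
    have "{q \<in> f ` A. P q} = f ` {q \<in> A. P (f q)}" for f :: "'a \<times> real \<Rightarrow> 'a \<times> real" and A P by auto
    then show ?thesis
      by (simp add: alive_def shift_all_points accepted_def shift_candidate shift_survives)
  qed
  then show ?thesis by (simp add: birth_death_def image_image)
qed

lemma shift_marked_pairs:
  fixes n :: "('a::euclidean_space \<times> real) set"
  shows "marked_pairs ((+) (v, 0) ` n) ((+) v ` h) = (+) ((v, 0), (v, 0)) ` marked_pairs n h"
proof (rule set_eqI)
  fix x :: "('a \<times> real) \<times> ('a \<times> real)"
  show "x \<in> marked_pairs ((+) (v, 0) ` n) ((+) v ` h) \<longleftrightarrow>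
    x \<in> (+) ((v, 0), (v, 0)) ` marked_pairs n h"
    unfolding marked_pairs_def shift_all_points by force
qed

section \<open>The marks as a thinning\<close>

lemma measurable_card_configuration [measurable (raw)]:
  fixes \<xi> :: "'b \<Rightarrow> 'a::euclidean_space set"
  assumes "\<xi> \<in> M \<rightarrow>\<^sub>M configurations" "B \<in> sets borel" "bounded B"
  shows "(\<lambda>\<omega>. card (\<xi> \<omega> \<inter> B)) \<in> M \<rightarrow>\<^sub>M count_space UNIV"
proof (rule measurable_compose[OF assms(1)])
  show "(\<lambda>\<xi>. card (\<xi> \<inter> B)) \<in> configurations \<rightarrow>\<^sub>M count_space UNIV"
    unfolding measurable_count_space_eq2_countable
    using sets_count[OF assms(2,3)] by (auto simp: vimage_def Int_def conj_commute)
qed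

text \<open>Finitely many points of \<xi> can be listed by cells that isolate them; for a random
  configuration the list consists of measurable selections.\<close>

lemma finite_slots:
  assumes "locally_finite_set \<xi>" "finite F" "F \<subseteq> \<xi>"
  shows "\<exists>S. finite S \<and> (\<forall>j\<in>S. card (\<xi> \<inter> cell j) = 1) \<and> inj_on (\<lambda>j. pt j \<xi>) S \<and> (\<lambda>j. pt j \<xi>) ` S = F"
proof -
  have "\<forall>x\<in>F. \<exists>j. card (\<xi> \<inter> cell j) = 1 \<and> pt j \<xi> = x" using ex_pt[OF assms(1)] assms(3) by blast
  then obtain s where s: "\<forall>x\<in>F. card (\<xi> \<inter> cell (s x)) = 1 \<and> pt (s x) \<xi> = x" by (metis (no_types))
  show ?thesis
  proof (intro exI conjI)
    show "inj_on (\<lambda>j. pt j \<xi>) (s ` F)" using s by (auto simp: inj_on_def)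
    show "(\<lambda>j. pt j \<xi>) ` s ` F = F" using s by (auto simp: image_image)
  qed (use s assms(2) in auto)
qed

locale birth_death_data = prob_space M
  for M :: "'w measure" +
  fixes N :: "'w \<Rightarrow> ('a::euclidean_space \<times> real) set"
    and \<eta>\<^sub>0 :: "'w \<Rightarrow> 'a set"
    and I :: "'w \<Rightarrow> 'a \<times> real \<Rightarrow> 'a \<times> real \<Rightarrow> bool"
    and \<rho> :: real
  assumes rho: "0 \<le> \<rho>" "\<rho> \<le> 1"
    and poisson: "unit_poisson_process M N"
    and initial: "hard_core_point_process M \<eta>\<^sub>0"
    and independence: "indep_set (sets (vimage_algebra (space M) \<eta>\<^sub>0 configurations))
           (sets (vimage_algebra (space M) N configurations))"
    and marks: "independent_marks M \<rho> N \<eta>\<^sub>0 I"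
begin

lemma measurable_N [measurable]: "N \<in> M \<rightarrow>\<^sub>M configurations"
  using poisson by (simp add: unit_poisson_process_def)

lemma measurable_initial [measurable]: "\<eta>\<^sub>0 \<in> M \<rightarrow>\<^sub>M configurations"
  using initial by (simp add: hard_core_point_process_def)

lemma locally_finite_N: "\<omega> \<in> space M \<Longrightarrow> locally_finite_set (N \<omega>)"
  using measurable_space[OF measurable_N] by (simp add: space_configurations)

lemma locally_finite_\<eta>\<^sub>0: "\<omega> \<in> space M \<Longrightarrow> locally_finite_set (\<eta>\<^sub>0 \<omega>)"
  using measurable_space[OF measurable_initial] by (simp add: space_configurations)

definition Y :: "'w \<Rightarrow> (('a \<times> real) \<times> ('a \<times> real)) set" where
  "Y \<omega> = marked_pairs (N \<omega>) (\<eta>\<^sub>0 \<omega>)"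

text \<open>One mark per unordered pair is stored, that of the later point; the other is its
  negation. As a random configuration, \<open>Z\<close> can be translated together with
  \<open>N\<close> and \<open>\<eta>\<^sub>0\<close>.\<close>

definition Z :: "'w \<Rightarrow> (('a \<times> real) \<times> ('a \<times> real)) set" where
  "Z \<omega> = {(p, q) \<in> Y \<omega>. I \<omega> p q}"

lemma mem_Z: "x \<in> Z \<omega> \<longleftrightarrow> x \<in> Y \<omega> \<and> I \<omega> (fst x) (snd x)"
  by (simp add: Z_def split_beta)

definition G :: "'w measure" where
  "G = vimage_algebra (space M) (\<lambda>\<omega>. (N \<omega>, \<eta>\<^sub>0 \<omega>)) (configurations \<Otimes>\<^sub>M configurations)"

lemma space_G [simp]: "space G = space M"
  by (simp add: G_def)

lemma sets_G_subset: "sets G \<subseteq> sets M"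
  unfolding G_def by (intro sets_image_in_sets) measurable

lemma measurable_NG: "(\<lambda>\<omega>. (N \<omega>, \<eta>\<^sub>0 \<omega>)) \<in> G \<rightarrow>\<^sub>M configurations \<Otimes>\<^sub>M configurations"
proof -
  have "(\<lambda>\<omega>. (N \<omega>, \<eta>\<^sub>0 \<omega>)) \<in> space M \<rightarrow> space (configurations \<Otimes>\<^sub>M configurations)"
  proof
    fix \<omega> assume "\<omega> \<in> space M"
    then show "(N \<omega>, \<eta>\<^sub>0 \<omega>) \<in> space (configurations \<Otimes>\<^sub>M configurations)"
      using locally_finite_N locally_finite_\<eta>\<^sub>0 by (simp add: space_pair_measure space_configurations)
  qed
  then show ?thesis unfolding G_def by (rule measurable_vimage_algebra1)
qed

lemma measurable_Y_G: "Y \<in> G \<rightarrow>\<^sub>M configurations"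
proof -
  have "(\<lambda>x. marked_pairs (fst x) (snd x)) \<in> configurations \<Otimes>\<^sub>M configurations \<rightarrow>\<^sub>M configurations"
    by measurable
  from measurable_compose[OF measurable_NG this] show ?thesis by (simp add: Y_def[abs_def])
qed

lemma measurable_Y [measurable]: "Y \<in> M \<rightarrow>\<^sub>M configurations"
  unfolding Y_def[abs_def] by measurable

lemma locally_finite_Y: "\<omega> \<in> space M \<Longrightarrow> locally_finite_set (Y \<omega>)"
  using measurable_space[OF measurable_Y] by (simp add: space_configurations)

section \<open>Conditional law of the marks\<close>

text \<open>On this event the cells in \<open>S\<close> list the points of
  \<open>Y \<omega> \<inter> D\<close> completely and without repetition: distinct listed points in
  \<open>D\<close>, as many as \<open>D\<close> contains. The random pairs thus become a fixed
  number of selections, the form required by \<open>independent_marks\<close>.\<close>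

definition slot_event :: "(('a \<times> real) \<times> ('a \<times> real)) set \<Rightarrow> nat set \<Rightarrow> 'w set" where
  "slot_event D S = {\<omega> \<in> space M. card (Y \<omega> \<inter> D) = card S \<and>
     (\<forall>j\<in>S. card (Y \<omega> \<inter> cell j) = 1 \<and> pt j (Y \<omega>) \<in> D) \<and> inj_on (\<lambda>j. pt j (Y \<omega>)) S}"

lemma slot_event_sets:
  assumes [measurable]: "D \<in> sets borel" and "bounded D" "finite S"
  shows "slot_event D S \<in> sets G"
proof -
  note [measurable] = measurable_Y_G
  have [measurable]: "(\<lambda>\<omega>. card (Y \<omega> \<inter> D)) \<in> G \<rightarrow>\<^sub>M count_space UNIV"
    using assms by measurable
  have [measurable]: "(\<lambda>\<omega>. card (Y \<omega> \<inter> cell j)) \<in> G \<rightarrow>\<^sub>M count_space UNIV" for j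
    using bounded_cell[of j] by measurable
  have [simp]: "countable S" using assms(3) by (rule countable_finite)
  have "{\<omega> \<in> space G. card (Y \<omega> \<inter> D) = card S \<and>
     (\<forall>j\<in>S. card (Y \<omega> \<inter> cell j) = 1 \<and> pt j (Y \<omega>) \<in> D) \<and>
     (\<forall>i\<in>S. \<forall>j\<in>S. pt i (Y \<omega>) = pt j (Y \<omega>) \<longrightarrow> i = j)} \<in> sets G"
    by measurable
  then show ?thesis unfolding slot_event_def inj_on_def space_G .
qed

lemma slot_event_image:
  assumes "\<omega> \<in> slot_event D S" "finite S" "bounded D"
  shows "(\<lambda>j. pt j (Y \<omega>)) ` S = Y \<omega> \<inter> D"
proof (rule card_subset_eq)
  have \<omega>: "\<omega> \<in> space M" using assms(1) by (simp add: slot_event_def)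
  show "finite (Y \<omega> \<inter> D)" by (rule locally_finite_set_bounded[OF locally_finite_Y[OF \<omega>] assms(3)])
  show "(\<lambda>j. pt j (Y \<omega>)) ` S \<subseteq> Y \<omega> \<inter> D"
    using assms(1) pt_mem by (fastforce simp: slot_event_def)
  show "card ((\<lambda>j. pt j (Y \<omega>)) ` S) = card (Y \<omega> \<inter> D)"
    using assms(1) by (simp add: slot_event_def card_image)
qed

lemma slot_event_cover:
  assumes "\<omega> \<in> space M" "bounded D"
  shows "\<exists>S. finite S \<and> \<omega> \<in> slot_event D S"
proof -
  have "finite (Y \<omega> \<inter> D)" by (rule locally_finite_set_bounded[OF locally_finite_Y[OF assms(1)] assms(2)])
  from finite_slots[OF locally_finite_Y[OF assms(1)] this]
  obtain S where S: "finite S" "\<forall>j\<in>S. card (Y \<omega> \<inter> cell j) = 1" "inj_on (\<lambda>j. pt j (Y \<omega>)) S"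
    "(\<lambda>j. pt j (Y \<omega>)) ` S = Y \<omega> \<inter> D" by auto
  then have "card (Y \<omega> \<inter> D) = card S" using card_image[OF S(3)] by simp
  then have "\<omega> \<in> slot_event D S" using S assms(1) unfolding slot_event_def by blast
  then show ?thesis using S(1) by blast
qed

text \<open>On a slot event the pairs in \<open>D\<close> are \<open>card S\<close> distinct
  selections. Avoiding \<open>D\<close> says that all their marks are false, which given
  \<open>(N, \<eta>\<^sub>0)\<close> has probability \<open>1 - \<rho>\<close> for each pair,
  independently.\<close>

lemma unmarked_slot_event:
  assumes D: "D \<in> sets borel" "bounded D" and S: "finite S"
    and B: "B \<in> sets G" "B \<subseteq> slot_event D S"
  shows "{\<omega> \<in> B. Z \<omega> \<inter> D = {}} \<in> sets M"
    and "measure M {\<omega> \<in> B. Z \<omega> \<inter> D = {}} = measure M B * (1 - \<rho>) ^ card S"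
proof -
  \<comment> \<open>A fixed order on \<open>S\<close> turns the cells into indexed selections
    \<open>P i\<close> and \<open>Q i\<close>.\<close>
  define s where "s = sorted_list_of_set S"
  have s: "set s = S" "distinct s" "length s = card S" using S by (auto simp: s_def)
  define P Q where "P i \<omega> = fst (pt (s ! i) (Y \<omega>))" and "Q i \<omega> = snd (pt (s ! i) (Y \<omega>))" for i \<omega>
  note [measurable] = measurable_Y_G
  have PQ: "P i \<in> G \<rightarrow>\<^sub>M borel" "Q i \<in> G \<rightarrow>\<^sub>M borel" for i
    unfolding P_def[abs_def] Q_def[abs_def] by measurable
  have image: "(\<lambda>i. (P i \<omega>, Q i \<omega>)) ` {..<card S} = Y \<omega> \<inter> D" if "\<omega> \<in> B" for \<omega>
  proof -
    have "(\<lambda>i. (P i \<omega>, Q i \<omega>)) ` {..<card S} = (\<lambda>j. pt j (Y \<omega>)) ` set s"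
      unfolding P_def Q_def set_conv_nth s(3)[symmetric] by force
    then show ?thesis using slot_event_image[OF _ S D(2)] that B(2) s(1) by auto
  qed
  have inj: "inj_on (\<lambda>i. (P i \<omega>, Q i \<omega>)) {..<card S}" if "\<omega> \<in> B" for \<omega>
  proof -
    have "inj_on (\<lambda>j. pt j (Y \<omega>)) (set s)" using that B(2) s(1) by (auto simp: slot_event_def)
    moreover have "inj_on ((!) s) {..<card S}" "(!) s ` {..<card S} = set s"
      using inj_on_nth[OF s(2)] s(3) by (auto simp: set_conv_nth)
    ultimately have "inj_on (\<lambda>i. pt (s ! i) (Y \<omega>)) {..<card S}"
      using comp_inj_on[of "(!) s" "{..<card S}" "\<lambda>j. pt j (Y \<omega>)"] by (simp add: comp_def)
    then show ?thesis by (simp add: P_def Q_def)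
  qed
  have pairs: "(P i \<omega>, Q i \<omega>) \<in> marked_pairs (N \<omega>) (\<eta>\<^sub>0 \<omega>)" if "\<omega> \<in> B" "i < card S" for i \<omega>
    using image[OF that(1)] that(2) by (auto simp: Y_def)
  have mk: "{\<omega> \<in> B. \<forall>i<card S. I \<omega> (P i \<omega>) (Q i \<omega>) = (\<lambda>_. False) i} \<in> sets M \<and>
      measure M {\<omega> \<in> B. \<forall>i<card S. I \<omega> (P i \<omega>) (Q i \<omega>) = (\<lambda>_. False) i} =
        measure M B * (\<Prod>i<card S. pmf (bernoulli_pmf \<rho>) ((\<lambda>_. False) i))"
  proof -
    have "\<forall>(k::nat) P Q. \<forall>A \<in> sets G. \<forall>b :: nat \<Rightarrow> bool.
        (\<forall>i<k. P i \<in> G \<rightarrow>\<^sub>M borel \<and> Q i \<in> G \<rightarrow>\<^sub>M borel) \<and>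
        (\<forall>\<omega>\<in>A. (\<forall>i<k. (P i \<omega>, Q i \<omega>) \<in> marked_pairs (N \<omega>) (\<eta>\<^sub>0 \<omega>)) \<and>
               inj_on (\<lambda>i. (P i \<omega>, Q i \<omega>)) {..<k}) \<longrightarrow>
        {\<omega>\<in>A. \<forall>i<k. I \<omega> (P i \<omega>) (Q i \<omega>) = b i} \<in> sets M \<and>
        measure M {\<omega>\<in>A. \<forall>i<k. I \<omega> (P i \<omega>) (Q i \<omega>) = b i} =
          measure M A * (\<Prod>i<k. pmf (bernoulli_pmf \<rho>) (b i))"
      using marks unfolding independent_marks_def Let_def G_def by blast
    from this[rule_format, of B "card S" P Q "\<lambda>_. False"] show ?thesis
      using B(1) PQ pairs inj by blast
  qed
  have eq: "{\<omega> \<in> B. Z \<omega> \<inter> D = {}} =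
    {\<omega> \<in> B. \<forall>i<card S. I \<omega> (P i \<omega>) (Q i \<omega>) = (\<lambda>_. False) i}"
  proof (rule Collect_cong, rule conj_cong[OF refl])
    fix \<omega> assume "\<omega> \<in> B"
    have "Z \<omega> \<inter> D = {} \<longleftrightarrow> (\<forall>x\<in>Y \<omega> \<inter> D. \<not> I \<omega> (fst x) (snd x))"
      using mem_Z[of _ \<omega>] by blast
    also have "\<dots> \<longleftrightarrow> (\<forall>i<card S. \<not> I \<omega> (P i \<omega>) (Q i \<omega>))"
      unfolding image[OF \<open>\<omega> \<in> B\<close>, symmetric] by auto
    finally show "Z \<omega> \<inter> D = {} \<longleftrightarrow> (\<forall>i<card S. I \<omega> (P i \<omega>) (Q i \<omega>) = (\<lambda>_. False) i)" by simp
  qed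
  show "{\<omega> \<in> B. Z \<omega> \<inter> D = {}} \<in> sets M"
    unfolding eq by (rule conjunct1[OF mk])
  have "measure M {\<omega> \<in> B. Z \<omega> \<inter> D = {}} =
      measure M B * (\<Prod>i<card S. pmf (bernoulli_pmf \<rho>) ((\<lambda>_. False) i))"
    unfolding eq by (rule conjunct2[OF mk])
  then show "measure M {\<omega> \<in> B. Z \<omega> \<inter> D = {}} = measure M B * (1 - \<rho>) ^ card S"
    by (simp only: pmf_bernoulli_False[OF rho] prod_constant card_lessThan)
qed

text \<open>Slot events for all finite \<open>S\<close> cover the space but overlap. Made disjoint,
  they cut \<open>A\<close> into countably many pieces in \<open>G\<close>, and on each of them the
  number of pairs in \<open>D\<close> is constant. The formula says that, given \<open>G\<close>,
  the set \<open>Z\<close> avoids \<open>D\<close> with probability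
  \<open>(1 - \<rho>) ^ card (Y \<omega> \<inter> D)\<close>.\<close>

lemma
  assumes A: "A \<in> sets G" and D: "D \<in> sets borel" "bounded D"
  shows unmarked_sets: "{\<omega> \<in> A. Z \<omega> \<inter> D = {}} \<in> sets M"
    and measure_unmarked: "measure M {\<omega> \<in> A. Z \<omega> \<inter> D = {}} =
      (\<integral>\<omega>. indicator A \<omega> * (1 - \<rho>) ^ card (Y \<omega> \<inter> D) \<partial>M)"
proof -
  let ?F = "{S :: nat set. finite S}"
  define T where "T = from_nat_into ?F"
  have T: "range T = ?F" "\<And>i. finite (T i)"
  proof -
    have ne: "?F \<noteq> {}" using finite.emptyI by blast
    show "range T = ?F" unfolding T_def by (rule range_from_nat_into[OF ne countable_Collect_finite])
    show "finite (T i)" for i using from_nat_into[OF ne, of i] by (simp add: T_def)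
  qed
  define B where "B i = disjointed (\<lambda>i. A \<inter> slot_event D (T i)) i" for i
  have BG: "B i \<in> sets G" for i
  proof -
    have "range (\<lambda>i. A \<inter> slot_event D (T i)) \<subseteq> sets G"
      using A slot_event_sets[OF D T(2)] by auto
    from sets.range_disjointed_sets[OF this] show ?thesis by (auto simp: B_def)
  qed
  have Bsub: "B i \<subseteq> slot_event D (T i)" for i
    unfolding B_def using disjointed_subset[of "\<lambda>i. A \<inter> slot_event D (T i)" i] by blast
  have UN: "(\<Union>i. B i) = A"
  proof -
    have "(\<Union>i. B i) = (\<Union>i. A \<inter> slot_event D (T i))" unfolding B_def by (rule UN_disjointed_eq)
    moreover have "\<exists>i. \<omega> \<in> slot_event D (T i)" if "\<omega> \<in> A" for \<omega>
    proof -
      have "\<omega> \<in> space M" using that A sets.sets_into_space[OF A] by auto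
      then obtain S where "finite S" "\<omega> \<in> slot_event D S" using slot_event_cover[OF _ D(2)] by blast
      moreover from this(1) have "S \<in> range T" using T(1) by blast
      ultimately show ?thesis by blast
    qed
    then have "A = (\<Union>i. A \<inter> slot_event D (T i))" by auto
    ultimately show ?thesis by simp
  qed
  have disj: "disjoint_family B" unfolding B_def[abs_def] by (rule disjoint_family_disjointed)
  define C where "C i = {\<omega> \<in> B i. Z \<omega> \<inter> D = {}}" for i
  have C: "C i \<in> sets M" "measure M (C i) = measure M (B i) * (1 - \<rho>) ^ card (T i)" for i
    using unmarked_slot_event[OF D T(2) BG Bsub] by (auto simp: C_def)
  have eqC: "{\<omega> \<in> A. Z \<omega> \<inter> D = {}} = (\<Union>i. C i)" using UN by (auto simp: C_def)
  show sets: "{\<omega> \<in> A. Z \<omega> \<inter> D = {}} \<in> sets M" unfolding eqC using C(1) by blast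
  have disjC: "disjoint_family C" using disj by (auto simp: disjoint_family_on_def C_def)
  let ?f = "\<lambda>\<omega>. ennreal ((1 - \<rho>) ^ card (Y \<omega> \<inter> D))"
  have [measurable]: "(\<lambda>\<omega>. card (Y \<omega> \<inter> D)) \<in> M \<rightarrow>\<^sub>M count_space UNIV" using D by measurable
  have [measurable]: "B i \<in> sets M" for i using BG sets_G_subset by blast
  have [measurable]: "A \<in> sets M" using A sets_G_subset by blast
  have r: "0 \<le> 1 - \<rho>" "1 - \<rho> \<le> 1" using rho by auto
  have "emeasure M (\<Union>i. C i) = (\<Sum>i. emeasure M (C i))"
    using C(1) disjC by (intro suminf_emeasure[symmetric]) auto
  also have "\<dots> = (\<Sum>i. \<integral>\<^sup>+\<omega>\<in>B i. ?f \<omega> \<partial>M)"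
  proof (rule suminf_cong)
    fix i
    have "(\<integral>\<^sup>+\<omega>\<in>B i. ?f \<omega> \<partial>M) = (\<integral>\<^sup>+\<omega>\<in>B i. ennreal ((1 - \<rho>) ^ card (T i)) \<partial>M)"
    proof (rule nn_integral_cong)
      fix \<omega> assume "\<omega> \<in> space M"
      show "?f \<omega> * indicator (B i) \<omega> = ennreal ((1 - \<rho>) ^ card (T i)) * indicator (B i) \<omega>"
        using Bsub[of i] by (auto simp: indicator_def slot_event_def)
    qed
    also have "\<dots> = ennreal ((1 - \<rho>) ^ card (T i)) * emeasure M (B i)"
      by (simp add: nn_integral_cmult_indicator)
    also have "\<dots> = emeasure M (C i)"
      using r by (simp add: emeasure_eq_measure C(2) ennreal_mult'[symmetric] mult.commute)
    finally show "emeasure M (C i) = (\<integral>\<^sup>+\<omega>\<in>B i. ?f \<omega> \<partial>M)" by simp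
  qed
  also have "\<dots> = (\<integral>\<^sup>+\<omega>\<in>(\<Union>i. B i). ?f \<omega> \<partial>M)"
    using disj by (intro nn_integral_disjoint_family[symmetric]) auto
  also have "\<dots> = (\<integral>\<^sup>+\<omega>. ennreal (indicator A \<omega> * (1 - \<rho>) ^ card (Y \<omega> \<inter> D)) \<partial>M)"
    unfolding UN by (intro nn_integral_cong) (auto simp: indicator_def)
  also have "\<dots> = ennreal (\<integral>\<omega>. indicator A \<omega> * (1 - \<rho>) ^ card (Y \<omega> \<inter> D) \<partial>M)"
  proof (rule nn_integral_eq_integral)
    show "integrable M (\<lambda>\<omega>. indicator A \<omega> * (1 - \<rho>) ^ card (Y \<omega> \<inter> D))"
      using r by (intro integrable_const_bound[where B=1])
        (auto simp: indicator_def abs_mult power_le_one)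
  qed (use r in auto)
  finally show "measure M {\<omega> \<in> A. Z \<omega> \<inter> D = {}} =
      (\<integral>\<omega>. indicator A \<omega> * (1 - \<rho>) ^ card (Y \<omega> \<inter> D) \<partial>M)"
    unfolding eqC[symmetric] emeasure_eq_measure
    using r by (subst (asm) ennreal_inj) (auto intro!: integral_nonneg)
qed

text \<open>\<open>I\<close> is controlled only along measurable selections of pairs. These yield
  the avoidance events of \<open>Z\<close>, and avoidance events generate.\<close>

lemma measurable_Z [measurable]: "Z \<in> M \<rightarrow>\<^sub>M configurations"
proof (rule measurable_configurationsI)
  show "locally_finite_set (Z \<omega>)" if "\<omega> \<in> space M" for \<omega>
    by (rule locally_finite_set_mono[OF locally_finite_Y[OF that]]) (auto simp: Z_def)
  fix B :: "(('a \<times> real) \<times> ('a \<times> real)) set" assume B: "B \<in> sets borel" "bounded B"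
  have "space M \<in> sets G" using sets.top[of G] by simp
  from sets.compl_sets[OF unmarked_sets[OF this B]]
  have "space M - {\<omega> \<in> space M. Z \<omega> \<inter> B = {}} \<in> sets M" .
  moreover have "space M - {\<omega> \<in> space M. Z \<omega> \<inter> B = {}} = {\<omega> \<in> space M. \<exists>x\<in>Z \<omega>. x \<in> B}" by auto
  ultimately show "{\<omega> \<in> space M. \<exists>x\<in>Z \<omega>. x \<in> B} \<in> sets M" by simp
qed

end

section \<open>The law of the arrivals\<close>

definition avoiding3 ::
    "'a::euclidean_space set \<Rightarrow> 'b::euclidean_space set \<Rightarrow> 'c::euclidean_space set \<Rightarrow>
     ('a set \<times> 'b set \<times> 'c set) set" where
  "avoiding3 B C D = avoiding B \<times> avoiding C \<times> avoiding D"

definition avoiding3_events ::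
    "('a::euclidean_space set \<times> 'b::euclidean_space set \<times> 'c::euclidean_space set) set set" where
  "avoiding3_events = {avoiding3 B C D | B C D. B \<in> sets borel \<and> bounded B \<and>
     C \<in> sets borel \<and> bounded C \<and> D \<in> sets borel \<and> bounded D}"

abbreviation configurations3 ::
    "('a::euclidean_space set \<times> 'b::euclidean_space set \<times> 'c::euclidean_space set) measure" where
  "configurations3 \<equiv> configurations \<Otimes>\<^sub>M configurations \<Otimes>\<^sub>M configurations"

lemma avoiding3_Int: "avoiding3 B C D \<inter> avoiding3 B' C' D' = avoiding3 (B \<union> B') (C \<union> C') (D \<union> D')"
  by (auto simp: avoiding3_def avoiding_Int[symmetric])

lemma Int_stable_avoiding3_events: "Int_stable avoiding3_events"
  unfolding Int_stable_def
proof (intro ballI)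
  fix X Y :: "('a set \<times> 'b set \<times> 'c set) set"
  assume "X \<in> avoiding3_events" "Y \<in> avoiding3_events"
  then obtain B C D B' C' D' where
    X: "X = avoiding3 B C D" "B \<in> sets borel" "bounded B" "C \<in> sets borel" "bounded C" "D \<in> sets borel" "bounded D" and
    Y: "Y = avoiding3 B' C' D'" "B' \<in> sets borel" "bounded B'" "C' \<in> sets borel" "bounded C'" "D' \<in> sets borel" "bounded D'"
    unfolding avoiding3_events_def by auto
  have "X \<inter> Y = avoiding3 (B \<union> B') (C \<union> C') (D \<union> D')" unfolding X(1) Y(1) by (rule avoiding3_Int)
  moreover have "B \<union> B' \<in> sets borel" "bounded (B \<union> B')" "C \<union> C' \<in> sets borel" "bounded (C \<union> C')"
    "D \<union> D' \<in> sets borel" "bounded (D \<union> D')" using X Y by auto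
  ultimately show "X \<inter> Y \<in> avoiding3_events" unfolding avoiding3_events_def by blast
qed

lemma space_configurations3:
  "space configurations3 = avoiding3 {} {} {}"
  by (simp add: space_pair_measure avoiding3_def avoiding_empty)

lemma avoiding3_subset: "avoiding3 B C D \<subseteq> avoiding3 {} {} {}"
  by (auto simp: avoiding3_def avoiding_def)

lemma avoiding3_events_Pow: "avoiding3_events \<subseteq> Pow (avoiding3 {} {} {})"
  using avoiding3_subset by (auto simp: avoiding3_events_def)

text \<open>Each coordinate is measurable for the generated \<sigma>-algebra, since the other two
  avoided sets may be taken empty; so is the identity into the product space.\<close>

lemma sets_configurations3:
  "sets configurations3 = sigma_sets (avoiding3 {} {} {}) avoiding3_events"
proof (rule antisym)
  let ?W = "sigma (avoiding3 {} {} {}) avoiding3_events :: ('a set \<times> 'b set \<times> 'c set) measure"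
  have sp: "space ?W = avoiding3 {} {} {}" and st: "sets ?W = sigma_sets (avoiding3 {} {} {}) avoiding3_events"
    by (simp_all add: space_measure_of sets_measure_of avoiding3_events_Pow)
  have ev: "avoiding3 B C D \<in> sets ?W"
    if "B \<in> sets borel" "bounded B" "C \<in> sets borel" "bounded C" "D \<in> sets borel" "bounded D" for B :: "'a set" and C :: "'b set" and D :: "'c set"
  proof -
    have "avoiding3 B C D \<in> avoiding3_events" unfolding avoiding3_events_def using that by blast
    then show ?thesis unfolding st by (rule sigma_sets.Basic)
  qed
  have lf: "locally_finite_set (fst x)" "locally_finite_set (fst (snd x))" "locally_finite_set (snd (snd x))"
    if "x \<in> space ?W" for x
  proof -
    have "x \<in> avoiding3 {} {} {}" using that by (simp only: sp)
    then show "locally_finite_set (fst x)" "locally_finite_set (fst (snd x))" "locally_finite_set (snd (snd x))"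
      by (auto simp: avoiding3_def avoiding_def)
  qed
  have 1: "fst \<in> ?W \<rightarrow>\<^sub>M configurations"
  proof (rule measurable_configurationsI)
    fix B :: "'a set" assume B: "B \<in> sets borel" "bounded B"
    have "{\<omega> \<in> space ?W. \<exists>x\<in>fst \<omega>. x \<in> B} = space ?W - avoiding3 B {} {}"
      unfolding sp by (auto simp: avoiding3_def avoiding_def)
    then show "{\<omega> \<in> space ?W. \<exists>x\<in>fst \<omega>. x \<in> B} \<in> sets ?W" using ev[of B "{}" "{}"] B by auto
  qed (rule lf)
  have 2: "(\<lambda>x. fst (snd x)) \<in> ?W \<rightarrow>\<^sub>M configurations"
  proof (rule measurable_configurationsI)
    fix B :: "'b set" assume B: "B \<in> sets borel" "bounded B"
    have "{\<omega> \<in> space ?W. \<exists>x\<in>fst (snd \<omega>). x \<in> B} = space ?W - avoiding3 {} B {}"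
      unfolding sp by (auto simp: avoiding3_def avoiding_def)
    then show "{\<omega> \<in> space ?W. \<exists>x\<in>fst (snd \<omega>). x \<in> B} \<in> sets ?W" using ev[of "{}" B "{}"] B by auto
  qed (rule lf)
  have 3: "(\<lambda>x. snd (snd x)) \<in> ?W \<rightarrow>\<^sub>M configurations"
  proof (rule measurable_configurationsI)
    fix B :: "'c set" assume B: "B \<in> sets borel" "bounded B"
    have "{\<omega> \<in> space ?W. \<exists>x\<in>snd (snd \<omega>). x \<in> B} = space ?W - avoiding3 {} {} B"
      unfolding sp by (auto simp: avoiding3_def avoiding_def)
    then show "{\<omega> \<in> space ?W. \<exists>x\<in>snd (snd \<omega>). x \<in> B} \<in> sets ?W" using ev[of "{}" "{}" B] B by auto
  qed (rule lf)
  have id: "(\<lambda>x. (fst x, fst (snd x), snd (snd x))) \<in> ?W \<rightarrow>\<^sub>M configurations3"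
    using 1 2 3 by (intro measurable_Pair)
  show "sets configurations3 \<subseteq> sigma_sets (avoiding3 {} {} {}) (avoiding3_events :: ('a set \<times> 'b set \<times> 'c set) set set)"
  proof
    fix A :: "('a set \<times> 'b set \<times> 'c set) set" assume A: "A \<in> sets configurations3"
    have "(\<lambda>x. (fst x, fst (snd x), snd (snd x))) -` A \<inter> space ?W = A"
      using sets.sets_into_space[OF A] unfolding sp space_configurations3 by auto
    then show "A \<in> sigma_sets (avoiding3 {} {} {}) avoiding3_events"
      using measurable_sets[OF id A] unfolding st by simp
  qed
  have "avoiding3_events \<subseteq> sets configurations3"
    unfolding avoiding3_events_def avoiding3_def by auto
  then show "sigma_sets (avoiding3 {} {} {}) avoiding3_events \<subseteq>
    sets (configurations3 :: ('a set \<times> 'b set \<times> 'c set) measure)"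
    unfolding space_configurations3[symmetric] by (rule sets.sigma_sets_subset)
qed

lemma avoiding3_sets:
  assumes "A \<in> avoiding3_events"
  shows "A \<in> sets configurations3"
  unfolding sets_configurations3 using assms by (rule sigma_sets.Basic)

text \<open>Renyi's theorem: the law of a simple point process is determined by its avoidance
  probabilities.\<close>

lemma distr_configurations_eqI:
  fixes \<xi> :: "'w \<Rightarrow> 'a::euclidean_space set" and \<zeta> :: "'v \<Rightarrow> 'a set"
  assumes "prob_space M" "prob_space M'"
    and \<xi>: "\<xi> \<in> M \<rightarrow>\<^sub>M configurations" and \<zeta>: "\<zeta> \<in> M' \<rightarrow>\<^sub>M configurations"
    and eq: "\<And>B. B \<in> sets borel \<Longrightarrow> bounded B \<Longrightarrow>
      measure M {\<omega> \<in> space M. \<xi> \<omega> \<inter> B = {}} = measure M' {\<omega> \<in> space M'. \<zeta> \<omega> \<inter> B = {}}"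
  shows "distr M configurations \<xi> = distr M' configurations \<zeta>"
proof (rule measure_eqI_generator_eq[OF Int_stable_avoiding_events])
  interpret M: prob_space M by fact
  interpret M': prob_space M' by fact
  show "avoiding_events \<subseteq> Pow {\<xi>::'a set. locally_finite_set \<xi>}"
    by (auto simp: avoiding_events_def avoiding_def)
  fix X :: "'a set set" assume "X \<in> avoiding_events"
  then obtain B where B: "X = avoiding B" "B \<in> sets borel" "bounded B"
    unfolding avoiding_events_def by auto
  have "\<xi> -` X \<inter> space M = {\<omega> \<in> space M. \<xi> \<omega> \<inter> B = {}}"
    using measurable_space[OF \<xi>] unfolding B(1) by (auto simp: avoiding_def space_configurations)
  moreover have "\<zeta> -` X \<inter> space M' = {\<omega> \<in> space M'. \<zeta> \<omega> \<inter> B = {}}"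
    using measurable_space[OF \<zeta>] unfolding B(1) by (auto simp: avoiding_def space_configurations)
  ultimately show "emeasure (distr M configurations \<xi>) X = emeasure (distr M' configurations \<zeta>) X"
    using eq[OF B(2,3)] \<xi> \<zeta> B
    by (simp add: emeasure_distr M.emeasure_eq_measure M'.emeasure_eq_measure)
next
  interpret M: prob_space M by fact
  interpret D: prob_space "distr M configurations \<xi>" by (rule M.prob_space_distr[OF \<xi>])
  show "range (\<lambda>_::nat. {\<xi>::'a set. locally_finite_set \<xi>}) \<subseteq> avoiding_events"
    unfolding avoiding_events_def avoiding_def by (auto intro!: exI[of _ "{}"])
  show "emeasure (distr M configurations \<xi>) {\<xi>. locally_finite_set \<xi>} \<noteq> \<infinity>" by simp
qed (auto simp: sets_configurations_avoiding)

text \<open>The same principle for independence: the preimages of avoidance events are \<pi>-systems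
  generating the \<sigma>-algebras of \<xi> and \<zeta>.\<close>

lemma (in prob_space) indep_var_configurationsI:
  fixes \<xi> :: "'a \<Rightarrow> 'b::euclidean_space set" and \<zeta> :: "'a \<Rightarrow> 'b set"
  assumes \<xi>: "\<xi> \<in> M \<rightarrow>\<^sub>M configurations" and \<zeta>: "\<zeta> \<in> M \<rightarrow>\<^sub>M configurations"
    and eq: "\<And>B C. B \<in> sets borel \<Longrightarrow> bounded B \<Longrightarrow> C \<in> sets borel \<Longrightarrow> bounded C \<Longrightarrow>
      prob {\<omega> \<in> space M. \<xi> \<omega> \<inter> B = {} \<and> \<zeta> \<omega> \<inter> C = {}} =
      prob {\<omega> \<in> space M. \<xi> \<omega> \<inter> B = {}} * prob {\<omega> \<in> space M. \<zeta> \<omega> \<inter> C = {}}"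
  shows "indep_var configurations \<xi> configurations \<zeta>"
proof -
  have gen: "{X -` A \<inter> space M | A. A \<in> sets configurations} =
      sigma_sets (space M) {X -` A \<inter> space M | A. A \<in> avoiding_events}"
    and stable: "Int_stable {X -` A \<inter> space M | A. A \<in> avoiding_events}"
    and meas: "{X -` A \<inter> space M | A. A \<in> avoiding_events} \<subseteq> events"
    if X: "X \<in> M \<rightarrow>\<^sub>M configurations" for X :: "'a \<Rightarrow> 'b set"
  proof -
    have "X \<in> space M \<rightarrow> {\<xi>. locally_finite_set \<xi>}"
      using measurable_space[OF X] by (auto simp: space_configurations)
    from sigma_sets_vimage_commute[OF this]
    show "{X -` A \<inter> space M | A. A \<in> sets configurations} =
      sigma_sets (space M) {X -` A \<inter> space M | A. A \<in> avoiding_events}"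
      by (simp add: sets_configurations_avoiding)
    show "{X -` A \<inter> space M | A. A \<in> avoiding_events} \<subseteq> events"
      using measurable_sets[OF X] by (auto simp: avoiding_events_def)
    show "Int_stable {X -` A \<inter> space M | A. A \<in> avoiding_events}"
      unfolding Int_stable_def
    proof safe
      fix A A' :: "'b set set" assume "A \<in> avoiding_events" "A' \<in> avoiding_events"
      then have "A \<inter> A' \<in> avoiding_events" using Int_stable_avoiding_events unfolding Int_stable_def by blast
      then show "\<exists>A''. X -` A \<inter> space M \<inter> (X -` A' \<inter> space M) = X -` A'' \<inter> space M \<and> A'' \<in> avoiding_events"
        by (intro exI[of _ "A \<inter> A'"]) auto
    qed
  qed
  have "indep_set {\<xi> -` A \<inter> space M | A. A \<in> avoiding_events} {\<zeta> -` A \<inter> space M | A. A \<in> avoiding_events}"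
  proof (rule indep_setI[OF meas[OF \<xi>] meas[OF \<zeta>]])
    fix a b assume "a \<in> {\<xi> -` A \<inter> space M | A. A \<in> avoiding_events}"
      and "b \<in> {\<zeta> -` A \<inter> space M | A. A \<in> avoiding_events}"
    then obtain B C where B: "a = \<xi> -` avoiding B \<inter> space M" "B \<in> sets borel" "bounded B"
      and C: "b = \<zeta> -` avoiding C \<inter> space M" "C \<in> sets borel" "bounded C"
      unfolding avoiding_events_def by blast
    have a: "a = {\<omega> \<in> space M. \<xi> \<omega> \<inter> B = {}}"
      using measurable_space[OF \<xi>] unfolding B(1) by (auto simp: avoiding_def space_configurations)
    have b: "b = {\<omega> \<in> space M. \<zeta> \<omega> \<inter> C = {}}"
      using measurable_space[OF \<zeta>] unfolding C(1) by (auto simp: avoiding_def space_configurations)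
    have "a \<inter> b = {\<omega> \<in> space M. \<xi> \<omega> \<inter> B = {} \<and> \<zeta> \<omega> \<inter> C = {}}" unfolding a b by auto
    then show "prob (a \<inter> b) = prob a * prob b" using eq[OF B(2,3) C(2,3)] a b by simp
  qed
  note ind = indep_set_sigma_sets[OF this stable[OF \<xi>] stable[OF \<zeta>]]
  show ?thesis
    unfolding indep_var_eq gen[OF \<xi>] gen[OF \<zeta>]
      sigma_sets_sigma_sets_eq[OF subset_trans[OF meas[OF \<xi>] sets.space_closed]]
      sigma_sets_sigma_sets_eq[OF subset_trans[OF meas[OF \<zeta>] sets.space_closed]]
    by (rule conjI[OF conjI[OF \<xi> \<zeta>] ind])
qed

context birth_death_data
begin

section \<open>Invariance and independence of the arrivals\<close>

lemma prob_N_count: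
  assumes "B \<in> sets borel" "bounded B" "B \<subseteq> UNIV \<times> {0..}"
  shows "prob {\<omega> \<in> space M. card (N \<omega> \<inter> B) = k} =
    measure lborel B ^ k / fact k * exp (- measure lborel B)"
  using poisson assms unfolding unit_poisson_process_def by blast

lemma N_nonneg:
  assumes "\<omega> \<in> space M" "p \<in> N \<omega>"
  shows "0 \<le> snd p"
proof -
  have "\<forall>\<omega>\<in>space M. N \<omega> \<subseteq> UNIV \<times> {0..}"
    using poisson unfolding unit_poisson_process_def by (elim conjE)
  then have "N \<omega> \<subseteq> UNIV \<times> {0..}" using assms(1) ..
  then show ?thesis using assms(2) by auto
qed

lemma prob_N_avoids:
  assumes "B \<in> sets borel" "bounded B"
  shows "prob {\<omega> \<in> space M. N \<omega> \<inter> B = {}} = exp (- measure lborel (B \<inter> UNIV \<times> {0..}))"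
proof -
  let ?B = "B \<inter> UNIV \<times> {0..}"
  have "closed ((UNIV :: 'a set) \<times> {0::real..})" by (intro closed_Times) auto
  then have B: "?B \<in> sets borel" "bounded ?B" using assms by (auto intro: bounded_Int)
  have "N \<omega> \<inter> B = {} \<longleftrightarrow> card (N \<omega> \<inter> ?B) = 0" if \<omega>: "\<omega> \<in> space M" for \<omega>
  proof -
    have "N \<omega> \<inter> ?B = N \<omega> \<inter> B" using N_nonneg[OF \<omega>] by (auto simp: mem_Times_iff)
    moreover have "finite (N \<omega> \<inter> B)" using locally_finite_N[OF \<omega>] assms(2) by (rule locally_finite_set_bounded)
    ultimately show ?thesis by simp
  qed
  then have "{\<omega> \<in> space M. N \<omega> \<inter> B = {}} = {\<omega> \<in> space M. card (N \<omega> \<inter> ?B) = 0}" by auto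
  then show ?thesis using prob_N_count[OF B, of 0] by simp
qed

text \<open>A purely spatial shift preserves both Lebesgue measure and the half-space of nonnegative
  times, hence all avoidance probabilities.\<close>

lemma distr_N_shift: "distr M configurations (\<lambda>\<omega>. (+) (v, 0) ` N \<omega>) = distr M configurations N"
proof (rule distr_configurations_eqI)
  fix B :: "('a \<times> real) set" assume B: "B \<in> sets borel" "bounded B"
  let ?T = "\<lambda>p. - (v, 0) + p" and ?H = "(UNIV :: 'a set) \<times> {0::real..}"
  have img: "(+) (- (v, 0)) ` A = (+) (v, 0) -` A" for A :: "('a \<times> real) set"
  proof (rule set_eqI)
    fix x :: "'a \<times> real"
    have x: "x = - (v, 0) + ((v, 0) + x)" by (simp add: prod_eq_iff)
    show "x \<in> (+) (- (v, 0)) ` A \<longleftrightarrow> x \<in> (+) (v, 0) -` A"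
    proof
      assume "x \<in> (+) (- (v, 0)) ` A"
      then obtain y where y: "y \<in> A" "x = - (v, 0) + y" by blast
      then have "(v, 0) + x = y" by (simp add: prod_eq_iff)
      then show "x \<in> (+) (v, 0) -` A" using y(1) by simp
    next
      assume "x \<in> (+) (v, 0) -` A"
      then have "(v, 0) + x \<in> A" by (simp only: vimage_eq)
      with x show "x \<in> (+) (- (v, 0)) ` A" by (rule image_eqI)
    qed
  qed
  have B': "(+) (- (v, 0)) ` B \<in> sets borel" "bounded ((+) (- (v, 0)) ` B)"
  proof -
    have "(+) (v, 0 :: real) \<in> borel \<rightarrow>\<^sub>M borel" by measurable
    from measurable_sets[OF this B(1)] have "(+) (v, 0) -` B \<inter> space borel \<in> sets borel" .
    then show "(+) (- (v, 0)) ` B \<in> sets borel" by (simp only: img space_borel Int_UNIV_right)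
    show "bounded ((+) (- (v, 0)) ` B)" using B(2) by (rule bounded_translation)
  qed
  have "{\<omega> \<in> space M. (+) (v, 0) ` N \<omega> \<inter> B = {}} = {\<omega> \<in> space M. N \<omega> \<inter> (+) (- (v, 0)) ` B = {}}"
    unfolding img by auto
  then have "prob {\<omega> \<in> space M. (+) (v, 0) ` N \<omega> \<inter> B = {}} =
    exp (- measure lborel ((+) (- (v, 0)) ` B \<inter> ?H))"
    using prob_N_avoids[OF B'] by simp
  also have "(+) (- (v, 0)) ` B \<inter> ?H = (+) (- (v, 0)) ` (B \<inter> ?H)"
    unfolding img by auto
  also have "measure lborel ((+) (- (v, 0)) ` (B \<inter> ?H)) = measure lborel (B \<inter> ?H)"
  proof -
    have "closed ?H" by (intro closed_Times) auto
    then have "B \<inter> ?H \<in> sets borel" using B(1) by auto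
    then have "measure (distr lborel borel ((+) (v, 0))) (B \<inter> ?H) =
      measure lborel ((+) (v, 0) -` (B \<inter> ?H) \<inter> space lborel)"
      by (intro measure_distr) (simp_all del: plus_prod_def)
    then show ?thesis unfolding lborel_distr_plus img by simp
  qed
  finally show "prob {\<omega> \<in> space M. (+) (v, 0) ` N \<omega> \<inter> B = {}} = prob {\<omega> \<in> space M. N \<omega> \<inter> B = {}}"
    using prob_N_avoids[OF B] by simp
qed (auto intro: prob_space_axioms)

text \<open>Avoidance probabilities already give independence over disjoint regions: volumes add up,
  and \<open>exp\<close> turns the sum into a product.\<close>

lemma indep_N_disjoint:
  assumes [measurable]: "\<Lambda> \<in> sets borel" "\<Lambda>' \<in> sets borel" and disj: "\<Lambda> \<inter> \<Lambda>' = {}"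
  shows "indep_var configurations (\<lambda>\<omega>. N \<omega> \<inter> \<Lambda>) configurations (\<lambda>\<omega>. N \<omega> \<inter> \<Lambda>')"
proof (rule indep_var_configurationsI)
  fix B C :: "('a \<times> real) set"
  assume B: "B \<in> sets borel" "bounded B" and C: "C \<in> sets borel" "bounded C"
  let ?H = "(UNIV :: 'a set) \<times> {0::real..}"
  have "closed ?H" by (intro closed_Times) auto
  then have H: "?H \<in> sets borel" by auto
  have BC: "\<Lambda> \<inter> B \<in> sets borel" "bounded (\<Lambda> \<inter> B)" "\<Lambda>' \<inter> C \<in> sets borel" "bounded (\<Lambda>' \<inter> C)"
    using B C by (auto intro: bounded_Int)
  have 1: "{\<omega> \<in> space M. N \<omega> \<inter> \<Lambda> \<inter> B = {} \<and> N \<omega> \<inter> \<Lambda>' \<inter> C = {}} =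
    {\<omega> \<in> space M. N \<omega> \<inter> (\<Lambda> \<inter> B \<union> \<Lambda>' \<inter> C) = {}}" by auto
  have 3: "{\<omega> \<in> space M. N \<omega> \<inter> A \<inter> A' = {}} = {\<omega> \<in> space M. N \<omega> \<inter> (A \<inter> A') = {}}" for A A'
    by (simp only: Int_assoc)
  have "measure lborel ((\<Lambda> \<inter> B \<union> \<Lambda>' \<inter> C) \<inter> ?H) =
    measure lborel (\<Lambda> \<inter> B \<inter> ?H \<union> \<Lambda>' \<inter> C \<inter> ?H)" by (simp only: Int_Un_distrib2)
  also have "\<dots> = measure lborel (\<Lambda> \<inter> B \<inter> ?H) + measure lborel (\<Lambda>' \<inter> C \<inter> ?H)"
  proof (rule measure_Union)
    have "bounded (\<Lambda> \<inter> B \<inter> ?H)" "bounded (\<Lambda>' \<inter> C \<inter> ?H)" using B C by (auto intro: bounded_Int)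
    then show "emeasure lborel (\<Lambda> \<inter> B \<inter> ?H) \<noteq> \<infinity>" "emeasure lborel (\<Lambda>' \<inter> C \<inter> ?H) \<noteq> \<infinity>"
      using emeasure_bounded_finite less_irrefl by fastforce+
    show "\<Lambda> \<inter> B \<inter> ?H \<in> sets lborel" "\<Lambda>' \<inter> C \<inter> ?H \<in> sets lborel" using BC H by auto
  qed (use disj in auto)
  finally have 2: "measure lborel ((\<Lambda> \<inter> B \<union> \<Lambda>' \<inter> C) \<inter> ?H) =
    measure lborel (\<Lambda> \<inter> B \<inter> ?H) + measure lborel (\<Lambda>' \<inter> C \<inter> ?H)" .
  show "prob {\<omega> \<in> space M. N \<omega> \<inter> \<Lambda> \<inter> B = {} \<and> N \<omega> \<inter> \<Lambda>' \<inter> C = {}} =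
      prob {\<omega> \<in> space M. N \<omega> \<inter> \<Lambda> \<inter> B = {}} * prob {\<omega> \<in> space M. N \<omega> \<inter> \<Lambda>' \<inter> C = {}}"
    unfolding 1 3
    using prob_N_avoids[of "\<Lambda> \<inter> B \<union> \<Lambda>' \<inter> C"] prob_N_avoids[of "\<Lambda> \<inter> B"] prob_N_avoids[of "\<Lambda>' \<inter> C"] BC 2
    by (simp add: mult_exp_exp)
qed measurable

lemma distr_N_initial:
  "distr M (configurations \<Otimes>\<^sub>M configurations) (\<lambda>\<omega>. (N \<omega>, \<eta>\<^sub>0 \<omega>)) =
   distr M configurations N \<Otimes>\<^sub>M distr M configurations \<eta>\<^sub>0"
proof (rule pair_measure_eqI[symmetric])
  interpret D1: prob_space "distr M configurations N" by (rule prob_space_distr) measurable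
  interpret D2: prob_space "distr M configurations \<eta>\<^sub>0" by (rule prob_space_distr) measurable
  show "sigma_finite_measure (distr M configurations N)" "sigma_finite_measure (distr M configurations \<eta>\<^sub>0)"
    by unfold_locales
  show "sets (distr M configurations N \<Otimes>\<^sub>M distr M configurations \<eta>\<^sub>0) =
      sets (distr M (configurations \<Otimes>\<^sub>M configurations) (\<lambda>\<omega>. (N \<omega>, \<eta>\<^sub>0 \<omega>)))"
    by (simp cong: sets_pair_measure_cong)
  fix A B assume "A \<in> sets (distr M configurations N)" "B \<in> sets (distr M configurations \<eta>\<^sub>0)"
  then have [measurable]: "A \<in> sets configurations" "B \<in> sets configurations" by simp_all
  have "N -` A \<inter> space M \<in> sets (vimage_algebra (space M) N configurations)"
    and "\<eta>\<^sub>0 -` B \<inter> space M \<in> sets (vimage_algebra (space M) \<eta>\<^sub>0 configurations)"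
    by (auto intro: in_vimage_algebra)
  with independence have "prob (\<eta>\<^sub>0 -` B \<inter> space M \<inter> (N -` A \<inter> space M)) =
      prob (\<eta>\<^sub>0 -` B \<inter> space M) * prob (N -` A \<inter> space M)"
    unfolding indep_sets2_eq by blast
  moreover have "(\<lambda>\<omega>. (N \<omega>, \<eta>\<^sub>0 \<omega>)) -` (A \<times> B) \<inter> space M = \<eta>\<^sub>0 -` B \<inter> space M \<inter> (N -` A \<inter> space M)"
    by auto
  ultimately show "emeasure (distr M configurations N) A * emeasure (distr M configurations \<eta>\<^sub>0) B =
      emeasure (distr M (configurations \<Otimes>\<^sub>M configurations) (\<lambda>\<omega>. (N \<omega>, \<eta>\<^sub>0 \<omega>))) (A \<times> B)"
    by (simp add: emeasure_distr emeasure_eq_measure ennreal_mult'[symmetric] mult.commute)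
qed

end

section \<open>Finiteness of descending chains\<close>

abbreviation centred_cube :: "real \<Rightarrow> 'a::euclidean_space set" where
  "centred_cube R \<equiv> cbox (- R *\<^sub>R One) (R *\<^sub>R One)"

text \<open>The slab has width \<open>1 / m\<close> in direction \<open>b\<close> and extends at
  most \<open>2 * R\<close> in each other direction.\<close>

lemma content_slab_le:
  fixes b :: "'c::euclidean_space"
  assumes b: "b \<in> Basis" and m: "0 < m" and R: "0 \<le> R"
  shows "measure lborel {x \<in> centred_cube R. \<lfloor>m * (x \<bullet> b)\<rfloor> = j} \<le>
    (2 * R) ^ (DIM('c) - 1) / m"
proof -
  let ?l = "\<Sum>i\<in>Basis. (if i = b then real_of_int j / m else - R) *\<^sub>R i"
  let ?u = "\<Sum>i\<in>Basis. (if i = b then (real_of_int j + 1) / m else R) *\<^sub>R i"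
  have lu: "?l \<bullet> i = (if i = b then real_of_int j / m else - R)"
    "?u \<bullet> i = (if i = b then (real_of_int j + 1) / m else R)" if "i \<in> Basis" for i
    using that by (simp_all add: inner_sum_left_Basis del: scaleR_minus_left)
  have le: "?l \<bullet> i \<le> ?u \<bullet> i" if "i \<in> Basis" for i
    using that m R by (simp add: lu divide_right_mono)
  have sub: "{x \<in> centred_cube R. \<lfloor>m * (x \<bullet> b)\<rfloor> = j} \<subseteq> cbox ?l ?u"
  proof
    fix x :: 'c assume x: "x \<in> {x \<in> centred_cube R. \<lfloor>m * (x \<bullet> b)\<rfloor> = j}"
    then have "real_of_int j \<le> m * (x \<bullet> b)" "m * (x \<bullet> b) \<le> real_of_int j + 1" by (auto simp: floor_eq_iff)
    then have "real_of_int j / m \<le> x \<bullet> b" "x \<bullet> b \<le> (real_of_int j + 1) / m"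
      using m by (simp_all add: field_simps)
    then show "x \<in> cbox ?l ?u" using x by (auto simp: mem_box lu)
  qed
  have "measure lborel {x \<in> centred_cube R. \<lfloor>m * (x \<bullet> b)\<rfloor> = j} \<le> measure lborel (cbox ?l ?u)"
    using sub by (intro measure_mono_fmeasurable) auto
  also have "\<dots> = (\<Prod>i\<in>Basis. if i = b then 1 / m else 2 * R)"
    using le by (subst content_cbox) (auto simp: lu diff_divide_distrib[symmetric] intro!: prod.cong)
  also have "\<dots> = (2 * R) ^ (DIM('c) - 1) / m"
    using b by (simp add: prod.remove[OF finite_Basis b])
  finally show ?thesis .
qed

text \<open>The intersection of all covers has probability at most every \<open>e i\<close>.
  Vanishing of \<open>e\<close> thus replaces the summability of a Borel-Cantelli argument, and
  \<open>P\<close> enters only through the covers.\<close>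

lemma (in prob_space) AE_not_if_prob_le:
  assumes E: "\<And>i::nat. E i \<in> events" "\<And>i. prob (E i) \<le> e i" "e \<longlonglongrightarrow> 0"
    and sub: "\<And>\<omega> i. \<omega> \<in> space M \<Longrightarrow> P \<omega> \<Longrightarrow> \<omega> \<in> E i"
  shows "AE \<omega> in M. \<not> P \<omega>"
proof (rule AE_I')
  have "prob (\<Inter>i. E i) \<le> e i" for i
    using E(1,2)[of i] finite_measure_mono[of "\<Inter>i. E i" "E i"] by fastforce
  then have "prob (\<Inter>i. E i) \<le> 0" using E(3) by (intro LIMSEQ_le_const) auto
  then have "prob (\<Inter>i. E i) = 0" using measure_nonneg[of M "\<Inter>i. E i"] by linarith
  then show "(\<Inter>i. E i) \<in> null_sets M" using E(1) by (auto simp: emeasure_eq_measure null_sets_def)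
  show "{\<omega> \<in> space M. \<not> \<not> P \<omega>} \<subseteq> (\<Inter>i. E i)" using sub by auto
qed

section \<open>Discretization of space and time\<close>

text \<open>The lower corner of the half-open unit cube that contains \<open>x\<close>; it labels
  the cube.\<close>

definition lattice_point :: "'a::euclidean_space \<Rightarrow> 'a" where
  "lattice_point x = (\<Sum>b\<in>Basis. real_of_int \<lfloor>x \<bullet> b\<rfloor> *\<^sub>R b)"

lemma lattice_point_inner [simp]: "b \<in> Basis \<Longrightarrow> lattice_point x \<bullet> b = real_of_int \<lfloor>x \<bullet> b\<rfloor>"
  by (simp add: lattice_point_def inner_sum_left inner_Basis if_distrib cong: if_cong)

text \<open>For \<open>r = 1\<close> these are the displacements between a cube and the cubes within
  reach of one step; their number is the constant \<kappa> of the chain estimate.\<close>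

definition integer_vectors :: "int \<Rightarrow> 'a::euclidean_space set" where
  "integer_vectors r = {k. \<forall>b\<in>Basis. \<exists>i\<in>{-r..r}. k \<bullet> b = real_of_int i}"

lemma finite_integer_vectors: "finite (integer_vectors r :: 'a::euclidean_space set)"
proof -
  have "integer_vectors r \<subseteq> (\<lambda>f. \<Sum>b\<in>Basis. real_of_int (f b) *\<^sub>R b) ` ((Basis :: 'a set) \<rightarrow>\<^sub>E {-r..r})"
  proof
    fix k :: 'a assume "k \<in> integer_vectors r"
    then have "\<forall>b\<in>Basis. \<exists>i. i \<in> {-r..r} \<and> k \<bullet> b = real_of_int i" by (auto simp: integer_vectors_def)
    then obtain f where f: "\<forall>b\<in>Basis. f b \<in> {-r..r} \<and> k \<bullet> b = real_of_int (f b)"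
      using bchoice[of Basis "\<lambda>b i. i \<in> {-r..r} \<and> k \<bullet> b = real_of_int i"] by blast
    have "k = (\<Sum>b\<in>Basis. (k \<bullet> b) *\<^sub>R b)" by (simp add: euclidean_representation)
    also have "\<dots> = (\<Sum>b\<in>Basis. real_of_int (restrict f Basis b) *\<^sub>R b)"
      using f by (intro sum.cong) auto
    finally have "k = (\<Sum>b\<in>Basis. real_of_int (restrict f Basis b) *\<^sub>R b)" .
    moreover have "restrict f Basis \<in> Basis \<rightarrow>\<^sub>E {-r..r}" using f by auto
    ultimately show "k \<in> (\<lambda>f. \<Sum>b\<in>Basis. real_of_int (f b) *\<^sub>R b) ` ((Basis :: 'a set) \<rightarrow>\<^sub>E {-r..r})"
      by blast
  qed
  moreover have "finite ((Basis :: 'a set) \<rightarrow>\<^sub>E {-r..r})" by (intro finite_PiE) auto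
  ultimately show ?thesis using finite_surj by blast
qed

lemma lattice_point_neighbour:
  assumes "dist x y \<le> 1"
  shows "lattice_point y - lattice_point x \<in> integer_vectors 1"
  unfolding integer_vectors_def
proof (intro CollectI ballI)
  fix b :: 'a assume b: "b \<in> Basis"
  have "\<bar>y \<bullet> b - x \<bullet> b\<bar> \<le> 1"
    using Basis_le_norm[OF b, of "y - x"] assms by (simp add: dist_norm norm_minus_commute inner_diff_left)
  then have "\<lfloor>y \<bullet> b\<rfloor> - \<lfloor>x \<bullet> b\<rfloor> \<in> {-1..1}" by (simp, linarith)
  then show "\<exists>i\<in>{- 1..1}. (lattice_point y - lattice_point x) \<bullet> b = real_of_int i"
    using b by (intro bexI[of _ "\<lfloor>y \<bullet> b\<rfloor> - \<lfloor>x \<bullet> b\<rfloor>"]) (simp_all add: inner_diff_left)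
qed

lemma lattice_point_bounded:
  assumes "norm x \<le> real r"
  shows "lattice_point x \<in> integer_vectors (int r + 1)"
  unfolding integer_vectors_def
proof (intro CollectI ballI)
  fix b :: 'a assume b: "b \<in> Basis"
  have "\<bar>x \<bullet> b\<bar> \<le> real r" using Basis_le_norm[OF b, of x] assms by simp
  then have "\<lfloor>x \<bullet> b\<rfloor> \<in> {- (int r + 1)..int r + 1}" by (simp, linarith)
  then show "\<exists>i\<in>{- (int r + 1)..int r + 1}. lattice_point x \<bullet> b = real_of_int i"
    using b by (intro bexI[of _ "\<lfloor>x \<bullet> b\<rfloor>"]) simp_all
qed

lemma borel_measurable_lattice_point [measurable]: "lattice_point \<in> borel \<rightarrow>\<^sub>M borel"
  unfolding lattice_point_def[abs_def] by measurable

text \<open>A unit cube times a time slab of length \<open>1 / m\<close>, half-open, so that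
  distinct cells are disjoint. Slabs are numbered by naturals because times are nonnegative.\<close>

definition space_time_cell :: "nat \<Rightarrow> 'a::euclidean_space \<times> nat \<Rightarrow> ('a \<times> real) set" where
  "space_time_cell m c = {p. lattice_point (fst p) = fst c \<and> \<lfloor>real m * snd p\<rfloor> = int (snd c)}"

lemma space_time_cell_sets [measurable]: "space_time_cell m c \<in> sets borel"
proof -
  have "{p \<in> space borel. lattice_point (fst p) = fst c \<and> \<lfloor>real m * snd p\<rfloor> = int (snd c)} \<in> sets borel"
    by measurable
  then show ?thesis by (simp add: space_time_cell_def)
qed

lemma space_time_cell_subset:
  assumes "0 < m"
  shows "space_time_cell m (k, j) \<subseteq> cbox k (k + One) \<times> {real j / real m..(real j + 1) / real m}"
proof
  fix p assume "p \<in> space_time_cell m (k, j)"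
  then have p: "k = lattice_point (fst p)" "\<lfloor>real m * snd p\<rfloor> = int j" by (auto simp: space_time_cell_def)
  have "fst p \<in> cbox k (k + One)"
    unfolding p(1) by (auto simp: mem_box inner_add_left)
  moreover have "real j \<le> real m * snd p" "real m * snd p \<le> real j + 1"
    using p(2) by (auto simp: floor_eq_iff)
  then have "snd p \<in> {real j / real m..(real j + 1) / real m}" using assms by (simp add: field_simps)
  ultimately show "p \<in> cbox k (k + One) \<times> {real j / real m..(real j + 1) / real m}"
    by (simp add: mem_Times_iff)
qed

lemma space_time_cell_bounded: "0 < m \<Longrightarrow> bounded (space_time_cell m c)"
  using space_time_cell_subset[of m "fst c" "snd c"]
  by (auto intro!: bounded_subset[OF bounded_Times] bounded_cbox)

lemma measure_space_time_cell:
  assumes "0 < m"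
  shows "measure lborel (space_time_cell m c) \<le> 1 / real m"
proof -
  obtain k j where c: "c = (k, j)" by (cases c)
  let ?B = "cbox k (k + One) \<times> {real j / real m..(real j + 1) / real m}"
  have "emeasure lborel ?B = emeasure (lborel \<Otimes>\<^sub>M lborel) ?B" by (simp add: lborel_prod)
  also have "\<dots> = emeasure lborel (cbox k (k + One)) * emeasure lborel {real j / real m..(real j + 1) / real m}"
    by (intro lborel.emeasure_pair_measure_Times) auto
  also have "emeasure lborel (cbox k (k + One)) = 1"
    by (subst emeasure_lborel_cbox) (simp_all add: inner_add_left)
  also have "emeasure lborel {real j / real m..(real j + 1) / real m} = ennreal (1 / real m)"
    using assms by (subst emeasure_lborel_Icc) (simp_all add: divide_right_mono diff_divide_distrib[symmetric])
  finally have B: "emeasure lborel ?B = ennreal (1 / real m)" by simp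
  have "emeasure lborel (space_time_cell m c) \<le> emeasure lborel ?B"
    using space_time_cell_subset[OF assms, of k j] unfolding c
    by (intro emeasure_mono) (auto simp: borel_prod[symmetric])
  then show ?thesis unfolding B measure_def using enn2real_mono by fastforce
qed

lemma space_time_cell_disjoint: "c \<noteq> c' \<Longrightarrow> space_time_cell m c \<inter> space_time_cell m c' = {}"
  by (auto simp: space_time_cell_def prod_eq_iff)

lemma pred_descending_chain [measurable (raw)]:
  fixes p :: "'b \<Rightarrow> 'a::euclidean_space \<times> real"
  assumes [measurable]: "n \<in> M \<rightarrow>\<^sub>M configurations" "p \<in> M \<rightarrow>\<^sub>M borel"
  shows "Measurable.pred M (\<lambda>\<omega>. descending_chain i (n \<omega>) (p \<omega>))"
proof -
  have "Measurable.pred (configurations \<Otimes>\<^sub>M borel) (\<lambda>(n, p :: 'a \<times> real). descending_chain i n p)"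
  proof (induction i)
    case (Suc i)
    let ?M = "configurations \<Otimes>\<^sub>M borel :: (('a \<times> real) set \<times> ('a \<times> real)) measure"
    have [measurable]: "Measurable.pred (?M \<Otimes>\<^sub>M borel) (\<lambda>y. descending_chain i (fst (fst y)) (snd y))"
      using measurable_compose[OF _ Suc.IH, of "\<lambda>y. (fst (fst y), snd y)" "?M \<Otimes>\<^sub>M borel"] by simp
    show ?case unfolding descending_chain.simps split_beta' by measurable
  qed simp
  from measurable_compose[OF _ this, of "\<lambda>\<omega>. (n \<omega>, p \<omega>)" M] show ?thesis by simp
qed

context birth_death_data
begin

lemma half_space_sets: "(UNIV :: 'a set) \<times> {0::real..} \<in> sets borel"
  by (intro borel_closed closed_Times) auto

lemma measure_Int_half_space_le:
  assumes "B \<in> sets borel" "bounded B"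
  shows "measure lborel (B \<inter> UNIV \<times> {0..}) \<le> measure lborel (B :: ('a \<times> real) set)"
  using assms half_space_sets emeasure_bounded_finite[OF assms(2)]
  by (intro measure_mono_fmeasurable) (auto simp: fmeasurable_def)

section \<open>Almost sure regularity of the arrivals\<close>

lemma prob_N_meets_le:
  assumes "B \<in> sets borel" "bounded B"
  shows "prob {\<omega> \<in> space M. \<exists>p\<in>N \<omega>. p \<in> B} \<le> measure lborel B"
proof -
  have [measurable]: "B \<in> sets borel" by fact
  have "{\<omega> \<in> space M. N \<omega> \<inter> B = {}} = space M - {\<omega> \<in> space M. \<exists>p\<in>N \<omega>. p \<in> B}" by auto
  then have "prob {\<omega> \<in> space M. \<exists>p\<in>N \<omega>. p \<in> B} = 1 - exp (- measure lborel (B \<inter> UNIV \<times> {0..}))"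
    using prob_N_avoids[OF assms] prob_compl[of "{\<omega> \<in> space M. \<exists>p\<in>N \<omega>. p \<in> B}"] by simp
  also have "\<dots> \<le> measure lborel (B \<inter> UNIV \<times> {0..})"
    using exp_ge_add_one_self[of "- measure lborel (B \<inter> UNIV \<times> {0..})"] by simp
  also have "\<dots> \<le> measure lborel B" by (rule measure_Int_half_space_le[OF assms])
  finally show ?thesis .
qed

text \<open>The quadratic order matters: order \<open>m\<close> slabs of volume of order
  \<open>1 / m\<close> then contribute only order \<open>1 / m\<close> in total.\<close>

lemma prob_N_two_points_le:
  assumes "B \<in> sets borel" "bounded B"
  shows "prob {\<omega> \<in> space M. 2 \<le> card (N \<omega> \<inter> B)} \<le> (measure lborel B)\<^sup>2"
proof -
  let ?B = "B \<inter> UNIV \<times> {0..}"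
  let ?v = "measure lborel ?B"
  have B: "?B \<in> sets borel" "bounded ?B" using assms half_space_sets by (auto intro: bounded_Int)
  have [measurable]: "(\<lambda>\<omega>. card (N \<omega> \<inter> ?B)) \<in> M \<rightarrow>\<^sub>M count_space UNIV" using B by measurable
  have eq: "N \<omega> \<inter> B = N \<omega> \<inter> ?B" if "\<omega> \<in> space M" for \<omega>
    using N_nonneg[OF that] by (auto simp: mem_Times_iff)
  have p: "prob {\<omega> \<in> space M. card (N \<omega> \<inter> ?B) = k} = ?v ^ k / fact k * exp (- ?v)" for k
    using B by (intro prob_N_count) auto
  let ?E = "\<lambda>k. {\<omega> \<in> space M. card (N \<omega> \<inter> ?B) = k}"
  have "{\<omega> \<in> space M. 2 \<le> card (N \<omega> \<inter> B)} = space M - (?E 0 \<union> ?E 1)"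
    using eq by auto
  then have "prob {\<omega> \<in> space M. 2 \<le> card (N \<omega> \<inter> B)} = 1 - prob (?E 0 \<union> ?E 1)"
    using prob_compl[of "?E 0 \<union> ?E 1"] by simp
  also have "prob (?E 0 \<union> ?E 1) = prob (?E 0) + prob (?E 1)"
    by (intro finite_measure_Union) auto
  also have "1 - \<dots> = 1 - (1 + ?v) * exp (- ?v)"
    unfolding p by (simp add: algebra_simps)
  \<comment> \<open>From \<open>exp (- v) \<ge> 1 - v\<close>; the product
    \<open>(1 + v) * (1 - v)\<close> leaves exactly the square.\<close>
  also have "\<dots> \<le> 1 - (1 + ?v) * (1 - ?v)"
    using exp_ge_add_one_self[of "- ?v"] by (intro diff_left_mono mult_left_mono) auto
  also have "\<dots> = ?v\<^sup>2" by (simp add: algebra_simps power2_eq_square)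
  also have "\<dots> \<le> (measure lborel B)\<^sup>2"
    by (intro power_mono measure_Int_half_space_le assms) auto
  finally show ?thesis .
qed

lemma AE_N_avoids_null:
  assumes B: "B \<in> sets borel" "emeasure lborel B = 0"
  shows "AE \<omega> in M. N \<omega> \<inter> B = {}"
proof -
  have "AE \<omega> in M. N \<omega> \<inter> (B \<inter> cball 0 (real m)) = {}" for m :: nat
  proof -
    have Bm: "B \<inter> cball 0 (real m) \<in> sets borel" "bounded (B \<inter> cball 0 (real m))"
      using B(1) by (auto intro: bounded_Int)
    have [measurable]: "B \<inter> cball 0 (real m) \<in> sets borel" by fact
    have "emeasure lborel (B \<inter> cball 0 (real m)) \<le> emeasure lborel B"
      using B(1) by (intro emeasure_mono) auto
    then have "measure lborel (B \<inter> cball 0 (real m)) = 0" using B(2) by (simp add: measure_def)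
    then have "prob {\<omega> \<in> space M. \<exists>p\<in>N \<omega>. p \<in> B \<inter> cball 0 (real m)} \<le> 0"
      using prob_N_meets_le[OF Bm] by simp
    then have "prob {\<omega> \<in> space M. \<exists>p\<in>N \<omega>. p \<in> B \<inter> cball 0 (real m)} = 0"
      using measure_nonneg by (rule antisym)
    moreover have "{\<omega> \<in> space M. \<exists>p\<in>N \<omega>. p \<in> B \<inter> cball 0 (real m)} \<in> events"
      by measurable
    ultimately have "AE \<omega> in M. \<omega> \<notin> {\<omega> \<in> space M. \<exists>p\<in>N \<omega>. p \<in> B \<inter> cball 0 (real m)}"
      by (intro AE_not_in) (simp add: null_sets_def emeasure_eq_measure)
    then show ?thesis by (rule AE_mp) (auto intro!: AE_I2)
  qed
  then have "AE \<omega> in M. \<forall>m. N \<omega> \<inter> (B \<inter> cball 0 (real m)) = {}" by (simp add: AE_all_countable)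
  then show ?thesis
  proof (rule AE_mp, intro AE_I2 impI)
    fix \<omega> assume *: "\<forall>m. N \<omega> \<inter> (B \<inter> cball 0 (real m)) = {}"
    have "p \<notin> B" if "p \<in> N \<omega>" for p
    proof -
      obtain m :: nat where "norm p \<le> real m" using real_arch_simple by blast
      then show ?thesis using * that by fastforce
    qed
    then show "N \<omega> \<inter> B = {}" by auto
  qed
qed

lemma AE_N_pos: "AE \<omega> in M. \<forall>p\<in>N \<omega>. 0 < snd p"
proof -
  have "emeasure lborel ((UNIV :: 'a set) \<times> {0::real}) = emeasure (lborel \<Otimes>\<^sub>M lborel) ((UNIV :: 'a set) \<times> {0::real})"
    by (simp add: lborel_prod)
  also have "\<dots> = 0" by (subst lborel.emeasure_pair_measure_Times) auto
  finally have 0: "emeasure lborel ((UNIV :: 'a set) \<times> {0::real}) = 0" .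
  have "(UNIV :: 'a set) \<times> {0::real} \<in> sets borel" by (intro borel_closed closed_Times) auto
  from AE_N_avoids_null[OF this 0] show ?thesis
  proof (rule AE_mp, intro AE_I2 impI ballI)
    fix \<omega> p assume "\<omega> \<in> space M" "N \<omega> \<inter> UNIV \<times> {0} = {}" "p \<in> N \<omega>"
    then show "0 < snd p" using N_nonneg[of \<omega> p] by (cases p) force
  qed
qed

text \<open>For a fixed initial configuration \<open>h\<close>, which is countable, the cylinder
  \<open>h \<times> UNIV\<close> is a null set and is avoided by \<open>N\<close>. Independence and
  Fubini carry this over to random \<open>h\<close>.\<close>

lemma AE_N_new_places: "AE \<omega> in M. \<forall>p\<in>N \<omega>. fst p \<notin> \<eta>\<^sub>0 \<omega>"
proof -
  interpret D1: prob_space "distr M configurations N" by (rule prob_space_distr) measurable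
  interpret D2: prob_space "distr M configurations \<eta>\<^sub>0" by (rule prob_space_distr) measurable
  interpret P: pair_sigma_finite "distr M configurations N" "distr M configurations \<eta>\<^sub>0" ..
  let ?C = "configurations \<Otimes>\<^sub>M configurations :: (('a \<times> real) set \<times> 'a set) measure"
  have pm [measurable]: "Measurable.pred ?C (\<lambda>x. \<forall>p\<in>fst x. fst p \<notin> snd x)" by measurable
  have ms: "{x \<in> space (distr M configurations N \<Otimes>\<^sub>M distr M configurations \<eta>\<^sub>0). \<forall>p\<in>fst x. fst p \<notin> snd x} \<in>
      sets (distr M configurations N \<Otimes>\<^sub>M distr M configurations \<eta>\<^sub>0)"
    by measurable
  have "AE n in distr M configurations N. \<forall>p\<in>n. fst p \<notin> h" if h: "locally_finite_set h" for h
  proof -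
    have [measurable]: "h \<in> space configurations" using h by (simp add: space_configurations)
    have cs: "h \<in> sets borel"
      using locally_finite_set_countable[OF h] by (auto intro: sets.countable)
    have "emeasure lborel (h \<times> (UNIV :: real set)) = emeasure (lborel \<Otimes>\<^sub>M lborel) (h \<times> (UNIV :: real set))"
      by (simp add: lborel_prod)
    also have "\<dots> = emeasure lborel h * emeasure lborel (UNIV :: real set)"
      using cs by (intro lborel.emeasure_pair_measure_Times) auto
    also have "emeasure lborel h = 0"
      using emeasure_lborel_countable[OF locally_finite_set_countable[OF h]] .
    finally have 0: "emeasure lborel (h \<times> (UNIV :: real set)) = 0" by simp
    have "h \<times> (UNIV :: real set) \<in> sets (borel \<Otimes>\<^sub>M borel)" using cs by auto
    then have "h \<times> (UNIV :: real set) \<in> sets borel" by (simp only: borel_prod)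
    from AE_N_avoids_null[OF this 0] have "AE \<omega> in M. \<forall>p\<in>N \<omega>. fst p \<notin> h"
      by (rule AE_mp) (force intro!: AE_I2)
    then show ?thesis by (subst AE_distr_iff) (measurable)
  qed
  then have "AE h in distr M configurations \<eta>\<^sub>0. AE n in distr M configurations N. \<forall>p\<in>n. fst p \<notin> h"
    by (rule AE_I2) (simp add: space_configurations)
  then have "AE n in distr M configurations N. AE h in distr M configurations \<eta>\<^sub>0. \<forall>p\<in>n. fst p \<notin> h"
    by (subst P.AE_commute[OF ms])
  then have "AE x in distr M configurations N \<Otimes>\<^sub>M distr M configurations \<eta>\<^sub>0. \<forall>p\<in>fst x. fst p \<notin> snd x"
    by (intro P.AE_pair_measure[OF ms]) simp
  then have "AE x in distr M ?C (\<lambda>\<omega>. (N \<omega>, \<eta>\<^sub>0 \<omega>)). \<forall>p\<in>fst x. fst p \<notin> snd x"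
    unfolding distr_N_initial .
  then show ?thesis by (subst (asm) AE_distr_iff) (simp_all add: pm[unfolded pred_def])
qed

text \<open>Off this event, which is rare for large \<open>m\<close>, points at decreasing times occupy time slabs of
  width \<open>1 / m\<close> with strictly decreasing indices.\<close>

definition unseparated :: "real \<Rightarrow> 'a \<times> real \<Rightarrow> nat \<Rightarrow> 'w set" where
  "unseparated R b m = {\<omega> \<in> space M. \<exists>p\<in>N \<omega>. \<exists>q\<in>N \<omega>. p \<noteq> q \<and>
     p \<in> centred_cube R \<and> q \<in> centred_cube R \<and>
     \<lfloor>real m * (p \<bullet> b)\<rfloor> = \<lfloor>real m * (q \<bullet> b)\<rfloor>}"

lemma unseparated_sets [measurable]: "unseparated R b m \<in> events"
  unfolding unseparated_def by measurable

text \<open>At most \<open>6 * R * real m\<close> slabs can meet the cube, and each has volume at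
  most \<open>?K / real m\<close>; the bound for two points in one slab is summed over them.\<close>

lemma prob_unseparated_le:
  assumes b: "b \<in> Basis" and m: "0 < m" and R: "1 \<le> R"
  shows "prob (unseparated R b m) \<le> (6 * R * ((2 * R) ^ (DIM('a \<times> real) - 1))\<^sup>2) / real m"
proof -
  let ?K = "(2 * R) ^ (DIM('a \<times> real) - 1)"
  define J where "J = {- (\<lceil>real m * R\<rceil> + 1)..\<lceil>real m * R\<rceil>}"
  define S where "S j = {x \<in> centred_cube R. \<lfloor>real m * (x \<bullet> b)\<rfloor> = j}" for j
  have S: "S j \<in> sets borel" "bounded (S j)" for j
  proof -
    have "{x \<in> space borel. x \<in> centred_cube R \<and> \<lfloor>real m * (x \<bullet> b)\<rfloor> = j} \<in> sets borel"
      by measurable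
    then show "S j \<in> sets borel" by (simp add: S_def)
    show "bounded (S j)" unfolding S_def by (rule bounded_subset[OF bounded_cbox]) auto
  qed
  have [measurable]: "(\<lambda>\<omega>. card (N \<omega> \<inter> S j)) \<in> M \<rightarrow>\<^sub>M count_space UNIV" for j using S by measurable
  have sub: "unseparated R b m \<subseteq> (\<Union>j\<in>J. {\<omega> \<in> space M. 2 \<le> card (N \<omega> \<inter> S j)})"
  proof
    fix \<omega> assume "\<omega> \<in> unseparated R b m"
    then obtain p q where \<omega>: "\<omega> \<in> space M" and pq: "p \<in> N \<omega>" "q \<in> N \<omega>" "p \<noteq> q"
      "p \<in> centred_cube R" "q \<in> centred_cube R"
      "\<lfloor>real m * (p \<bullet> b)\<rfloor> = \<lfloor>real m * (q \<bullet> b)\<rfloor>"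
      unfolding unseparated_def by blast
    let ?j = "\<lfloor>real m * (p \<bullet> b)\<rfloor>"
    have "{p, q} \<subseteq> N \<omega> \<inter> S ?j" using pq by (auto simp: S_def)
    moreover have "finite (N \<omega> \<inter> S ?j)" using locally_finite_N[OF \<omega>] S by (intro locally_finite_set_bounded)
    ultimately have "card {p, q} \<le> card (N \<omega> \<inter> S ?j)" by (intro card_mono)
    then have "2 \<le> card (N \<omega> \<inter> S ?j)" using pq(3) by simp
    moreover have "?j \<in> J"
    proof -
      have "- R \<le> p \<bullet> b" "p \<bullet> b \<le> R" using pq(4) b by (auto simp: mem_box)
      then have "real m * (- R) \<le> real m * (p \<bullet> b)" "real m * (p \<bullet> b) \<le> real m * R"
        using mult_left_mono[of "- R" "p \<bullet> b" "real m"] mult_left_mono[of "p \<bullet> b" R "real m"] by auto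
      then show ?thesis unfolding J_def by (simp, linarith)
    qed
    ultimately show "\<omega> \<in> (\<Union>j\<in>J. {\<omega> \<in> space M. 2 \<le> card (N \<omega> \<inter> S j)})" using \<omega> by blast
  qed
  have "prob (unseparated R b m) \<le> prob (\<Union>j\<in>J. {\<omega> \<in> space M. 2 \<le> card (N \<omega> \<inter> S j)})"
    using sub by (intro finite_measure_mono sets.finite_UN) (auto simp: J_def)
  also have "\<dots> \<le> (\<Sum>j\<in>J. prob {\<omega> \<in> space M. 2 \<le> card (N \<omega> \<inter> S j)})"
    by (intro finite_measure_subadditive_finite) (auto simp: J_def)
  also have "\<dots> \<le> (\<Sum>j\<in>J. (?K / real m)\<^sup>2)"
  proof (rule sum_mono)
    fix j
    have "prob {\<omega> \<in> space M. 2 \<le> card (N \<omega> \<inter> S j)} \<le> (measure lborel (S j))\<^sup>2"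
      by (rule prob_N_two_points_le[OF S])
    also have "\<dots> \<le> (?K / real m)\<^sup>2"
      unfolding S_def using b m R by (intro power_mono content_slab_le) auto
    finally show "prob {\<omega> \<in> space M. 2 \<le> card (N \<omega> \<inter> S j)} \<le> (?K / real m)\<^sup>2" .
  qed
  also have "\<dots> = real (card J) * (?K / real m)\<^sup>2" by simp
  also have "\<dots> \<le> (6 * R * real m) * (?K / real m)\<^sup>2"
  proof (rule mult_right_mono)
    \<comment> \<open>This absorbs the additive constants of \<open>2 * (real m * R + 1) + 2\<close>
      and is the origin of the factor 6.\<close>
    have ge: "1 \<le> real m * R" using m R mult_mono[of 1 "real m" 1 R] by simp
    then have "1 \<le> \<lceil>real m * R\<rceil>" by linarith
    then have "real (card J) = 2 * \<lceil>real m * R\<rceil> + 2" unfolding J_def by simp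
    also have "\<dots> = 2 * real_of_int \<lceil>real m * R\<rceil> + 2" by simp
    also have "\<dots> \<le> 2 * (real m * R + 1) + 2"
      by (intro add_right_mono mult_left_mono of_int_ceiling_le_add_one) simp
    also have "\<dots> \<le> 6 * R * real m" using ge by (simp add: mult.commute)
    finally show "real (card J) \<le> 6 * R * real m" .
  qed simp
  also have "\<dots> = (6 * R * ?K\<^sup>2) / real m" using m by (simp add: power2_eq_square field_simps)
  finally show ?thesis .
qed

text \<open>Two points with equal coordinate share a slab for every \<open>m\<close>, an event of
  vanishing probability. The time direction gives distinct times, and any one spatial direction
  gives distinct places.\<close>

lemma AE_N_distinct_coordinates:
  assumes b: "b \<in> Basis"
  shows "AE \<omega> in M. inj_on (\<lambda>p. p \<bullet> b) (N \<omega>)"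
proof -
  have sep: "AE \<omega> in M. \<not> (\<exists>p\<in>N \<omega>. \<exists>q\<in>N \<omega>. p \<noteq> q \<and> p \<bullet> b = q \<bullet> b \<and>
      p \<in> centred_cube (real R) \<and> q \<in> centred_cube (real R))"
    if R: "1 \<le> R" for R :: nat
  proof (rule AE_not_if_prob_le)
    let ?K = "6 * real R * ((2 * real R) ^ (DIM('a \<times> real) - 1))\<^sup>2"
    show "unseparated (real R) b (Suc i) \<in> events" for i by measurable
    show "prob (unseparated (real R) b (Suc i)) \<le> ?K / real (Suc i)" for i
      using b R by (intro prob_unseparated_le) auto
    show "(\<lambda>i. ?K / real (Suc i)) \<longlonglongrightarrow> 0"
      using LIMSEQ_Suc[OF lim_const_over_n[of ?K]] .
    fix \<omega> i
    assume "\<omega> \<in> space M" and "\<exists>p\<in>N \<omega>. \<exists>q\<in>N \<omega>. p \<noteq> q \<and> p \<bullet> b = q \<bullet> b \<and>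
      p \<in> centred_cube (real R) \<and> q \<in> centred_cube (real R)"
    then show "\<omega> \<in> unseparated (real R) b (Suc i)"
      unfolding unseparated_def mem_Collect_eq by (metis (no_types))
  qed
  then have "AE \<omega> in M. \<forall>R. \<not> (\<exists>p\<in>N \<omega>. \<exists>q\<in>N \<omega>. p \<noteq> q \<and> p \<bullet> b = q \<bullet> b \<and>
      p \<in> centred_cube (real (Suc R)) \<and> q \<in> centred_cube (real (Suc R)))"
    unfolding AE_all_countable by (intro allI) (rule sep, simp)
  then show ?thesis
  proof (rule AE_mp, intro AE_I2 impI inj_onI)
    fix \<omega> p q
    assume *: "\<forall>R. \<not> (\<exists>p\<in>N \<omega>. \<exists>q\<in>N \<omega>. p \<noteq> q \<and> p \<bullet> b = q \<bullet> b \<and>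
      p \<in> centred_cube (real (Suc R)) \<and> q \<in> centred_cube (real (Suc R)))"
      and pq: "p \<in> N \<omega>" "q \<in> N \<omega>" "p \<bullet> b = q \<bullet> b"
    obtain R :: nat where R: "max (norm p) (norm q) \<le> real R" using real_arch_simple by blast
    have mem: "x \<in> centred_cube (real (Suc R))" if "norm x \<le> real R" for x :: "'a \<times> real"
      unfolding mem_box
    proof
      fix i :: "'a \<times> real" assume i: "i \<in> Basis"
      have "- real (Suc R) \<le> x \<bullet> i" "x \<bullet> i \<le> real (Suc R)"
        using Basis_le_norm[OF i, of x] that by linarith+
      then show "(- real (Suc R) *\<^sub>R One) \<bullet> i \<le> x \<bullet> i \<and> x \<bullet> i \<le> (real (Suc R) *\<^sub>R One) \<bullet> i"
        using i by simp
    qed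
    have "p \<in> centred_cube (real (Suc R))"
      "q \<in> centred_cube (real (Suc R))"
      using mem[of p] mem[of q] R by auto
    then show "p = q" using *[rule_format, of R] pq by blast
  qed
qed

lemma AE_N_distinct_times: "AE \<omega> in M. inj_on snd (N \<omega>)"
proof -
  have "(0, 1) \<in> (Basis :: ('a \<times> real) set)" by (simp add: Basis_prod_def)
  from AE_N_distinct_coordinates[OF this] show ?thesis by (simp add: inner_prod_def)
qed

lemma AE_N_distinct_places: "AE \<omega> in M. inj_on fst (N \<omega>)"
proof -
  obtain b :: 'a where "b \<in> Basis" using nonempty_Basis by blast
  then have "(b, 0) \<in> (Basis :: ('a \<times> real) set)" by (simp add: Basis_prod_def)
  from AE_N_distinct_coordinates[OF this] show ?thesis
  proof (rule AE_mp, intro AE_I2 impI inj_onI)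
    fix \<omega> p q assume "inj_on (\<lambda>p. p \<bullet> (b, 0)) (N \<omega>)" "p \<in> N \<omega>" "q \<in> N \<omega>" "fst p = fst q"
    moreover from this(4) have "p \<bullet> (b, 0) = q \<bullet> (b, 0)" by (simp add: inner_prod_def)
    ultimately show "p = q" by (meson inj_onD)
  qed
qed

section \<open>Chains of occupied cells\<close>

definition occupied :: "nat \<Rightarrow> 'a \<times> nat \<Rightarrow> 'w set" where
  "occupied m c = {\<omega> \<in> space M. \<exists>p\<in>N \<omega>. p \<in> space_time_cell m c}"

lemma occupied_sets [measurable]: "occupied m c \<in> events"
  unfolding occupied_def by measurable

lemma prob_occupied_le:
  assumes "0 < m"
  shows "prob (occupied m c) \<le> 1 / real m"
  using prob_N_meets_le[OF space_time_cell_sets space_time_cell_bounded[OF assms]]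
    measure_space_time_cell[OF assms] unfolding occupied_def by (rule order_trans)

text \<open>Distinct cells are disjoint, so their counts are independent. Intersecting with
  \<open>space M\<close> takes care of empty \<open>S\<close>, where the bare intersection is the
  universal set.\<close>

lemma prob_all_occupied_le:
  assumes m: "0 < m" and S: "finite S"
  shows "prob (space M \<inter> (\<Inter>c\<in>S. occupied m c)) \<le> (1 / real m) ^ card S"
proof (cases "S = {}")
  case False
  obtain f where f: "bij_betw f {..<card S} S" using ex_bij_betw_nat_finite[OF S] by (auto simp: atLeast0LessThan)
  define B where "B i = space_time_cell m (f i) \<inter> UNIV \<times> {0..}" for i
  have B: "B i \<in> sets borel" "bounded (B i)" "B i \<subseteq> UNIV \<times> {0..}" for i
  proof -
    show "bounded (B i)" unfolding B_def
      by (rule bounded_subset[OF space_time_cell_bounded[OF m]]) blast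
  qed (use half_space_sets in \<open>auto simp: B_def\<close>)
  have disj: "disjoint_family_on B {..<card S}"
    unfolding disjoint_family_on_def
  proof (intro ballI impI)
    fix i j assume "i \<in> {..<card S}" "j \<in> {..<card S}" "i \<noteq> j"
    then have "f i \<noteq> f j" using f by (auto simp: bij_betw_def inj_on_def)
    from space_time_cell_disjoint[OF this, of m] show "B i \<inter> B j = {}" unfolding B_def by blast
  qed
  have "\<forall>n (B :: nat \<Rightarrow> ('a \<times> real) set).
        (\<forall>i<n. B i \<in> sets borel \<and> bounded (B i) \<and> B i \<subseteq> UNIV \<times> {0..}) \<and>
        disjoint_family_on B {..<n} \<longrightarrow>
        indep_vars (\<lambda>_. count_space UNIV) (\<lambda>i \<omega>. card (N \<omega> \<inter> B i)) {..<n}"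
    using poisson unfolding unit_poisson_process_def by (elim conjE)
  then have "indep_vars (\<lambda>_. count_space UNIV) (\<lambda>i \<omega>. card (N \<omega> \<inter> B i)) {..<card S}"
    using B disj by simp
  from indep_varsD[OF this, of "{..<card S}" "\<lambda>_. {0<..}"]
  have ind: "prob (\<Inter>i<card S. (\<lambda>\<omega>. card (N \<omega> \<inter> B i)) -` {0<..} \<inter> space M) =
    (\<Prod>i<card S. prob ((\<lambda>\<omega>. card (N \<omega> \<inter> B i)) -` {0<..} \<inter> space M))"
    using False S by (simp add: lessThan_empty_iff card_gt_0_iff)
  have occ: "(\<lambda>\<omega>. card (N \<omega> \<inter> B i)) -` {0<..} \<inter> space M = occupied m (f i)" for i
  proof -
    have "0 < card (N \<omega> \<inter> B i) \<longleftrightarrow> (\<exists>p\<in>N \<omega>. p \<in> space_time_cell m (f i))" if \<omega>: "\<omega> \<in> space M" for \<omega>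
    proof -
      have "finite (N \<omega> \<inter> B i)" using locally_finite_N[OF \<omega>] B(2) by (rule locally_finite_set_bounded)
      moreover have "N \<omega> \<inter> B i = N \<omega> \<inter> space_time_cell m (f i)"
        using N_nonneg[OF \<omega>] by (auto simp: B_def mem_Times_iff)
      ultimately show ?thesis by (auto simp: card_gt_0_iff)
    qed
    then show ?thesis by (auto simp: occupied_def)
  qed
  have "(\<Inter>c\<in>S. occupied m c) = (\<Inter>i<card S. occupied m (f i))"
    using f by (simp add: bij_betw_def image_image[symmetric, of _ f])
  moreover have "(\<Inter>c\<in>S. occupied m c) \<subseteq> space M" using False by (auto simp: occupied_def)
  ultimately have "prob (space M \<inter> (\<Inter>c\<in>S. occupied m c)) = (\<Prod>i<card S. prob (occupied m (f i)))"
    using ind unfolding occ by (simp add: Int_absorb1)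
  also have "\<dots> \<le> (\<Prod>i<card S. 1 / real m)"
    by (intro prod_mono conjI prob_occupied_le m measure_nonneg)
  finally show ?thesis by simp
qed (simp add: prob_space)

text \<open>A step leads to the same or a neighbouring cube and to a strictly earlier slab. Nothing
  is asked of the starting cell beyond its index, so the index can be raised to a common bound, as
  \<open>cell_chain_mono\<close> states.\<close>

primrec cell_chain :: "nat \<Rightarrow> nat \<Rightarrow> 'a \<times> nat \<Rightarrow> 'w set" where
  "cell_chain m 0 c = space M"
| "cell_chain m (Suc i) c = (\<Union>e\<in>integer_vectors 1. \<Union>j<snd c.
     occupied m (fst c + e, j) \<inter> cell_chain m i (fst c + e, j))"

lemma cell_chain_sets [measurable]: "cell_chain m i c \<in> events"
  by (induction i arbitrary: c)
    (auto intro!: sets.finite_UN sets.Int finite_integer_vectors)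

lemma cell_chain_mono: "j \<le> j' \<Longrightarrow> cell_chain m i (k, j) \<subseteq> cell_chain m i (k, j')"
  by (cases i) (auto, fastforce)

text \<open>The time indices along a chain of cells decrease strictly. This makes the cells distinct, hence
  their occupations independent, and it yields the binomial coefficient, whose factor \<open>1 / fact i\<close>
  beats the exponential number of spatial paths. The set \<open>S\<close> collects the cells already visited.\<close>

lemma prob_cell_chain_aux:
  assumes m: "0 < m"
  shows "finite S \<Longrightarrow> (\<And>c. c \<in> S \<Longrightarrow> j \<le> snd c) \<Longrightarrow>
    prob (space M \<inter> (\<Inter>c\<in>S. occupied m c) \<inter> cell_chain m i (k, j)) \<le>
      (1 / real m) ^ card S * (real (card (integer_vectors 1 :: 'a set)) / real m) ^ i * real (j choose i)"
proof (induction i arbitrary: S j k)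
  case 0
  have "prob (space M \<inter> (\<Inter>c\<in>S. occupied m c) \<inter> cell_chain m 0 (k, j)) \<le>
      prob (space M \<inter> (\<Inter>c\<in>S. occupied m c))"
    using 0 by (intro finite_measure_mono) auto
  also have "\<dots> \<le> (1 / real m) ^ card S" by (rule prob_all_occupied_le[OF m 0(1)])
  finally show ?case by simp
next
  case (Suc i)
  let ?E = "integer_vectors 1 :: 'a set"
  let ?\<kappa> = "real (card ?E)"
  let ?A = "\<lambda>e j'. space M \<inter> (\<Inter>c\<in>insert (k + e, j') S. occupied m c) \<inter> cell_chain m i (k + e, j')"
  have occS [measurable]: "space M \<inter> (\<Inter>c\<in>T. occupied m c) \<in> events" if "finite T" for T
    using that by (cases "T = {}") auto
  have A: "?A e j' \<in> events" for e j' using Suc.prems(1) by (intro sets.Int[OF occS]) auto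
  have "space M \<inter> (\<Inter>c\<in>S. occupied m c) \<inter> cell_chain m (Suc i) (k, j) \<subseteq> (\<Union>e\<in>?E. \<Union>j'<j. ?A e j')"
    by auto
  then have "prob (space M \<inter> (\<Inter>c\<in>S. occupied m c) \<inter> cell_chain m (Suc i) (k, j)) \<le>
      prob (\<Union>e\<in>?E. \<Union>j'<j. ?A e j')"
    using A by (intro finite_measure_mono sets.finite_UN finite_integer_vectors) auto
  also have "\<dots> \<le> (\<Sum>e\<in>?E. prob (\<Union>j'<j. ?A e j'))"
    using A by (intro finite_measure_subadditive_finite finite_integer_vectors) auto
  also have "\<dots> \<le> (\<Sum>e\<in>?E. \<Sum>j'<j. prob (?A e j'))"
    using A by (intro sum_mono finite_measure_subadditive_finite) auto
  also have "\<dots> \<le> (\<Sum>e\<in>?E. \<Sum>j'<j. (1 / real m) ^ Suc (card S) * (?\<kappa> / real m) ^ i * real (j' choose i))"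
  proof (intro sum_mono)
    fix e j' assume "j' \<in> {..<j}"
    \<comment> \<open>Visited cells have slab index at least \<open>j\<close>, the next one has
      index below \<open>j\<close>; so it is a new cell.\<close>
    then have "(k + e, j') \<notin> S" using Suc.prems(2)[of "(k + e, j')"] by auto
    then have "card (insert (k + e, j') S) = Suc (card S)" using Suc.prems(1) by simp
    moreover have "j' \<le> snd c" if "c \<in> insert (k + e, j') S" for c
      using that Suc.prems(2)[of c] \<open>j' \<in> {..<j}\<close> by auto
    ultimately show "prob (?A e j') \<le> (1 / real m) ^ Suc (card S) * (?\<kappa> / real m) ^ i * real (j' choose i)"
      using Suc.IH[of "insert (k + e, j') S" j' "k + e"] Suc.prems(1) by simp
  qed
  also have "\<dots> = ?\<kappa> * ((1 / real m) ^ Suc (card S) * (?\<kappa> / real m) ^ i * real (\<Sum>j'<j. j' choose i))"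
    by (simp add: sum_distrib_left)
  \<comment> \<open>The hockey-stick identity sums over the slab of the next cell. Here the strict
    decrease of indices becomes a binomial coefficient.\<close>
  also have "(\<Sum>j'<j. j' choose i) = j choose Suc i"
  proof (cases j)
    case (Suc j0)
    then show ?thesis using sum_choose_upper[of i j0] by (simp add: lessThan_Suc_atMost)
  qed simp
  also have "?\<kappa> * ((1 / real m) ^ Suc (card S) * (?\<kappa> / real m) ^ i * real (j choose Suc i)) =
      (1 / real m) ^ card S * (?\<kappa> / real m) ^ Suc i * real (j choose Suc i)"
    unfolding power_Suc by (simp only: divide_inverse mult_1 mult_ac)
  finally show ?case .
qed

text \<open>Bounding the binomial coefficient by \<open>real (m * T) ^ i / fact i\<close> cancels
  the powers of \<open>m\<close>; the estimate is uniform in the discretization.\<close>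

lemma prob_cell_chain_le:
  assumes m: "0 < m"
  shows "prob (cell_chain m i (k, m * T)) \<le>
    (real (card (integer_vectors 1 :: 'a set)) * real T) ^ i / fact i"
proof -
  let ?\<kappa> = "real (card (integer_vectors 1 :: 'a set))"
  have "prob (cell_chain m i (k, m * T)) \<le> (?\<kappa> / real m) ^ i * real ((m * T) choose i)"
    using prob_cell_chain_aux[OF m, of "{}" "m * T" i k] sets.sets_into_space[OF cell_chain_sets]
    by (simp add: Int_absorb1)
  also have "\<dots> \<le> (?\<kappa> / real m) ^ i * (real (m * T) ^ i / fact i)"
  proof (rule mult_left_mono)
    have "real (((m * T) choose i) * fact i) \<le> real ((m * T) ^ i)"
      using binomial_fact_pow[of "m * T" i] by (simp only: of_nat_le_iff)
    then show "real ((m * T) choose i) \<le> real (m * T) ^ i / fact i"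
      by (simp add: field_simps)
  qed simp
  also have "\<dots> = (?\<kappa> * real T) ^ i / fact i"
    using m by (simp add: power_divide power_mult_distrib)
  finally show ?thesis .
qed

text \<open>A chain of \<open>i\<close> steps stays within distance \<open>i\<close> of its start.
  The condition \<open>norm (fst p) + real i \<le> R\<close> therefore keeps it inside the cube and
  is inherited by the next point with \<open>i\<close> lowered by one. Off
  \<open>unseparated\<close>, taken in the time direction \<open>(0, 1)\<close>, the slab indices of
  successive points differ and hence decrease strictly.\<close>

lemma descending_chain_cell_chain:
  assumes \<omega>: "\<omega> \<in> space M" "\<omega> \<notin> unseparated R (0, 1) m" and m: "0 < m"
  shows "p \<in> N \<omega> \<Longrightarrow> norm (fst p) + real i \<le> R \<Longrightarrow> snd p \<le> R \<Longrightarrow> descending_chain i (N \<omega>) p \<Longrightarrow>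
    \<omega> \<in> cell_chain m i (lattice_point (fst p), nat \<lfloor>real m * snd p\<rfloor>)"
proof (induction i arbitrary: p)
  case (Suc i)
  then obtain q where q: "q \<in> N \<omega>" "snd q < snd p" "dist (fst p) (fst q) \<le> 1" "descending_chain i (N \<omega>) q"
    by auto
  have nq: "norm (fst q) + real i \<le> R"
    using norm_triangle_ineq2[of "fst q" "fst p"] q(3) Suc.prems(2)
    by (simp add: dist_norm norm_minus_commute)
  have box: "x \<in> centred_cube R" if "x \<in> N \<omega>" "norm (fst x) \<le> R" "snd x \<le> R" for x
  proof -
    have "- R \<le> fst x \<bullet> b \<and> fst x \<bullet> b \<le> R" if "b \<in> Basis" for b
      using Basis_le_norm[OF that, of "fst x"] \<open>norm (fst x) \<le> R\<close> by linarith
    moreover have "- R \<le> snd x \<and> snd x \<le> R"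
      using N_nonneg[OF \<omega>(1) that(1)] that(3) by simp
    ultimately have "- R \<le> x \<bullet> i \<and> x \<bullet> i \<le> R" if "i \<in> Basis" for i
      using that by (auto simp: Basis_prod_def inner_prod_def)
    then show ?thesis by (simp add: mem_box)
  qed
  have "\<lfloor>real m * (p \<bullet> (0, 1))\<rfloor> \<noteq> \<lfloor>real m * (q \<bullet> (0, 1))\<rfloor>"
  proof
    assume eq: "\<lfloor>real m * (p \<bullet> (0, 1))\<rfloor> = \<lfloor>real m * (q \<bullet> (0, 1))\<rfloor>"
    have "p \<in> centred_cube R"
      by (rule box[OF Suc.prems(1)]) (use Suc.prems in auto)
    moreover have "q \<in> centred_cube R"
      by (rule box[OF q(1)]) (use nq q(2) Suc.prems(3) in auto)
    moreover have "p \<noteq> q" using q(2) by auto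
    ultimately have "\<omega> \<in> unseparated R (0, 1) m"
      unfolding unseparated_def using \<omega>(1) Suc.prems(1) q(1) eq by blast
    with \<omega>(2) show False ..
  qed
  then have ne: "\<lfloor>real m * snd q\<rfloor> \<noteq> \<lfloor>real m * snd p\<rfloor>" by (simp add: inner_prod_def)
  have "\<lfloor>real m * snd q\<rfloor> \<le> \<lfloor>real m * snd p\<rfloor>" using q(2) by (intro floor_mono mult_left_mono) auto
  moreover have "0 \<le> \<lfloor>real m * snd q\<rfloor>" using N_nonneg[OF \<omega>(1) q(1)] by simp
  ultimately have lt: "nat \<lfloor>real m * snd q\<rfloor> < nat \<lfloor>real m * snd p\<rfloor>" using ne by linarith
  let ?e = "lattice_point (fst q) - lattice_point (fst p)"
  have "?e \<in> integer_vectors 1" by (rule lattice_point_neighbour[OF q(3)])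
  moreover have "\<omega> \<in> occupied m (lattice_point (fst q), nat \<lfloor>real m * snd q\<rfloor>)"
    using \<omega>(1) q(1) \<open>0 \<le> \<lfloor>real m * snd q\<rfloor>\<close> by (auto simp: occupied_def space_time_cell_def)
  moreover have "\<omega> \<in> cell_chain m i (lattice_point (fst q), nat \<lfloor>real m * snd q\<rfloor>)"
    using Suc.IH[OF q(1) nq _ q(4)] q(2) Suc.prems(3) by simp
  moreover have "lattice_point (fst p) + ?e = lattice_point (fst q)" by simp
  ultimately show ?case
    unfolding cell_chain.simps fst_conv snd_conv using lt
    by (intro UN_I[of ?e] UN_I[of "nat \<lfloor>real m * snd q\<rfloor>"]) (simp_all only: IntI lessThan_iff)
qed (use \<omega> in simp)

text \<open>The event does not involve \<open>m\<close>, so the error from unseparated points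
  disappears as \<open>m\<close> tends to infinity. The leading factor counts the cubes in which a
  chain may start.\<close>

lemma prob_long_chain_le:
  fixes r T i :: nat
  shows "prob {\<omega> \<in> space M. \<exists>p\<in>N \<omega>. norm (fst p) \<le> real r \<and> snd p \<le> real T \<and> descending_chain i (N \<omega>) p} \<le>
    real (card (integer_vectors (int r + 1) :: 'a set)) *
      ((real (card (integer_vectors 1 :: 'a set)) * real T) ^ i / fact i)" (is "prob ?D \<le> ?L * ?c")
proof -
  \<comment> \<open>Large enough for start radius \<open>r\<close>, \<open>i\<close> unit steps and
    times up to \<open>T\<close>; the final 1 ensures \<open>1 \<le> R\<close> for
    \<open>prob_unseparated_le\<close>.\<close>
  let ?R = "real (r + i + T + 1)"
  let ?K = "6 * ?R * ((2 * ?R) ^ (DIM('a \<times> real) - 1))\<^sup>2"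
  have b: "(0, 1) \<in> (Basis :: ('a \<times> real) set)" by (simp add: Basis_prod_def)
  have D: "?D \<in> events" by measurable
  have "prob ?D \<le> ?K / real (Suc m) + ?L * ?c" for m
  proof -
    let ?V = "\<Union>k\<in>integer_vectors (int r + 1). cell_chain (Suc m) i (k, Suc m * T)"
    have V: "?V \<in> events" by (intro sets.finite_UN finite_integer_vectors) auto
    have "?D \<subseteq> unseparated ?R (0, 1) (Suc m) \<union> ?V"
    proof
      fix \<omega> assume "\<omega> \<in> ?D"
      then obtain p where p: "\<omega> \<in> space M" "p \<in> N \<omega>" "norm (fst p) \<le> real r" "snd p \<le> real T"
        "descending_chain i (N \<omega>) p" by blast
      show "\<omega> \<in> unseparated ?R (0, 1) (Suc m) \<union> ?V"
      proof (cases "\<omega> \<in> unseparated ?R (0, 1) (Suc m)")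
        case False
        have "\<omega> \<in> cell_chain (Suc m) i (lattice_point (fst p), nat \<lfloor>real (Suc m) * snd p\<rfloor>)"
          using p by (intro descending_chain_cell_chain[OF p(1) False]) auto
        moreover have "nat \<lfloor>real (Suc m) * snd p\<rfloor> \<le> Suc m * T"
        proof -
          have "real (Suc m) * snd p \<le> real (Suc m) * real T" using p(4) by (rule mult_left_mono) simp
          then have "real (Suc m) * snd p \<le> real (Suc m * T)" by (simp only: of_nat_mult)
          then show ?thesis by linarith
        qed
        ultimately have "\<omega> \<in> cell_chain (Suc m) i (lattice_point (fst p), Suc m * T)"
          using cell_chain_mono by blast
        then show ?thesis using lattice_point_bounded[OF p(3)] by blast
      qed simp
    qed
    then have "prob ?D \<le> prob (unseparated ?R (0, 1) (Suc m) \<union> ?V)"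
      using V by (intro finite_measure_mono) auto
    also have "\<dots> \<le> prob (unseparated ?R (0, 1) (Suc m)) + prob ?V"
      using V by (intro measure_Un_le) auto
    also have "prob (unseparated ?R (0, 1) (Suc m)) \<le> ?K / real (Suc m)"
      by (intro prob_unseparated_le b) auto
    also have "prob ?V \<le> (\<Sum>k\<in>integer_vectors (int r + 1). prob (cell_chain (Suc m) i (k, Suc m * T)))"
      by (intro finite_measure_subadditive_finite finite_integer_vectors) auto
    also have "\<dots> \<le> (\<Sum>k\<in>(integer_vectors (int r + 1) :: 'a set). ?c)"
      by (intro sum_mono prob_cell_chain_le) simp
    finally show ?thesis by simp
  qed
  moreover have "(\<lambda>m. ?K / real (Suc m) + ?L * ?c) \<longlonglongrightarrow> 0 + ?L * ?c"
    by (intro tendsto_add tendsto_const LIMSEQ_Suc[OF lim_const_over_n])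
  ultimately show ?thesis by (intro LIMSEQ_le_const[of _ "?L * ?c"]) auto
qed

lemma AE_N_finite_chains: "AE \<omega> in M. \<forall>p\<in>N \<omega>. \<exists>i. \<not> descending_chain i (N \<omega>) p"
proof -
  have "AE \<omega> in M. \<not> (\<exists>p\<in>N \<omega>. norm (fst p) \<le> real r \<and> snd p \<le> real r \<and> (\<forall>i. descending_chain i (N \<omega>) p))"
    for r :: nat
  proof (rule AE_not_if_prob_le)
    let ?L = "real (card (integer_vectors (int r + 1) :: 'a set))"
    let ?x = "real (card (integer_vectors 1 :: 'a set)) * real r"
    let ?D = "\<lambda>i. {\<omega> \<in> space M. \<exists>p\<in>N \<omega>. norm (fst p) \<le> real r \<and> snd p \<le> real r \<and> descending_chain i (N \<omega>) p}"
    show "?D i \<in> events" for i by measurable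
    show "prob (?D i) \<le> ?L * (?x ^ i / fact i)" for i by (rule prob_long_chain_le)
    have "(\<lambda>i. ?x ^ i / fact i) \<longlonglongrightarrow> 0"
      using summable_LIMSEQ_zero[OF summable_exp[of ?x]] by (simp add: divide_inverse mult.commute)
    from tendsto_mult_right_zero[OF this]
    show "(\<lambda>i. ?L * (?x ^ i / fact i)) \<longlonglongrightarrow> 0" .
  qed blast
  then have "AE \<omega> in M. \<forall>r::nat. \<not> (\<exists>p\<in>N \<omega>. norm (fst p) \<le> real r \<and> snd p \<le> real r \<and>
      (\<forall>i. descending_chain i (N \<omega>) p))"
    unfolding AE_all_countable by blast
  then show ?thesis
  proof (rule AE_mp, intro AE_I2 impI ballI)
    fix \<omega> p
    assume *: "\<forall>r::nat. \<not> (\<exists>p\<in>N \<omega>. norm (fst p) \<le> real r \<and> snd p \<le> real r \<and>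
      (\<forall>i. descending_chain i (N \<omega>) p))" and p: "p \<in> N \<omega>"
    obtain r :: nat where "max (norm (fst p)) (snd p) \<le> real r" using real_arch_simple by blast
    then show "\<exists>i. \<not> descending_chain i (N \<omega>) p" using *[rule_format, of r] p by auto
  qed
qed

lemma AE_hard_core_birth_death:
  "AE \<omega> in M. hard_core_birth_death (N \<omega>) (\<eta>\<^sub>0 \<omega>) (I \<omega>) (birth_death (N \<omega>) (\<eta>\<^sub>0 \<omega>) (Z \<omega>))"
proof -
  have hc: "AE \<omega> in M. hard_core (\<eta>\<^sub>0 \<omega>)" using initial by (simp add: hard_core_point_process_def)
  show ?thesis
    using hc AE_N_pos AE_N_distinct_times AE_N_distinct_places AE_N_new_places AE_N_finite_chains AE_space
  proof eventually_elim
    case (elim \<omega>)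
    interpret regular_arrivals "N \<omega>" "\<eta>\<^sub>0 \<omega>"
      using elim locally_finite_N locally_finite_\<eta>\<^sub>0 by unfold_locales auto
    have anti: "\<forall>(p, q)\<in>marked_pairs (N \<omega>) (\<eta>\<^sub>0 \<omega>). I \<omega> q p \<longleftrightarrow> \<not> I \<omega> p q"
      using marks elim(7) unfolding independent_marks_def by (elim conjE) (erule bspec)
    show ?case
    proof (rule hard_core_birth_death_process)
      show "I \<omega> q p \<longleftrightarrow> \<not> I \<omega> p q" if "(p, q) \<in> marked_pairs (N \<omega>) (\<eta>\<^sub>0 \<omega>)" for p q
        using bspec[OF anti that] by simp
    qed (simp add: Z_def Y_def)
  qed
qed

end

section \<open>Stationarity\<close>

definition shift3 :: "'a::euclidean_space \<Rightarrow>
    ('a \<times> real) set \<times> 'a set \<times> (('a \<times> real) \<times> ('a \<times> real)) set \<Rightarrow>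
    ('a \<times> real) set \<times> 'a set \<times> (('a \<times> real) \<times> ('a \<times> real)) set" where
  "shift3 v x = ((+) (v, 0) ` fst x, (+) v ` fst (snd x), (+) ((v, 0), (v, 0)) ` snd (snd x))"

lemma measurable_shift3 [measurable]: "shift3 v \<in> configurations3 \<rightarrow>\<^sub>M configurations3"
  unfolding shift3_def[abs_def] by measurable

lemma translation_avoiding:
  fixes \<xi> :: "'a::euclidean_space set"
  assumes "locally_finite_set \<xi>"
  shows "(+) w ` \<xi> \<in> avoiding B \<longleftrightarrow> \<xi> \<in> avoiding ((+) w -` B)"
  using assms locally_finite_set_translation[OF assms, of w] by (auto simp: avoiding_def)

lemma translation_preimage:
  fixes B :: "'a::euclidean_space set"
  shows "B \<in> sets borel \<Longrightarrow> (+) w -` B \<in> sets borel" and "bounded B \<Longrightarrow> bounded ((+) w -` B)"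
proof -
  have "(+) w \<in> borel \<rightarrow>\<^sub>M borel" by measurable
  then show "B \<in> sets borel \<Longrightarrow> (+) w -` B \<in> sets borel"
    using measurable_sets[of "(+) w" borel borel B] by simp
  have "(+) w -` B \<subseteq> (+) (- w) ` B"
  proof
    fix x assume "x \<in> (+) w -` B"
    then have "w + x \<in> B" "x = - w + (w + x)" by auto
    then show "x \<in> (+) (- w) ` B" by blast
  qed
  then show "bounded B \<Longrightarrow> bounded ((+) w -` B)" using bounded_translation bounded_subset by metis
qed

lemma card_translation_Int:
  fixes \<xi> :: "'a::euclidean_space set"
  shows "card ((+) w ` \<xi> \<inter> B) = card (\<xi> \<inter> (+) w -` B)"
proof -
  have "(+) w ` \<xi> \<inter> B = (+) w ` (\<xi> \<inter> (+) w -` B)" by auto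
  then show ?thesis by (simp add: card_image)
qed

context birth_death_data
begin

definition X :: "'w \<Rightarrow> ('a \<times> real) set \<times> 'a set \<times> (('a \<times> real) \<times> ('a \<times> real)) set" where
  "X \<omega> = (N \<omega>, \<eta>\<^sub>0 \<omega>, Z \<omega>)"

lemma measurable_X [measurable]: "X \<in> M \<rightarrow>\<^sub>M configurations3"
  unfolding X_def[abs_def] by measurable

text \<open>The conditional probability, given arrivals \<open>n\<close> and initial configuration
  \<open>h\<close>, that the triple lies in \<open>avoiding3 B C D\<close>.\<close>

definition weight :: "('a \<times> real) set \<Rightarrow> 'a set \<Rightarrow> (('a \<times> real) \<times> ('a \<times> real)) set \<Rightarrow>
    ('a \<times> real) set \<Rightarrow> 'a set \<Rightarrow> real" where
  "weight B C D n h = indicator (avoiding B) n * indicator (avoiding C) h *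
     (1 - \<rho>) ^ card (marked_pairs n h \<inter> D)"

lemma weight_nonneg: "0 \<le> weight B C D n h"
  and weight_le_1: "weight B C D n h \<le> 1"
  using rho by (auto simp: weight_def indicator_def power_le_one)

lemma abs_weight_le_1: "\<bar>weight B C D n h\<bar> \<le> 1"
  using weight_nonneg weight_le_1 by simp

lemma measurable_weight:
  assumes "B \<in> sets borel" "bounded B" "C \<in> sets borel" "bounded C" "D \<in> sets borel" "bounded D"
  shows "(\<lambda>x. weight B C D (fst x) (snd x)) \<in> borel_measurable (configurations \<Otimes>\<^sub>M configurations)"
proof -
  have [measurable]: "avoiding B \<in> sets configurations" "avoiding C \<in> sets configurations"
    using assms by auto
  have [measurable]: "(\<lambda>x. card (marked_pairs (fst x) (snd x) \<inter> D)) \<in>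
      configurations \<Otimes>\<^sub>M configurations \<rightarrow>\<^sub>M count_space UNIV"
    using assms by measurable
  show ?thesis unfolding weight_def by measurable
qed

lemma borel_measurable_weight [measurable (raw)]:
  assumes "B \<in> sets borel" "bounded B" "C \<in> sets borel" "bounded C" "D \<in> sets borel" "bounded D"
    and "n \<in> K \<rightarrow>\<^sub>M configurations" "h \<in> K \<rightarrow>\<^sub>M configurations"
  shows "(\<lambda>x. weight B C D (n x) (h x)) \<in> borel_measurable K"
  using measurable_compose[OF measurable_Pair[OF assms(7,8)] measurable_weight[OF assms(1-6)]] by simp

lemma subalgebra_G: "subalgebra M G"
  using sets_G_subset by (simp add: subalgebra_def)

sublocale G: finite_measure_subalgebra M G
  by unfold_locales (rule subalgebra_G)

text \<open>\<open>measure_unmarked\<close> identifies the conditional expectation of the avoidance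
  event given \<open>G\<close>; a factor measurable for \<open>G\<close> can then be carried
  along.\<close>

lemma integral_unmarked:
  assumes g: "g \<in> borel_measurable G" "integrable M g" and D: "D \<in> sets borel" "bounded D"
  shows "(\<integral>\<omega>. g \<omega> * indicator {\<omega> \<in> space M. Z \<omega> \<inter> D = {}} \<omega> \<partial>M) =
    (\<integral>\<omega>. g \<omega> * (1 - \<rho>) ^ card (Y \<omega> \<inter> D) \<partial>M)"
proof -
  let ?E = "{\<omega> \<in> space M. Z \<omega> \<inter> D = {}}"
  let ?c = "\<lambda>\<omega>. (1 - \<rho>) ^ card (Y \<omega> \<inter> D)"
  have top: "space M \<in> sets G" using sets.top[of G] by simp
  have [measurable]: "?E \<in> events" by (rule unmarked_sets[OF top D])
  note [measurable] = measurable_Y_G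
  have [measurable]: "(\<lambda>\<omega>. card (Y \<omega> \<inter> D)) \<in> G \<rightarrow>\<^sub>M count_space UNIV" using D by measurable
  have cG: "?c \<in> borel_measurable G" by measurable
  then have [measurable]: "?c \<in> borel_measurable M" by (rule measurable_from_subalg[OF subalgebra_G])
  have [measurable]: "g \<in> borel_measurable M" by (rule measurable_from_subalg[OF subalgebra_G g(1)])
  have c1: "norm (?c \<omega>) \<le> 1" for \<omega> using rho by (simp add: power_le_one)
  have ce: "AE \<omega> in M. real_cond_exp M G (indicator ?E) \<omega> = ?c \<omega>"
  proof (rule G.real_cond_exp_charact)
    fix A assume A: "A \<in> sets G"
    then have [measurable]: "A \<in> events" using sets_G_subset by blast
    have "(\<integral>\<omega>\<in>A. indicator ?E \<omega> \<partial>M) = (\<integral>\<omega>. indicator {\<omega> \<in> A. Z \<omega> \<inter> D = {}} \<omega> \<partial>M)"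
      unfolding set_lebesgue_integral_def
      using sets.sets_into_space[OF A] by (intro Bochner_Integration.integral_cong) (auto simp: indicator_def)
    also have "\<dots> = prob {\<omega> \<in> A. Z \<omega> \<inter> D = {}}"
      using unmarked_sets[OF A D] by simp
    also have "\<dots> = (\<integral>\<omega>. indicator A \<omega> * ?c \<omega> \<partial>M)"
      by (rule measure_unmarked[OF A D])
    finally show "(\<integral>\<omega>\<in>A. indicator ?E \<omega> \<partial>M) = (\<integral>\<omega>\<in>A. ?c \<omega> \<partial>M)"
      by (simp add: set_lebesgue_integral_def)
  next
    show "integrable M (indicat_real ?E)"
      by (intro integrable_const_bound[where B=1]) (auto simp: indicator_def)
    show "integrable M ?c" using c1 by (intro integrable_const_bound[where B=1]) auto
  qed (use cG in auto)
  have "integrable M (\<lambda>\<omega>. g \<omega> * indicator ?E \<omega>)"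
    using g(2) by (rule Bochner_Integration.integrable_bound) (auto simp: indicator_def)
  from G.real_cond_exp_intg(2)[OF this g(1)]
  have "(\<integral>\<omega>. g \<omega> * indicator ?E \<omega> \<partial>M) = (\<integral>\<omega>. g \<omega> * real_cond_exp M G (indicator ?E) \<omega> \<partial>M)"
    by simp
  also have "\<dots> = (\<integral>\<omega>. g \<omega> * ?c \<omega> \<partial>M)"
    using ce by (intro integral_cong_AE) auto
  finally show ?thesis .
qed

lemma measurable_N_G: "N \<in> G \<rightarrow>\<^sub>M configurations"
  using measurable_compose[OF measurable_NG measurable_fst] by simp

lemma measurable_initial_G: "\<eta>\<^sub>0 \<in> G \<rightarrow>\<^sub>M configurations"
  using measurable_compose[OF measurable_NG measurable_snd] by simp

lemma integral_avoiding3: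
  assumes g: "g \<in> borel_measurable G" "integrable M g"
    and B: "B \<in> sets borel" "bounded B" "C \<in> sets borel" "bounded C" "D \<in> sets borel" "bounded D"
  shows "(\<integral>\<omega>. g \<omega> * indicator (avoiding3 B C D) (X \<omega>) \<partial>M) =
    (\<integral>\<omega>. g \<omega> * weight B C D (N \<omega>) (\<eta>\<^sub>0 \<omega>) \<partial>M)"
proof -
  let ?g = "\<lambda>\<omega>. g \<omega> * (indicator (avoiding B) (N \<omega>) * indicator (avoiding C) (\<eta>\<^sub>0 \<omega>))"
  have [measurable]: "avoiding B \<in> sets configurations" "avoiding C \<in> sets configurations"
    using B by auto
  note [measurable] = measurable_N_G measurable_initial_G g(1)
  have gG: "?g \<in> borel_measurable G" by measurable
  then have "?g \<in> borel_measurable M" by (rule measurable_from_subalg[OF subalgebra_G])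
  then have "integrable M ?g"
    by (intro Bochner_Integration.integrable_bound[OF g(2)]) (auto simp: indicator_def)
  from integral_unmarked[OF gG this B(5,6)]
  have "(\<integral>\<omega>. ?g \<omega> * indicator {\<omega> \<in> space M. Z \<omega> \<inter> D = {}} \<omega> \<partial>M) =
    (\<integral>\<omega>. ?g \<omega> * (1 - \<rho>) ^ card (Y \<omega> \<inter> D) \<partial>M)" .
  moreover have "(\<integral>\<omega>. g \<omega> * indicator (avoiding3 B C D) (X \<omega>) \<partial>M) =
      (\<integral>\<omega>. ?g \<omega> * indicator {\<omega> \<in> space M. Z \<omega> \<inter> D = {}} \<omega> \<partial>M)"
  proof (intro Bochner_Integration.integral_cong refl)
    fix \<omega> assume \<omega>: "\<omega> \<in> space M"
    have "locally_finite_set (Z \<omega>)" using measurable_space[OF measurable_Z \<omega>] by (simp add: space_configurations)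
    then have "X \<omega> \<in> avoiding3 B C D \<longleftrightarrow> N \<omega> \<in> avoiding B \<and> \<eta>\<^sub>0 \<omega> \<in> avoiding C \<and> Z \<omega> \<inter> D = {}"
      by (simp add: X_def avoiding3_def) (auto simp: avoiding_def)
    then show "g \<omega> * indicator (avoiding3 B C D) (X \<omega>) = ?g \<omega> * indicator {\<omega> \<in> space M. Z \<omega> \<inter> D = {}} \<omega>"
      using \<omega> by (auto simp: indicator_def)
  qed
  ultimately show ?thesis by (simp add: weight_def Y_def mult.assoc)
qed

lemma prob_X_avoiding3:
  assumes B: "B \<in> sets borel" "bounded B" "C \<in> sets borel" "bounded C" "D \<in> sets borel" "bounded D"
  shows "prob (X -` avoiding3 B C D \<inter> space M) = (\<integral>\<omega>. weight B C D (N \<omega>) (\<eta>\<^sub>0 \<omega>) \<partial>M)"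
proof -
  have "avoiding3 B C D \<in> avoiding3_events" unfolding avoiding3_events_def using B by blast
  then have [measurable]: "avoiding3 B C D \<in> sets configurations3" by (rule avoiding3_sets)
  have "(\<integral>\<omega>. (1::real) * indicator (avoiding3 B C D) (X \<omega>) \<partial>M) =
      (\<integral>\<omega>. indicator (X -` avoiding3 B C D \<inter> space M) \<omega> \<partial>M)"
    by (intro Bochner_Integration.integral_cong) (auto simp: indicator_def)
  also have "\<dots> = prob (X -` avoiding3 B C D \<inter> space M)" by simp
  finally have "prob (X -` avoiding3 B C D \<inter> space M) =
      (\<integral>\<omega>. (1::real) * indicator (avoiding3 B C D) (X \<omega>) \<partial>M)" ..
  also have "\<dots> = (\<integral>\<omega>. 1 * weight B C D (N \<omega>) (\<eta>\<^sub>0 \<omega>) \<partial>M)"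
    by (rule integral_avoiding3[OF _ _ B]) simp_all
  finally show ?thesis by (simp only: mult_1)
qed

text \<open>Fubini for the product law: the inner variable \<omega>' averages over the arrivals
  while the initial configuration is frozen, one sample space serving for both integrals.\<close>

lemma integral_N_initial:
  assumes F: "(\<lambda>x. F (fst x) (snd x)) \<in> borel_measurable (configurations \<Otimes>\<^sub>M configurations)"
    and bound: "\<And>n h. \<bar>F n h\<bar> \<le> (1::real)"
  shows "(\<integral>\<omega>. F (N \<omega>) (\<eta>\<^sub>0 \<omega>) \<partial>M) = (\<integral>\<omega>. (\<integral>\<omega>'. F (N \<omega>') (\<eta>\<^sub>0 \<omega>) \<partial>M) \<partial>M)"
    and "(\<lambda>h. \<integral>\<omega>'. F (N \<omega>') h \<partial>M) \<in> borel_measurable configurations"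
proof -
  let ?N = "distr M configurations N" and ?H = "distr M configurations \<eta>\<^sub>0"
  interpret D1: prob_space ?N by (rule prob_space_distr) measurable
  interpret D2: prob_space ?H by (rule prob_space_distr) measurable
  interpret P: pair_prob_space ?N ?H ..
  have [measurable]: "(\<lambda>x. F (fst x) (snd x)) \<in> borel_measurable (configurations \<Otimes>\<^sub>M configurations)" by fact
  have inner: "(\<integral>\<omega>'. F (N \<omega>') h \<partial>M) = (\<integral>n. F n h \<partial>?N)" if "h \<in> space configurations" for h
  proof -
    have "(\<lambda>n. F n h) \<in> borel_measurable configurations"
      using measurable_compose[OF _ F, of "\<lambda>n. (n, h)" configurations] that by simp
    then show ?thesis by (simp add: integral_distr)
  qed
  have meas: "(\<lambda>h. \<integral>n. F n h \<partial>?N) \<in> borel_measurable configurations"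
  proof -
    have "(\<lambda>(h, n). F n h) \<in> borel_measurable (configurations \<Otimes>\<^sub>M ?N)"
      using measurable_compose[OF _ F, of "\<lambda>x. (snd x, fst x)" "configurations \<Otimes>\<^sub>M configurations"]
      by (simp add: split_beta' cong: measurable_cong_sets sets_pair_measure_cong)
    then show ?thesis by (rule D1.borel_measurable_lebesgue_integral)
  qed
  show m2: "(\<lambda>h. \<integral>\<omega>'. F (N \<omega>') h \<partial>M) \<in> borel_measurable configurations"
    using meas inner by (simp cong: measurable_cong)
  have "(\<integral>\<omega>. F (N \<omega>) (\<eta>\<^sub>0 \<omega>) \<partial>M) =
      (\<integral>x. F (fst x) (snd x) \<partial>distr M (configurations \<Otimes>\<^sub>M configurations) (\<lambda>\<omega>. (N \<omega>, \<eta>\<^sub>0 \<omega>)))"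
    by (subst integral_distr) (simp_all add: F)
  also have "\<dots> = (\<integral>x. F (fst x) (snd x) \<partial>(?N \<Otimes>\<^sub>M ?H))" unfolding distr_N_initial ..
  also have "\<dots> = (\<integral>h. (\<integral>n. F n h \<partial>?N) \<partial>?H)"
  proof -
    have "integrable (?N \<Otimes>\<^sub>M ?H) (\<lambda>(n, h). F n h)"
      unfolding split_beta' using bound F
      by (intro P.integrable_const_bound[where B=1])
        (simp_all cong: measurable_cong_sets sets_pair_measure_cong)
    from P.integral_snd[OF this] show ?thesis by (simp add: split_beta')
  qed
  also have "\<dots> = (\<integral>\<omega>. (\<integral>n. F n (\<eta>\<^sub>0 \<omega>) \<partial>?N) \<partial>M)"
    using meas by (subst integral_distr) simp_all
  also have "\<dots> = (\<integral>\<omega>. (\<integral>\<omega>'. F (N \<omega>') (\<eta>\<^sub>0 \<omega>) \<partial>M) \<partial>M)"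
    using measurable_space[OF measurable_initial]
    by (intro Bochner_Integration.integral_cong) (simp_all add: inner)
  finally show "(\<integral>\<omega>. F (N \<omega>) (\<eta>\<^sub>0 \<omega>) \<partial>M) = (\<integral>\<omega>. (\<integral>\<omega>'. F (N \<omega>') (\<eta>\<^sub>0 \<omega>) \<partial>M) \<partial>M)" .
qed

lemma shift3_X_avoiding3:
  assumes "\<omega> \<in> space M"
  shows "shift3 v (X \<omega>) \<in> avoiding3 B C D \<longleftrightarrow>
    X \<omega> \<in> avoiding3 ((+) (v, 0) -` B) ((+) v -` C) ((+) ((v, 0), (v, 0)) -` D)"
proof -
  have "locally_finite_set (Z \<omega>)" using measurable_space[OF measurable_Z assms] by (simp add: space_configurations)
  then show ?thesis
    unfolding shift3_def X_def avoiding3_def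
    using locally_finite_N[OF assms] locally_finite_\<eta>\<^sub>0[OF assms] by (simp add: translation_avoiding)
qed

lemma weight_shift:
  assumes "locally_finite_set n" "locally_finite_set h"
  shows "weight ((+) (v, 0) -` B) ((+) v -` C) ((+) ((v, 0), (v, 0)) -` D) n h =
    weight B C D ((+) (v, 0) ` n) ((+) v ` h)"
  unfolding weight_def shift_marked_pairs card_translation_Int
  using translation_avoiding[OF assms(1), of "(v, 0)" B] translation_avoiding[OF assms(2), of v C]
  by (simp add: indicator_def)

text \<open>On generating events the shift moves into \<open>weight\<close>. The inner average then
  absorbs it for the arrivals by invariance of their law, and the outer one for the initial
  configuration by its stationarity; the marks follow, since \<open>marked_pairs\<close> is
  equivariant.\<close>

lemma distr_X_shift:
  assumes stat: "stationary M \<eta>\<^sub>0"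
  shows "distr M configurations3 (\<lambda>\<omega>. shift3 v (X \<omega>)) = distr M configurations3 X"
proof (rule measure_eqI_generator_eq[OF Int_stable_avoiding3_events avoiding3_events_Pow])
  fix U :: "(('a \<times> real) set \<times> 'a set \<times> (('a \<times> real) \<times> ('a \<times> real)) set) set"
  assume U: "U \<in> avoiding3_events"
  then obtain B C D where BCD: "U = avoiding3 B C D"
    "B \<in> sets borel" "bounded B" "C \<in> sets borel" "bounded C" "D \<in> sets borel" "bounded D"
    unfolding avoiding3_events_def by blast
  note [measurable] = avoiding3_sets[OF U]
  let ?B = "(+) (v, 0) -` B" and ?C = "(+) v -` C" and ?D = "(+) ((v, 0), (v, 0)) -` D"
  have pre: "?B \<in> sets borel" "bounded ?B" "?C \<in> sets borel" "bounded ?C" "?D \<in> sets borel" "bounded ?D"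
    using BCD by (auto simp only: intro!: translation_preimage)
  let ?F = "\<lambda>n h. weight B C D n h"
  let ?G = "\<lambda>n h. weight B C D ((+) (v, 0) ` n) ((+) v ` h)"
  have F: "(\<lambda>x. ?F (fst x) (snd x)) \<in> borel_measurable (configurations \<Otimes>\<^sub>M configurations)"
    by (rule measurable_weight[OF BCD(2-7)])
  have G: "(\<lambda>x. ?G (fst x) (snd x)) \<in> borel_measurable (configurations \<Otimes>\<^sub>M configurations)"
    using BCD by measurable
  have inner: "(\<integral>\<omega>'. ?G (N \<omega>') h \<partial>M) = (\<integral>\<omega>'. ?F (N \<omega>') ((+) v ` h) \<partial>M)"
    if h: "h \<in> space configurations" for h
  proof -
    have h': "(+) v ` h \<in> space configurations"
      using h locally_finite_set_translation by (auto simp: space_configurations)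
    have m: "(\<lambda>n. ?F n ((+) v ` h)) \<in> borel_measurable configurations"
      using measurable_compose[OF _ F, of "\<lambda>n. (n, (+) v ` h)" configurations] h' by simp
    have "(\<integral>\<omega>'. ?G (N \<omega>') h \<partial>M) = (\<integral>n. ?F n ((+) v ` h) \<partial>distr M configurations (\<lambda>\<omega>. (+) (v, 0) ` N \<omega>))"
      using m by (subst integral_distr) simp_all
    also have "\<dots> = (\<integral>\<omega>'. ?F (N \<omega>') ((+) v ` h) \<partial>M)"
      unfolding distr_N_shift using m by (subst integral_distr) simp_all
    finally show ?thesis .
  qed
  have "prob ((\<lambda>\<omega>. shift3 v (X \<omega>)) -` U \<inter> space M) = prob (X -` avoiding3 ?B ?C ?D \<inter> space M)"
    unfolding BCD(1) by (rule arg_cong[where f=prob]) (use shift3_X_avoiding3 in blast)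
  also have "\<dots> = (\<integral>\<omega>. weight ?B ?C ?D (N \<omega>) (\<eta>\<^sub>0 \<omega>) \<partial>M)"
    by (rule prob_X_avoiding3[OF pre])
  also have "\<dots> = (\<integral>\<omega>. ?G (N \<omega>) (\<eta>\<^sub>0 \<omega>) \<partial>M)"
    by (intro Bochner_Integration.integral_cong refl weight_shift locally_finite_N locally_finite_\<eta>\<^sub>0)
  also have "\<dots> = (\<integral>\<omega>. (\<integral>\<omega>'. ?G (N \<omega>') (\<eta>\<^sub>0 \<omega>) \<partial>M) \<partial>M)"
    by (rule integral_N_initial(1)[OF G abs_weight_le_1])
  also have "\<dots> = (\<integral>\<omega>. (\<integral>\<omega>'. ?F (N \<omega>') ((+) v ` \<eta>\<^sub>0 \<omega>) \<partial>M) \<partial>M)"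
    using measurable_space[OF measurable_initial]
    by (intro Bochner_Integration.integral_cong refl inner) auto
  also have "\<dots> = (\<integral>h. (\<integral>\<omega>'. ?F (N \<omega>') h \<partial>M) \<partial>distr M configurations (\<lambda>\<omega>. (+) v ` \<eta>\<^sub>0 \<omega>))"
    using integral_N_initial(2)[OF F abs_weight_le_1] by (subst integral_distr) simp_all
  also have "\<dots> = (\<integral>h. (\<integral>\<omega>'. ?F (N \<omega>') h \<partial>M) \<partial>distr M configurations \<eta>\<^sub>0)"
    using stat unfolding stationary_def by simp
  also have "\<dots> = (\<integral>\<omega>. (\<integral>\<omega>'. ?F (N \<omega>') (\<eta>\<^sub>0 \<omega>) \<partial>M) \<partial>M)"
    using integral_N_initial(2)[OF F abs_weight_le_1] by (subst integral_distr) simp_all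
  also have "\<dots> = (\<integral>\<omega>. ?F (N \<omega>) (\<eta>\<^sub>0 \<omega>) \<partial>M)"
    by (rule integral_N_initial(1)[OF F abs_weight_le_1, symmetric])
  also have "\<dots> = prob (X -` U \<inter> space M)"
    unfolding BCD(1) by (rule prob_X_avoiding3[OF BCD(2-7), symmetric])
  finally show "emeasure (distr M configurations3 (\<lambda>\<omega>. shift3 v (X \<omega>))) U = emeasure (distr M configurations3 X) U"
    by (simp add: emeasure_distr emeasure_eq_measure)
next
  interpret D: prob_space "distr M configurations3 (\<lambda>\<omega>. shift3 v (X \<omega>))"
    by (rule prob_space_distr) measurable
  show "range (\<lambda>_::nat. avoiding3 {} {} {}) \<subseteq> avoiding3_events"
    unfolding avoiding3_events_def by auto
  show "emeasure (distr M configurations3 (\<lambda>\<omega>. shift3 v (X \<omega>))) (avoiding3 {} {} {}) \<noteq> \<infinity>"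
    by simp
qed (simp_all add: sets_configurations3)

lemma shift3_birth_death:
  "birth_death (fst (shift3 v x)) (fst (snd (shift3 v x))) (snd (snd (shift3 v x))) t =
    (+) v ` birth_death (fst x) (fst (snd x)) (snd (snd x)) t"
  unfolding shift3_def fst_conv snd_conv by (rule shift_birth_death)

lemma stationary_birth_death:
  assumes "stationary M \<eta>\<^sub>0"
  shows "stationary M (\<lambda>\<omega>. birth_death (N \<omega>) (\<eta>\<^sub>0 \<omega>) (Z \<omega>) t)"
  unfolding stationary_def
proof
  fix v
  let ?b = "\<lambda>x. birth_death (fst x) (fst (snd x)) (snd (snd x)) t"
  have b [measurable]: "?b \<in> configurations3 \<rightarrow>\<^sub>M configurations" by measurable
  have "distr M configurations (\<lambda>\<omega>. (+) v ` birth_death (N \<omega>) (\<eta>\<^sub>0 \<omega>) (Z \<omega>) t) =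
      distr M configurations (?b \<circ> (\<lambda>\<omega>. shift3 v (X \<omega>)))"
    by (simp add: comp_def shift3_birth_death X_def)
  also have "\<dots> = distr (distr M configurations3 (\<lambda>\<omega>. shift3 v (X \<omega>))) configurations ?b"
    by (subst distr_distr) simp_all
  also have "\<dots> = distr (distr M configurations3 X) configurations ?b"
    unfolding distr_X_shift[OF assms] ..
  also have "\<dots> = distr M configurations (?b \<circ> X)" by (subst distr_distr) simp_all
  finally show "distr M configurations (\<lambda>\<omega>. (+) v ` birth_death (N \<omega>) (\<eta>\<^sub>0 \<omega>) (Z \<omega>) t) =
      distr M configurations (\<lambda>\<omega>. birth_death (N \<omega>) (\<eta>\<^sub>0 \<omega>) (Z \<omega>) t)"
    by (simp add: comp_def X_def)
qed

end

section \<open>Ergodicity\<close>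

lemma indicator_avoiding_Un:
  "indicator (avoiding (A \<union> A')) x = (indicator (avoiding A) x * indicator (avoiding A') x :: real)"
  by (auto simp: avoiding_Int[symmetric] indicator_def)

context birth_death_data
begin

section \<open>Decoupling of distant events\<close>

text \<open>A pair in \<open>D\<close> has both ends in \<Lambda>, so arrivals elsewhere cannot
  contribute. The configuration \<open>h\<close> stays whole: it is frozen in all independence
  arguments.\<close>

lemma weight_Int:
  assumes "locally_finite_set n" "B \<subseteq> \<Lambda>" "D \<subseteq> \<Lambda> \<times> \<Lambda>"
  shows "weight B C D (n \<inter> \<Lambda>) h = weight B C D n h"
proof -
  have "marked_pairs (n \<inter> \<Lambda>) h \<inter> D = marked_pairs n h \<inter> D"
    using assms(3) by (auto simp: marked_pairs_def all_points_def)
  moreover have "n \<inter> \<Lambda> \<in> avoiding B \<longleftrightarrow> n \<in> avoiding B"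
    using assms(1,2) locally_finite_set_mono[OF assms(1), of "n \<inter> \<Lambda>"] by (auto simp: avoiding_def)
  ultimately show ?thesis by (simp add: weight_def indicator_def)
qed

lemma weight_Un:
  assumes "locally_finite_set n" "locally_finite_set h" "D \<inter> D' = {}" "bounded D" "bounded D'"
  shows "weight (B \<union> B') (C \<union> C') (D \<union> D') n h = weight B C D n h * weight B' C' D' n h"
proof -
  note lf = locally_finite_marked_pairs[OF assms(1,2)]
  have "card (marked_pairs n h \<inter> (D \<union> D')) = card (marked_pairs n h \<inter> D) + card (marked_pairs n h \<inter> D')"
    unfolding Int_Un_distrib using assms(3)
    by (intro card_Un_disjoint locally_finite_set_bounded[OF lf] assms) auto
  then show ?thesis by (simp add: weight_def power_add indicator_avoiding_Un)
qed

text \<open>By \<open>cond_exp_avoiding3\<close> this is the conditional probability of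
  \<open>avoiding3 B C D\<close> given \<open>\<eta>\<^sub>0\<close>, here as an explicit function
  of the configuration instead of a version chosen up to null sets.\<close>

definition mean_weight :: "('a \<times> real) set \<Rightarrow> 'a set \<Rightarrow> (('a \<times> real) \<times> ('a \<times> real)) set \<Rightarrow>
    'a set \<Rightarrow> real" where
  "mean_weight B C D h = (\<integral>\<omega>. weight B C D (N \<omega>) h \<partial>M)"

lemma mean_weight_nonneg: "0 \<le> mean_weight B C D h"
  unfolding mean_weight_def by (intro Bochner_Integration.integral_nonneg weight_nonneg)

context
  fixes B :: "('a \<times> real) set" and C :: "'a set" and D :: "(('a \<times> real) \<times> ('a \<times> real)) set"
  assumes BCD [measurable]: "B \<in> sets borel" "C \<in> sets borel" "D \<in> sets borel"
    and bounded: "bounded B" "bounded C" "bounded D"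
begin

lemma borel_measurable_weight_fixed:
  "h \<in> space configurations \<Longrightarrow> (\<lambda>n. weight B C D n h) \<in> borel_measurable configurations"
  using BCD bounded by (intro borel_measurable_weight) auto

lemma mean_weight_le_1: "mean_weight B C D h \<le> 1"
\<comment> \<open>For arbitrary sets \<open>h\<close> integrability may fail, and then the integral
  has the default value 0.\<close>
proof (cases "integrable M (\<lambda>\<omega>. weight B C D (N \<omega>) h)")
  case True
  then have "mean_weight B C D h \<le> (\<integral>\<omega>. 1 \<partial>M)"
    unfolding mean_weight_def by (intro integral_mono weight_le_1) auto
  then show ?thesis by (simp add: prob_space)
qed (simp add: mean_weight_def not_integrable_integral_eq)

lemma borel_measurable_mean_weight: "mean_weight B C D \<in> borel_measurable configurations"
  unfolding mean_weight_def[abs_def]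
  by (rule integral_N_initial(2)[OF measurable_weight abs_weight_le_1]) (use BCD bounded in auto)

lemma measurable_mean_weight_G: "(\<lambda>\<omega>. mean_weight B C D (\<eta>\<^sub>0 \<omega>)) \<in> borel_measurable G"
  by (rule measurable_compose[OF measurable_initial_G borel_measurable_mean_weight])

lemma integrable_mean_weight: "integrable M (\<lambda>\<omega>. mean_weight B C D (\<eta>\<^sub>0 \<omega>))"
  using measurable_compose[OF measurable_initial borel_measurable_mean_weight] mean_weight_nonneg mean_weight_le_1
  by (intro integrable_const_bound[where B=1]) auto

lemma avoiding3_BCD: "avoiding3 B C D \<in> sets configurations3"
proof -
  have "avoiding3 B C D \<in> avoiding3_events"
    unfolding avoiding3_events_def using BCD bounded by blast
  then show ?thesis by (rule avoiding3_sets)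
qed

lemma integral_times_weight:
  assumes g: "g \<in> borel_measurable configurations" "\<And>h. \<bar>g h\<bar> \<le> (1::real)"
  shows "(\<integral>\<omega>. g (\<eta>\<^sub>0 \<omega>) * weight B C D (N \<omega>) (\<eta>\<^sub>0 \<omega>) \<partial>M) =
    (\<integral>\<omega>. g (\<eta>\<^sub>0 \<omega>) * mean_weight B C D (\<eta>\<^sub>0 \<omega>) \<partial>M)"
proof -
  have "(\<integral>\<omega>. g (\<eta>\<^sub>0 \<omega>) * weight B C D (N \<omega>) (\<eta>\<^sub>0 \<omega>) \<partial>M) =
    (\<integral>\<omega>. (\<integral>\<omega>'. g (\<eta>\<^sub>0 \<omega>) * weight B C D (N \<omega>') (\<eta>\<^sub>0 \<omega>) \<partial>M) \<partial>M)"
  proof (rule integral_N_initial(1))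
    show "(\<lambda>x. g (snd x) * weight B C D (fst x) (snd x)) \<in> borel_measurable (configurations \<Otimes>\<^sub>M configurations)"
      by (intro borel_measurable_times measurable_compose[OF measurable_snd g(1)] measurable_weight BCD bounded)
    show "\<bar>g h * weight B C D n h\<bar> \<le> 1" for n h
      using mult_mono[OF g(2)[of h] abs_weight_le_1[of B C D n h]] by (simp add: abs_mult)
  qed
  also have "\<dots> = (\<integral>\<omega>. g (\<eta>\<^sub>0 \<omega>) * mean_weight B C D (\<eta>\<^sub>0 \<omega>) \<partial>M)"
    by (simp add: mean_weight_def)
  finally show ?thesis .
qed

text \<open>With \<open>h\<close> frozen the two weights are functions of \<open>N\<close> on
  \<Lambda> and on \<Lambda>', which are independent.\<close>

lemma integral_weight_mult:
  assumes BCD' [measurable]: "B' \<in> sets borel" "C' \<in> sets borel" "D' \<in> sets borel"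
    and bounded': "bounded B'" "bounded C'" "bounded D'"
    and \<Lambda>: "\<Lambda> \<in> sets borel" "\<Lambda>' \<in> sets borel" "\<Lambda> \<inter> \<Lambda>' = {}"
    and sub: "B \<subseteq> \<Lambda>" "D \<subseteq> \<Lambda> \<times> \<Lambda>" "B' \<subseteq> \<Lambda>'" "D' \<subseteq> \<Lambda>' \<times> \<Lambda>'"
    and h: "h \<in> space configurations"
  shows "(\<integral>\<omega>. weight B C D (N \<omega>) h * weight B' C' D' (N \<omega>) h \<partial>M) =
    mean_weight B C D h * mean_weight B' C' D' h"
proof -
  have m: "(\<lambda>n. weight B C D n h) \<in> borel_measurable configurations"
    and m': "(\<lambda>n. weight B' C' D' n h) \<in> borel_measurable configurations"
    using borel_measurable_weight_fixed[OF h] h BCD' bounded' by (auto intro!: borel_measurable_weight)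
  have eq: "weight B C D (N \<omega> \<inter> \<Lambda>) h = weight B C D (N \<omega>) h"
    "weight B' C' D' (N \<omega> \<inter> \<Lambda>') h = weight B' C' D' (N \<omega>) h" if "\<omega> \<in> space M" for \<omega>
    using locally_finite_N[OF that] sub by (auto intro: weight_Int)
  have "indep_var borel (\<lambda>\<omega>. weight B C D (N \<omega> \<inter> \<Lambda>) h) borel (\<lambda>\<omega>. weight B' C' D' (N \<omega> \<inter> \<Lambda>') h)"
    using indep_var_compose[OF indep_N_disjoint[OF \<Lambda>] m m'] by (simp add: comp_def)
  moreover have "integrable M (\<lambda>\<omega>. weight B C D (N \<omega> \<inter> \<Lambda>) h)"
    "integrable M (\<lambda>\<omega>. weight B' C' D' (N \<omega> \<inter> \<Lambda>') h)"
    using measurable_compose[OF measurable_Int_configuration[OF measurable_N \<Lambda>(1)] m]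
      measurable_compose[OF measurable_Int_configuration[OF measurable_N \<Lambda>(2)] m'] abs_weight_le_1
    by (auto intro!: integrable_const_bound[where B=1])
  ultimately have "(\<integral>\<omega>. weight B C D (N \<omega> \<inter> \<Lambda>) h * weight B' C' D' (N \<omega> \<inter> \<Lambda>') h \<partial>M) =
    (\<integral>\<omega>. weight B C D (N \<omega> \<inter> \<Lambda>) h \<partial>M) * (\<integral>\<omega>. weight B' C' D' (N \<omega> \<inter> \<Lambda>') h \<partial>M)"
    by (rule indep_var_lebesgue_integral)
  then show ?thesis
    unfolding mean_weight_def by (simp add: eq cong: Bochner_Integration.integral_cong)
qed

end

text \<open>Given \<open>\<eta>\<^sub>0\<close> the two events are independent. Both terms of the
  difference therefore have the same expectation, the mean of the product of the two conditional
  probabilities; \<open>C\<close> and \<open>C'\<close> may overlap.\<close>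

lemma decoupling:
  assumes B: "B \<in> sets borel" "C \<in> sets borel" "D \<in> sets borel" "bounded B" "bounded C" "bounded D"
    and B': "B' \<in> sets borel" "C' \<in> sets borel" "D' \<in> sets borel" "bounded B'" "bounded C'" "bounded D'"
    and \<Lambda>: "\<Lambda> \<in> sets borel" "\<Lambda>' \<in> sets borel" "\<Lambda> \<inter> \<Lambda>' = {}"
    and sub: "B \<subseteq> \<Lambda>" "D \<subseteq> \<Lambda> \<times> \<Lambda>" "B' \<subseteq> \<Lambda>'" "D' \<subseteq> \<Lambda>' \<times> \<Lambda>'"
  shows "(\<integral>\<omega>. (indicator (avoiding3 B C D) (X \<omega>) - mean_weight B C D (\<eta>\<^sub>0 \<omega>)) *
      indicator (avoiding3 B' C' D') (X \<omega>) \<partial>M) = 0"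
proof -
  note [measurable] = avoiding3_BCD[OF B] avoiding3_BCD[OF B']
  let ?mm = "\<integral>\<omega>. mean_weight B C D (\<eta>\<^sub>0 \<omega>) * mean_weight B' C' D' (\<eta>\<^sub>0 \<omega>) \<partial>M"
  have DD: "D \<inter> D' = {}" using sub \<Lambda>(3) by blast
  have un: "B \<union> B' \<in> sets borel" "bounded (B \<union> B')" "C \<union> C' \<in> sets borel" "bounded (C \<union> C')"
    "D \<union> D' \<in> sets borel" "bounded (D \<union> D')" using B B' by auto
  have "(\<integral>\<omega>. indicator (avoiding3 B C D) (X \<omega>) * indicator (avoiding3 B' C' D') (X \<omega>) \<partial>M) =
      (\<integral>\<omega>. (1::real) * indicator (avoiding3 (B \<union> B') (C \<union> C') (D \<union> D')) (X \<omega>) \<partial>M)"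
    by (intro Bochner_Integration.integral_cong) (auto simp: avoiding3_Int[symmetric] indicator_def)
  also have "\<dots> = (\<integral>\<omega>. 1 * weight (B \<union> B') (C \<union> C') (D \<union> D') (N \<omega>) (\<eta>\<^sub>0 \<omega>) \<partial>M)"
    by (rule integral_avoiding3[OF _ _ un]) simp_all
  also have "\<dots> = (\<integral>\<omega>. weight (B \<union> B') (C \<union> C') (D \<union> D') (N \<omega>) (\<eta>\<^sub>0 \<omega>) \<partial>M)" by simp
  also have "\<dots> = (\<integral>\<omega>. (\<integral>\<omega>'. weight (B \<union> B') (C \<union> C') (D \<union> D') (N \<omega>') (\<eta>\<^sub>0 \<omega>) \<partial>M) \<partial>M)"
    by (rule integral_N_initial(1)[OF measurable_weight[OF un] abs_weight_le_1])
  also have "\<dots> = ?mm"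
  proof (intro Bochner_Integration.integral_cong refl)
    fix \<omega> assume \<omega>: "\<omega> \<in> space M"
    then have h: "\<eta>\<^sub>0 \<omega> \<in> space configurations" by (rule measurable_space[OF measurable_initial])
    have "(\<integral>\<omega>'. weight (B \<union> B') (C \<union> C') (D \<union> D') (N \<omega>') (\<eta>\<^sub>0 \<omega>) \<partial>M) =
      (\<integral>\<omega>'. weight B C D (N \<omega>') (\<eta>\<^sub>0 \<omega>) * weight B' C' D' (N \<omega>') (\<eta>\<^sub>0 \<omega>) \<partial>M)"
      by (intro Bochner_Integration.integral_cong refl weight_Un locally_finite_N
        locally_finite_\<eta>\<^sub>0[OF \<omega>] DD B B')
    also have "\<dots> = mean_weight B C D (\<eta>\<^sub>0 \<omega>) * mean_weight B' C' D' (\<eta>\<^sub>0 \<omega>)"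
      by (rule integral_weight_mult[OF B B' \<Lambda> sub h])
    finally show "(\<integral>\<omega>'. weight (B \<union> B') (C \<union> C') (D \<union> D') (N \<omega>') (\<eta>\<^sub>0 \<omega>) \<partial>M) =
      mean_weight B C D (\<eta>\<^sub>0 \<omega>) * mean_weight B' C' D' (\<eta>\<^sub>0 \<omega>)" .
  qed
  finally have 1: "(\<integral>\<omega>. indicator (avoiding3 B C D) (X \<omega>) * indicator (avoiding3 B' C' D') (X \<omega>) \<partial>M) = ?mm" .
  have "(\<integral>\<omega>. mean_weight B C D (\<eta>\<^sub>0 \<omega>) * indicator (avoiding3 B' C' D') (X \<omega>) \<partial>M) =
      (\<integral>\<omega>. mean_weight B C D (\<eta>\<^sub>0 \<omega>) * weight B' C' D' (N \<omega>) (\<eta>\<^sub>0 \<omega>) \<partial>M)"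
    by (rule integral_avoiding3[OF measurable_mean_weight_G[OF B] integrable_mean_weight[OF B]]) (use B' in auto)
  also have "\<dots> = ?mm"
    using mean_weight_nonneg mean_weight_le_1[OF B]
    by (intro integral_times_weight[OF B'] borel_measurable_mean_weight[OF B]) (simp add: abs_le_iff order_trans[OF _ mean_weight_nonneg])
  finally have 2: "(\<integral>\<omega>. mean_weight B C D (\<eta>\<^sub>0 \<omega>) * indicator (avoiding3 B' C' D') (X \<omega>) \<partial>M) = ?mm" .
  have i1: "integrable M (\<lambda>\<omega>. indicator (avoiding3 B C D) (X \<omega>) * indicator (avoiding3 B' C' D') (X \<omega>) :: real)"
    by (intro integrable_const_bound[where B=1]) (auto simp: indicator_def)
  have i2: "integrable M (\<lambda>\<omega>. mean_weight B C D (\<eta>\<^sub>0 \<omega>) * indicator (avoiding3 B' C' D') (X \<omega>))"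
    using borel_measurable_integrable[OF integrable_mean_weight[OF B]]
    by (intro Bochner_Integration.integrable_bound[OF integrable_mean_weight[OF B]]) (auto simp: indicator_def)
  show ?thesis
    unfolding left_diff_distrib using 1 2 by (simp add: Bochner_Integration.integral_diff[OF i1 i2])
qed

text \<open>Conditionally on the initial configuration, a local event is asymptotically independent of
  every event translated to infinity.\<close>

lemma mixing:
  assumes stat: "stationary M \<eta>\<^sub>0" and e: "norm e = 1"
    and B: "B \<in> sets borel" "C \<in> sets borel" "D \<in> sets borel" "bounded B" "bounded C" "bounded D"
    and V: "V \<in> sets configurations3"
  shows "(\<lambda>k. \<integral>\<omega>. (indicator (avoiding3 B C D) (X \<omega>) - mean_weight B C D (\<eta>\<^sub>0 \<omega>)) *
      indicator V (shift3 (real k *\<^sub>R e) (X \<omega>)) \<partial>M) \<longlonglongrightarrow> 0"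
proof -
  define W where "W \<omega> = indicator (avoiding3 B C D) (X \<omega>) - mean_weight B C D (\<eta>\<^sub>0 \<omega>)" for \<omega>
  note [measurable] = avoiding3_BCD[OF B] borel_measurable_integrable[OF integrable_mean_weight[OF B]]
  have W [measurable]: "W \<in> borel_measurable M" unfolding W_def[abs_def] by measurable
  have W1: "\<bar>W \<omega>\<bar> \<le> 1" for \<omega>
    using mean_weight_nonneg[of B C D "\<eta>\<^sub>0 \<omega>"] mean_weight_le_1[OF B, of "\<eta>\<^sub>0 \<omega>"]
    by (auto simp: W_def indicator_def)
  define J where "J V k = (\<integral>\<omega>. W \<omega> * indicator V (shift3 (real k *\<^sub>R e) (X \<omega>)) \<partial>M)" for V k
  have int: "integrable M (\<lambda>\<omega>. W \<omega> * indicator V (shift3 (real k *\<^sub>R e) (X \<omega>)))"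
    if [measurable]: "V \<in> sets configurations3" for V k
    using W1 by (intro integrable_const_bound[where B=1]) (auto simp: indicator_def)
  \<comment> \<open>Stationarity makes the bound independent of \<open>k\<close>; this uniformity
    controls the tails of infinite unions below.\<close>
  have bound: "\<bar>J V k\<bar> \<le> prob (X -` V \<inter> space M)" if V [measurable]: "V \<in> sets configurations3" for V k
  proof -
    have "\<bar>J V k\<bar> \<le> (\<integral>\<omega>. \<bar>W \<omega> * indicator V (shift3 (real k *\<^sub>R e) (X \<omega>))\<bar> \<partial>M)"
      unfolding J_def by (rule integral_abs_bound)
    also have "\<dots> \<le> (\<integral>\<omega>. indicator ((\<lambda>\<omega>. shift3 (real k *\<^sub>R e) (X \<omega>)) -` V \<inter> space M) \<omega> \<partial>M)"
    proof (rule integral_mono)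
      show "integrable M (\<lambda>\<omega>. \<bar>W \<omega> * indicator V (shift3 (real k *\<^sub>R e) (X \<omega>))\<bar>)"
        by (rule integrable_abs[OF int[OF V]])
      show "integrable M (indicat_real ((\<lambda>\<omega>. shift3 (real k *\<^sub>R e) (X \<omega>)) -` V \<inter> space M))"
        by (intro integrable_const_bound[where B=1]) (auto simp: indicator_def)
      show "\<bar>W \<omega> * indicator V (shift3 (real k *\<^sub>R e) (X \<omega>))\<bar> \<le>
          indicator ((\<lambda>\<omega>. shift3 (real k *\<^sub>R e) (X \<omega>)) -` V \<inter> space M) \<omega>" if "\<omega> \<in> space M" for \<omega>
        using W1[of \<omega>] that by (simp add: indicator_def)
    qed
    also have "\<dots> = measure (distr M configurations3 (\<lambda>\<omega>. shift3 (real k *\<^sub>R e) (X \<omega>))) V"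
      by (simp add: measure_distr)
    also have "\<dots> = prob (X -` V \<inter> space M)"
      unfolding distr_X_shift[OF stat] by (simp add: measure_distr)
    finally show ?thesis .
  qed
  have base: "J (avoiding3 B' C' D') \<longlonglongrightarrow> 0"
    if B': "B' \<in> sets borel" "bounded B'" "C' \<in> sets borel" "bounded C'" "D' \<in> sets borel" "bounded D'"
    for B' C' D'
  proof -
    let ?V = "avoiding3 B' C' D'"
    have "bounded (fst ` (B \<union> B' \<union> fst ` (D \<union> D') \<union> snd ` (D \<union> D')))"
      using B B' by (intro bounded_fst) (auto intro!: bounded_fst bounded_snd)
    then obtain r where r: "\<And>x. x \<in> fst ` (B \<union> B' \<union> fst ` (D \<union> D') \<union> snd ` (D \<union> D')) \<Longrightarrow> norm x \<le> r"
      unfolding bounded_iff by blast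
    \<comment> \<open>A shift by more than \<open>2 * r\<close> separates the arrivals tested by
      \<open>?B\<close> and \<open>?D\<close> from those tested by \<open>B\<close> and
      \<open>D\<close>, so the integral vanishes exactly.\<close>
    have "J ?V k = 0" if k: "2 * r < real k" for k
    proof -
      let ?v = "real k *\<^sub>R e"
      let ?\<Lambda> = "{p :: 'a \<times> real. norm (fst p) \<le> r}" and ?\<Lambda>' = "{p :: 'a \<times> real. norm (?v + fst p) \<le> r}"
      let ?B = "(+) (?v, 0) -` B'" and ?C = "(+) ?v -` C'" and ?D = "(+) ((?v, 0), (?v, 0)) -` D'"
      have pre: "?B \<in> sets borel" "?C \<in> sets borel" "?D \<in> sets borel" "bounded ?B" "bounded ?C" "bounded ?D"
        using B' by (auto simp only: intro!: translation_preimage)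
      have \<Lambda>: "?\<Lambda> \<in> sets borel" "?\<Lambda>' \<in> sets borel"
      proof -
        have "{p \<in> space borel. norm (fst p :: 'a) \<le> r} \<in> sets (borel :: ('a \<times> real) measure)"
          "{p \<in> space borel. norm (?v + fst p) \<le> r} \<in> sets (borel :: ('a \<times> real) measure)" by measurable
        then show "?\<Lambda> \<in> sets borel" "?\<Lambda>' \<in> sets borel" by simp_all
      qed
      have disj: "?\<Lambda> \<inter> ?\<Lambda>' = {}"
      proof -
        have False if "norm x \<le> r" "norm (?v + x) \<le> r" for x
        proof -
          have "norm ?v \<le> norm (?v + x) + norm x" using norm_triangle_ineq4[of "?v + x" x] by simp
          then show False using that k e by simp
        qed
        then show ?thesis by blast
      qed
      have sub: "B \<subseteq> ?\<Lambda>" "D \<subseteq> ?\<Lambda> \<times> ?\<Lambda>" "?B \<subseteq> ?\<Lambda>'" "?D \<subseteq> ?\<Lambda>' \<times> ?\<Lambda>'"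
      proof -
        have rB: "norm (fst p) \<le> r" if "p \<in> B \<union> B'" for p using r[of "fst p"] that by blast
        have rD: "norm (fst (fst x)) \<le> r \<and> norm (fst (snd x)) \<le> r" if "x \<in> D \<union> D'" for x
        proof -
          have "fst x \<in> B \<union> B' \<union> fst ` (D \<union> D') \<union> snd ` (D \<union> D')"
            "snd x \<in> B \<union> B' \<union> fst ` (D \<union> D') \<union> snd ` (D \<union> D')"
            using imageI[OF that, of fst] imageI[OF that, of snd] by blast+
          then show ?thesis using r[OF imageI] by blast
        qed
        show "B \<subseteq> ?\<Lambda>" using rB by blast
        show "D \<subseteq> ?\<Lambda> \<times> ?\<Lambda>" using rD by (force simp: mem_Times_iff)
        show "?B \<subseteq> ?\<Lambda>'"
        proof
          fix p assume "p \<in> ?B"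
          then show "p \<in> ?\<Lambda>'" using rB[of "(?v, 0) + p"] by simp
        qed
        show "?D \<subseteq> ?\<Lambda>' \<times> ?\<Lambda>'"
        proof
          fix x assume "x \<in> ?D"
          then show "x \<in> ?\<Lambda>' \<times> ?\<Lambda>'" using rD[of "((?v, 0), (?v, 0)) + x"] by (simp add: mem_Times_iff)
        qed
      qed
      have "J ?V k = (\<integral>\<omega>. W \<omega> * indicator (avoiding3 ?B ?C ?D) (X \<omega>) \<partial>M)"
        unfolding J_def using shift3_X_avoiding3
        by (intro Bochner_Integration.integral_cong refl) (simp add: indicator_def)
      also have "\<dots> = 0"
        unfolding W_def by (rule decoupling[OF B pre \<Lambda> disj sub])
      finally show ?thesis .
    qed
    moreover have "\<forall>\<^sub>F k in sequentially. 2 * r < real k"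
      by (rule eventually_compose_filterlim[OF eventually_gt_at_top filterlim_real_sequentially])
    ultimately have "\<forall>\<^sub>F k in sequentially. J ?V k = 0" by (auto elim: eventually_mono)
    then show ?thesis by (rule tendsto_eventually)
  qed
  have J_Un: "J (U \<union> V) k = J U k + J V k"
    if "U \<in> sets configurations3" "V \<in> sets configurations3" "U \<inter> V = {}" for U V k
  proof -
    have "indicator (U \<union> V) x = (indicator U x + indicator V x :: real)" for x
      using that(3) by (auto simp: indicator_def)
    then show ?thesis
      unfolding J_def using int[OF that(1)] int[OF that(2)] by (simp add: distrib_left)
  qed
  have "J V \<longlonglongrightarrow> 0"
    using Int_stable_avoiding3_events avoiding3_events_Pow V[unfolded sets_configurations3]
  proof (induction V rule: sigma_sets_induct_disjoint)
    case (basic V)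
    then show ?case unfolding avoiding3_events_def using base by blast
  next
    case empty
    then show ?case by (simp add: J_def[abs_def])
  next
    case (compl A)
    have A: "A \<in> sets configurations3" using compl(1) by (simp only: sets_configurations3)
    have top: "avoiding3 {} {} {} \<in> sets configurations3"
      unfolding space_configurations3[symmetric] by (rule sets.top)
    have "A \<subseteq> avoiding3 {} {} {}" using sets.sets_into_space[OF A] unfolding space_configurations3 .
    then have "A \<union> (avoiding3 {} {} {} - A) = avoiding3 {} {} {}" by blast
    then have "J (avoiding3 {} {} {} - A) = (\<lambda>k. J (avoiding3 {} {} {}) k - J A k)"
      using J_Un[OF A sets.Diff[OF top A]] by auto
    moreover have "(\<lambda>k. J (avoiding3 {} {} {}) k - J A k) \<longlonglongrightarrow> 0 - 0"
      by (intro tendsto_diff base compl(2)) auto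
    ultimately show ?case by simp
  next
    case (union A)
    have A: "A i \<in> sets configurations3" for i
      using union(2) unfolding sets_configurations3 by blast
    \<comment> \<open>The limit in \<open>k\<close> is exchanged with the infinite sum:
      \<open>S n\<close> is handled term by term, the tail \<open>T n\<close> by the uniform
      bound.\<close>
    define S where "S n = (\<Union>i<n. A i)" for n
    define T where "T n = (\<Union>i. A i) - S n" for n
    have S: "S n \<in> sets configurations3" for n using A by (auto simp: S_def)
    have T: "T n \<in> sets configurations3" for n using A S by (auto simp: T_def)
    have JS: "J (S n) k = (\<Sum>i<n. J (A i) k)" for n k
    proof (induction n)
      case (Suc n)
      have "S (Suc n) = S n \<union> A n" by (auto simp: S_def less_Suc_eq)
      moreover have "A i \<inter> A n = {}" if "i < n" for i
        using disjoint_family_onD[OF union(1), of i n] that by auto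
      then have "S n \<inter> A n = {}" unfolding S_def by blast
      ultimately show ?case using J_Un[OF S A] Suc by simp
    qed (simp add: S_def J_def)
    have JU: "J (\<Union>i. A i) k = (\<Sum>i<n. J (A i) k) + J (T n) k" for n k
    proof -
      have "(\<Union>i. A i) = S n \<union> T n" by (auto simp: S_def T_def)
      moreover have "S n \<inter> T n = {}" by (auto simp: T_def)
      ultimately show ?thesis using J_Un[OF S T] JS by simp
    qed
    have t: "(\<lambda>n. prob (X -` T n \<inter> space M)) \<longlonglongrightarrow> 0"
    proof -
      have "(\<lambda>n. prob (X -` T n \<inter> space M)) \<longlonglongrightarrow> prob (\<Inter>n. X -` T n \<inter> space M)"
        using measurable_sets[OF measurable_X T]
        by (intro finite_Lim_measure_decseq) (auto simp: decseq_def T_def S_def)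
      moreover have "(\<Inter>n. X -` T n \<inter> space M) = {}"
      proof -
        have False if "\<And>n. X \<omega> \<in> T n" for \<omega>
        proof -
          have "X \<omega> \<in> (\<Union>i. A i)" using that[of 0] unfolding T_def by blast
          then obtain i where "X \<omega> \<in> A i" by blast
          then show False using that[of "Suc i"] by (auto simp: T_def S_def)
        qed
        then show ?thesis by blast
      qed
      ultimately show ?thesis by simp
    qed
    show ?case
    proof (rule LIMSEQ_I)
      fix r :: real assume "0 < r"
      then obtain n where n: "prob (X -` T n \<inter> space M) < r / 2"
        using LIMSEQ_D[OF t, of "r / 2"] by auto
      have "(\<lambda>k. \<Sum>i<n. J (A i) k) \<longlonglongrightarrow> 0" by (intro tendsto_null_sum union(3))
      then obtain k0 where k0: "\<And>k. k \<ge> k0 \<Longrightarrow> \<bar>\<Sum>i<n. J (A i) k\<bar> < r / 2"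
        using LIMSEQ_D[of _ 0 "r / 2"] \<open>0 < r\<close> by fastforce
      show "\<exists>k0. \<forall>k\<ge>k0. norm (J (\<Union>i. A i) k - 0) < r"
      proof (intro exI allI impI)
        fix k assume "k0 \<le> k"
        from k0[OF this] n bound[OF T, of n k] show "norm (J (\<Union>i. A i) k - 0) < r"
          unfolding JU[of k n] by simp
      qed
    qed
  qed
  then show ?thesis by (simp add: J_def[abs_def] W_def)
qed

definition F :: "'w measure" where
  "F = vimage_algebra (space M) \<eta>\<^sub>0 configurations"

lemma sets_F: "sets F = {\<eta>\<^sub>0 -` A \<inter> space M | A. A \<in> sets configurations}"
  unfolding F_def using measurable_space[OF measurable_initial] by (intro sets_vimage_algebra2) auto

lemma subalgebra_F: "subalgebra M F"
  unfolding subalgebra_def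
proof
  show "space F = space M" by (simp add: F_def)
  show "sets F \<subseteq> events" unfolding sets_F using measurable_sets[OF measurable_initial] by auto
qed

sublocale F: finite_measure_subalgebra M F
  by unfold_locales (rule subalgebra_F)

lemma measurable_initial_F: "\<eta>\<^sub>0 \<in> F \<rightarrow>\<^sub>M configurations"
  unfolding F_def using measurable_space[OF measurable_initial] by (intro measurable_vimage_algebra1) auto

lemma cond_exp_avoiding3:
  assumes B: "B \<in> sets borel" "C \<in> sets borel" "D \<in> sets borel" "bounded B" "bounded C" "bounded D"
  shows "AE \<omega> in M. real_cond_exp M F (\<lambda>\<omega>. indicator (avoiding3 B C D) (X \<omega>)) \<omega> = mean_weight B C D (\<eta>\<^sub>0 \<omega>)"
proof (rule F.real_cond_exp_charact)
  note [measurable] = avoiding3_BCD[OF B]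
  show "integrable M (\<lambda>\<omega>. indicat_real (avoiding3 B C D) (X \<omega>))"
    by (intro integrable_const_bound[where B=1]) (auto simp: indicator_def)
  show "integrable M (\<lambda>\<omega>. mean_weight B C D (\<eta>\<^sub>0 \<omega>))" by (rule integrable_mean_weight[OF B])
  show "(\<lambda>\<omega>. mean_weight B C D (\<eta>\<^sub>0 \<omega>)) \<in> borel_measurable F"
    by (rule measurable_compose[OF measurable_initial_F borel_measurable_mean_weight[OF B]])
  fix A assume "A \<in> sets F"
  then obtain C' where A: "A = \<eta>\<^sub>0 -` C' \<inter> space M" and C' [measurable]: "C' \<in> sets configurations"
    unfolding sets_F by blast
  have gG: "(\<lambda>\<omega>. indicat_real C' (\<eta>\<^sub>0 \<omega>)) \<in> borel_measurable G"
    using measurable_initial_G by measurable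
  have gi: "integrable M (\<lambda>\<omega>. indicat_real C' (\<eta>\<^sub>0 \<omega>))"
    by (intro integrable_const_bound[where B=1]) (auto simp: indicator_def)
  have "(\<integral>\<omega>\<in>A. indicat_real (avoiding3 B C D) (X \<omega>) \<partial>M) =
      (\<integral>\<omega>. indicat_real C' (\<eta>\<^sub>0 \<omega>) * indicator (avoiding3 B C D) (X \<omega>) \<partial>M)"
    unfolding set_lebesgue_integral_def A
    by (intro Bochner_Integration.integral_cong) (auto simp: indicator_def)
  also have "\<dots> = (\<integral>\<omega>. indicat_real C' (\<eta>\<^sub>0 \<omega>) * weight B C D (N \<omega>) (\<eta>\<^sub>0 \<omega>) \<partial>M)"
    by (rule integral_avoiding3[OF gG gi]) (use B in auto)
  also have "\<dots> = (\<integral>\<omega>. indicat_real C' (\<eta>\<^sub>0 \<omega>) * mean_weight B C D (\<eta>\<^sub>0 \<omega>) \<partial>M)"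
    by (intro integral_times_weight[OF B]) (auto simp: indicator_def)
  also have "\<dots> = (\<integral>\<omega>\<in>A. mean_weight B C D (\<eta>\<^sub>0 \<omega>) \<partial>M)"
    unfolding set_lebesgue_integral_def A
    by (intro Bochner_Integration.integral_cong) (auto simp: indicator_def)
  finally show "(\<integral>\<omega>\<in>A. indicat_real (avoiding3 B C D) (X \<omega>) \<partial>M) =
      (\<integral>\<omega>\<in>A. mean_weight B C D (\<eta>\<^sub>0 \<omega>) \<partial>M)" .
qed

text \<open>By \<open>mixing\<close>, an invariant event is conditionally independent of every local event given
  \<open>\<eta>\<^sub>0\<close>; hence it is conditionally independent of itself.\<close>

lemma invariant_event_initial:
  assumes stat: "stationary M \<eta>\<^sub>0" and A: "A \<in> sets configurations3"
    and inv: "\<And>v \<omega>. \<omega> \<in> space M \<Longrightarrow> shift3 v (X \<omega>) \<in> A \<longleftrightarrow> X \<omega> \<in> A"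
  shows "\<exists>C\<in>sets configurations. AE \<omega> in M. X \<omega> \<in> A \<longleftrightarrow> \<eta>\<^sub>0 \<omega> \<in> C"
proof -
  obtain e :: 'a where "e \<in> Basis" using nonempty_Basis by blast
  then have e: "norm e = 1" by simp
  note [measurable] = A
  define f where "f \<omega> = indicat_real A (X \<omega>)" for \<omega>
  define E where "E = real_cond_exp M F f"
  have f [measurable]: "f \<in> borel_measurable M" unfolding f_def[abs_def] by measurable
  have fi: "integrable M f" by (intro integrable_const_bound[where B=1]) (auto simp: f_def indicator_def)
  have EF: "E \<in> borel_measurable F" unfolding E_def by (rule borel_measurable_cond_exp)
  have [measurable]: "E \<in> borel_measurable M" by (rule measurable_from_subalg[OF subalgebra_F EF])
  have Ei: "integrable M E" unfolding E_def by (rule F.real_cond_exp_int(1)[OF fi])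
  have int: "integrable M (\<lambda>\<omega>. indicator U (X \<omega>) * (f \<omega> - E \<omega>))"
    if [measurable]: "U \<in> sets configurations3" for U
    by (intro Bochner_Integration.integrable_bound[OF Bochner_Integration.integrable_diff[OF fi Ei]])
      (auto simp: indicator_def)
  have base: "(\<integral>\<omega>. indicator (avoiding3 B C D) (X \<omega>) * (f \<omega> - E \<omega>) \<partial>M) = 0"
    if B: "B \<in> sets borel" "C \<in> sets borel" "D \<in> sets borel" "bounded B" "bounded C" "bounded D" for B C D
  proof -
    let ?m = "\<lambda>\<omega>. mean_weight B C D (\<eta>\<^sub>0 \<omega>)" and ?u = "\<lambda>\<omega>. indicat_real (avoiding3 B C D) (X \<omega>)"
    note [measurable] = avoiding3_BCD[OF B]
    have mF: "?m \<in> borel_measurable F"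
      by (rule measurable_compose[OF measurable_initial_F borel_measurable_mean_weight[OF B]])
    have [measurable]: "?m \<in> borel_measurable M" by (rule measurable_from_subalg[OF subalgebra_F mF])
    have uf: "integrable M (\<lambda>\<omega>. ?u \<omega> * f \<omega>)"
      by (intro Bochner_Integration.integrable_bound[OF fi]) (auto simp: indicator_def)
    have mf: "integrable M (\<lambda>\<omega>. ?m \<omega> * f \<omega>)"
      by (intro Bochner_Integration.integrable_bound[OF integrable_mean_weight[OF B]])
        (auto simp: f_def indicator_def)
    have Eu: "integrable M (\<lambda>\<omega>. E \<omega> * ?u \<omega>)"
      by (intro Bochner_Integration.integrable_bound[OF Ei]) (auto simp: indicator_def)
    \<comment> \<open>For an invariant event the sequence of \<open>mixing\<close> does not depend
      on \<open>k\<close>, so its common value is the limit 0.\<close>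
    have "(\<lambda>k::nat. \<integral>\<omega>. (?u \<omega> - ?m \<omega>) * f \<omega> \<partial>M) \<longlonglongrightarrow> 0"
    proof -
      have "(\<integral>\<omega>. (?u \<omega> - ?m \<omega>) * indicator A (shift3 (real k *\<^sub>R e) (X \<omega>)) \<partial>M) =
          (\<integral>\<omega>. (?u \<omega> - ?m \<omega>) * f \<omega> \<partial>M)" for k
        unfolding f_def using inv by (intro Bochner_Integration.integral_cong refl) (simp add: indicator_def)
      with mixing[OF stat e B A] show ?thesis by simp
    qed
    then have "(\<integral>\<omega>. (?u \<omega> - ?m \<omega>) * f \<omega> \<partial>M) = 0" by (simp add: LIMSEQ_const_iff)
    then have "(\<integral>\<omega>. ?u \<omega> * f \<omega> \<partial>M) = (\<integral>\<omega>. ?m \<omega> * f \<omega> \<partial>M)"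
      unfolding left_diff_distrib by (simp add: Bochner_Integration.integral_diff[OF uf mf])
    \<comment> \<open>Conditional expectation is self-adjoint: \<open>?m\<close> depends on
      \<open>\<eta>\<^sub>0\<close> only, so \<open>f\<close> may be replaced by \<open>E\<close>;
      next \<open>?m\<close>, the conditional expectation of \<open>?u\<close>, is replaced by
      \<open>?u\<close>.\<close>
    also have "\<dots> = (\<integral>\<omega>. ?m \<omega> * E \<omega> \<partial>M)"
      unfolding E_def by (rule F.real_cond_exp_intg(2)[OF mf mF f, symmetric])
    also have "\<dots> = (\<integral>\<omega>. E \<omega> * real_cond_exp M F ?u \<omega> \<partial>M)"
      using cond_exp_avoiding3[OF B] by (intro integral_cong_AE) (auto simp: mult.commute)
    also have "\<dots> = (\<integral>\<omega>. E \<omega> * ?u \<omega> \<partial>M)"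
      by (rule F.real_cond_exp_intg(2)[OF Eu EF]) measurable
    finally have "(\<integral>\<omega>. ?u \<omega> * f \<omega> \<partial>M) = (\<integral>\<omega>. ?u \<omega> * E \<omega> \<partial>M)" by (simp add: mult.commute)
    moreover have "integrable M (\<lambda>\<omega>. ?u \<omega> * E \<omega>)" using Eu by (simp add: mult.commute)
    ultimately show ?thesis
      unfolding right_diff_distrib using uf by (simp add: Bochner_Integration.integral_diff)
  qed
  \<comment> \<open>Since \<open>E\<close> is a function of \<open>\<eta>\<^sub>0\<close> and hence
    of \<open>X\<close>, vanishing on all events of \<open>X\<close> means \<open>f = E\<close>
    almost surely. Two such events are used below.\<close>
  have zero: "(\<integral>\<omega>. indicator U (X \<omega>) * (f \<omega> - E \<omega>) \<partial>M) = 0" if U: "U \<in> sets configurations3" for U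
    using Int_stable_avoiding3_events avoiding3_events_Pow U[unfolded sets_configurations3]
  proof (induction U rule: sigma_sets_induct_disjoint)
    case (basic V)
    then show ?case unfolding avoiding3_events_def using base by blast
  next
    case (compl V)
    have V: "V \<in> sets configurations3" using compl(1) by (simp only: sets_configurations3)
    have top: "avoiding3 {} {} {} \<in> sets configurations3"
      unfolding space_configurations3[symmetric] by (rule sets.top)
    have "V \<subseteq> avoiding3 {} {} {}" using sets.sets_into_space[OF V] unfolding space_configurations3 .
    then have "indicat_real (avoiding3 {} {} {} - V) x = indicator (avoiding3 {} {} {}) x - indicator V x" for x
      by (auto simp: indicator_def)
    then show ?case
      using int[OF top] int[OF V] base[of "{}" "{}" "{}"] compl(2)
      by (simp add: left_diff_distrib)
  next
    case (union V)
    have V: "V i \<in> sets configurations3" for i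
      using union(2) unfolding sets_configurations3 by blast
    have eq: "(\<integral>\<omega>. indicator U (X \<omega>) * (f \<omega> - E \<omega>) \<partial>M) = (\<integral>\<omega>\<in>X -` U \<inter> space M. f \<omega> - E \<omega> \<partial>M)" for U
      unfolding set_lebesgue_integral_def
      by (intro Bochner_Integration.integral_cong) (auto simp: indicator_def)
    have "(\<integral>\<omega>\<in>(\<Union>i. X -` V i \<inter> space M). f \<omega> - E \<omega> \<partial>M) =
        (\<Sum>i. \<integral>\<omega>\<in>X -` V i \<inter> space M. f \<omega> - E \<omega> \<partial>M)"
    proof (rule lebesgue_integral_countable_add)
      show "X -` V i \<inter> space M \<in> events" for i using measurable_sets[OF measurable_X V] .
      then have "(\<Union>i. X -` V i \<inter> space M) \<in> events" by blast
      then show "set_integrable M (\<Union>i. X -` V i \<inter> space M) (\<lambda>\<omega>. f \<omega> - E \<omega>)"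
        unfolding set_integrable_def using fi Ei
        by (intro integrable_mult_indicator) auto
      show "X -` V i \<inter> space M \<inter> (X -` V j \<inter> space M) = {}" if "i \<noteq> j" for i j
        using disjoint_family_onD[OF union(1), of i j] that by auto
    qed
    also have "\<dots> = 0" using union(3) unfolding eq by simp
    finally show ?case unfolding eq vimage_UN by (simp only: Int_UN_distrib2 UN_simps)
  qed simp
  \<comment> \<open>\<open>f\<close> takes the values 0 and 1 only, so the event is recovered by
    thresholding \<open>E\<close> at one half. On \<open>?U1\<close> the difference
    \<open>f - E\<close> is below \<open>- 1 / 2\<close>, on \<open>?U2\<close> it is at least
    \<open>1 / 2\<close>; its vanishing integrals make both events null.\<close>
  have "{\<omega> \<in> space F. 1 / 2 < E \<omega>} \<in> sets F" using EF by measurable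
  then obtain C where C [measurable]: "C \<in> sets configurations"
    and CE: "{\<omega> \<in> space F. 1 / 2 < E \<omega>} = \<eta>\<^sub>0 -` C \<inter> space M" unfolding sets_F by blast
  have CE': "\<eta>\<^sub>0 \<omega> \<in> C \<longleftrightarrow> 1 / 2 < E \<omega>" if "\<omega> \<in> space M" for \<omega>
    using CE that subalgebra_F unfolding subalgebra_def by blast
  let ?U1 = "{x \<in> space configurations3. x \<notin> A \<and> fst (snd x) \<in> C}"
  let ?U2 = "{x \<in> space configurations3. x \<in> A \<and> fst (snd x) \<notin> C}"
  have U: "?U1 \<in> sets configurations3" "?U2 \<in> sets configurations3" by measurable
  have fsX: "fst (snd (X \<omega>)) = \<eta>\<^sub>0 \<omega>" for \<omega> by (simp add: X_def)
  have p1: "prob (X -` ?U1 \<inter> space M) \<le> 0"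
  proof -
    have "(\<integral>\<omega>. indicator ?U1 (X \<omega>) * (f \<omega> - E \<omega>) \<partial>M) \<le>
        (\<integral>\<omega>. - (1 / 2) * indicator (X -` ?U1 \<inter> space M) \<omega> \<partial>M)"
    proof (rule integral_mono[OF int[OF U(1)]])
      show "integrable M (\<lambda>\<omega>. - (1 / 2) * indicat_real (X -` ?U1 \<inter> space M) \<omega>)"
        using measurable_sets[OF measurable_X U(1)] by (intro integrable_mult_right integrable_real_indicator) (simp_all add: emeasure_eq_measure)
      show "indicator ?U1 (X \<omega>) * (f \<omega> - E \<omega>) \<le> - (1 / 2) * indicator (X -` ?U1 \<inter> space M) \<omega>"
        if "\<omega> \<in> space M" for \<omega>
        using that CE'[OF that] fsX[of \<omega>] by (auto simp: indicator_def f_def)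
    qed
    then show ?thesis using zero[OF U(1)] measurable_sets[OF measurable_X U(1)] by simp
  qed
  have p2: "prob (X -` ?U2 \<inter> space M) \<le> 0"
  proof -
    have "(\<integral>\<omega>. 1 / 2 * indicator (X -` ?U2 \<inter> space M) \<omega> \<partial>M) \<le>
        (\<integral>\<omega>. indicator ?U2 (X \<omega>) * (f \<omega> - E \<omega>) \<partial>M)"
    proof (rule integral_mono[OF _ int[OF U(2)]])
      show "integrable M (\<lambda>\<omega>. 1 / 2 * indicat_real (X -` ?U2 \<inter> space M) \<omega>)"
        using measurable_sets[OF measurable_X U(2)] by (intro integrable_mult_right integrable_real_indicator) (simp_all add: emeasure_eq_measure)
      show "1 / 2 * indicator (X -` ?U2 \<inter> space M) \<omega> \<le> indicator ?U2 (X \<omega>) * (f \<omega> - E \<omega>)"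
        if "\<omega> \<in> space M" for \<omega>
        using that CE'[OF that] fsX[of \<omega>] by (auto simp: indicator_def f_def)
    qed
    then show ?thesis using zero[OF U(2)] measurable_sets[OF measurable_X U(2)] by simp
  qed
  have null: "AE \<omega> in M. \<omega> \<notin> X -` U \<inter> space M"
    if "U \<in> sets configurations3" "prob (X -` U \<inter> space M) \<le> 0" for U
    using measurable_sets[OF measurable_X that(1)] that(2) measure_nonneg[of M "X -` U \<inter> space M"]
    by (intro AE_not_in) (auto simp: null_sets_def emeasure_eq_measure)
  have "AE \<omega> in M. X \<omega> \<in> A \<longleftrightarrow> \<eta>\<^sub>0 \<omega> \<in> C"
    using null[OF U(1) p1] null[OF U(2) p2] AE_space
  proof eventually_elim
    case (elim \<omega>)
    then show ?case using measurable_space[OF measurable_X elim(3)] by (auto simp: X_def)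
  qed
  then show ?thesis using C by blast
qed

end

text \<open>Replacing \<open>C\<close> by the configurations almost all of whose translates lie in \<open>C\<close> makes an almost
  surely invariant event strictly invariant.\<close>

lemma (in prob_space) ergodic_AE_invariant:
  fixes \<xi> :: "'a \<Rightarrow> 'b::euclidean_space set"
  assumes \<xi> [measurable]: "\<xi> \<in> M \<rightarrow>\<^sub>M configurations" and erg: "ergodic M \<xi>"
    and C [measurable]: "C \<in> sets configurations"
    and inv: "\<And>v. AE \<omega> in M. (+) v ` \<xi> \<omega> \<in> C \<longleftrightarrow> \<xi> \<omega> \<in> C"
  shows "prob (\<xi> -` C \<inter> space M) \<in> {0, 1}"
proof -
  define C' where "C' = {\<zeta> \<in> space configurations. AE v in lborel. (+) v ` \<zeta> \<in> C}"
  have slice: "{v. (+) v ` \<zeta> \<in> C} \<in> sets borel" if "\<zeta> \<in> space configurations" for \<zeta>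
  proof -
    have [measurable]: "(\<lambda>v. \<zeta>) \<in> borel \<rightarrow>\<^sub>M configurations" using that by simp
    have "{v \<in> space borel. (+) v ` \<zeta> \<in> C} \<in> sets borel" by measurable
    then show ?thesis by simp
  qed
  have C' [measurable]: "C' \<in> sets configurations"
  proof -
    let ?Q = "{x \<in> space (configurations \<Otimes>\<^sub>M lborel). (+) (snd x) ` fst x \<notin> C}"
    have "?Q \<in> sets (configurations \<Otimes>\<^sub>M lborel)" by measurable
    then have [measurable]: "(\<lambda>\<zeta>. emeasure lborel (Pair \<zeta> -` ?Q)) \<in> borel_measurable configurations"
      by (rule lborel.measurable_emeasure_Pair)
    have "C' = {\<zeta> \<in> space configurations. emeasure lborel (Pair \<zeta> -` ?Q) = 0}"
      unfolding C'_def
    proof (rule Collect_cong, rule conj_cong[OF refl])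
      fix \<zeta> :: "'b set" assume \<zeta>: "\<zeta> \<in> space configurations"
      have "Pair \<zeta> -` ?Q = {v. (+) v ` \<zeta> \<notin> C}" using \<zeta> by (auto simp: space_pair_measure)
      moreover have "{v. (+) v ` \<zeta> \<notin> C} = UNIV - {v. (+) v ` \<zeta> \<in> C}" by auto
      then have "{v. (+) v ` \<zeta> \<notin> C} \<in> sets lborel" using slice[OF \<zeta>] by auto
      ultimately show "(AE v in lborel. (+) v ` \<zeta> \<in> C) \<longleftrightarrow> emeasure lborel (Pair \<zeta> -` ?Q) = 0"
        by (subst AE_iff_measurable[of "{v. (+) v ` \<zeta> \<notin> C}"]) auto
    qed
    also have "\<dots> \<in> sets configurations" by measurable
    finally show ?thesis .
  qed
  \<comment> \<open>Translating \<zeta> by \<open>w\<close> only translates the variable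
    \<open>v\<close>, and Lebesgue measure is invariant. No exceptional set of translations
    remains.\<close>
  have "\<forall>v. \<forall>\<zeta>\<in>space configurations. (+) v ` \<zeta> \<in> C' \<longleftrightarrow> \<zeta> \<in> C'"
  proof (intro allI ballI)
    fix w and \<zeta> :: "'b set" assume \<zeta>: "\<zeta> \<in> space configurations"
    then have w\<zeta>: "(+) w ` \<zeta> \<in> space configurations"
      using locally_finite_set_translation by (auto simp: space_configurations)
    have "(AE v in lborel. (+) v ` (+) w ` \<zeta> \<in> C) \<longleftrightarrow> (AE v in lborel. (+) (w + v) ` \<zeta> \<in> C)"
      by (simp add: image_image add_ac)
    also have "\<dots> \<longleftrightarrow> (AE v in distr lborel borel ((+) w). (+) v ` \<zeta> \<in> C)"
      using slice[OF \<zeta>] by (subst AE_distr_iff) auto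
    also have "\<dots> \<longleftrightarrow> (AE v in lborel. (+) v ` \<zeta> \<in> C)" unfolding lborel_distr_plus ..
    finally show "(+) w ` \<zeta> \<in> C' \<longleftrightarrow> \<zeta> \<in> C'" using \<zeta> w\<zeta> by (simp add: C'_def)
  qed
  then have 01: "measure (distr M configurations \<xi>) C' \<in> {0, 1}"
    using erg C' unfolding ergodic_def by blast
  interpret P: pair_sigma_finite M "lborel :: 'b measure" ..
  have "AE v in (lborel :: 'b measure). AE \<omega> in M. (+) v ` \<xi> \<omega> \<in> C \<longleftrightarrow> \<xi> \<omega> \<in> C"
    by (rule AE_I2) (rule inv)
  then have "AE \<omega> in M. AE v in lborel. (+) v ` \<xi> \<omega> \<in> C \<longleftrightarrow> \<xi> \<omega> \<in> C"
    by (subst P.AE_commute) measurable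
  then have "AE \<omega> in M. \<xi> \<omega> \<in> C \<longleftrightarrow> \<xi> \<omega> \<in> C'"
    using AE_space
  proof eventually_elim
    case (elim \<omega>)
    have s: "\<xi> \<omega> \<in> space configurations" by (rule measurable_space[OF \<xi> elim(2)])
    show ?case
    proof
      assume "\<xi> \<omega> \<in> C"
      then show "\<xi> \<omega> \<in> C'" using elim(1) s by (simp add: C'_def)
    next
      assume "\<xi> \<omega> \<in> C'"
      then have "AE v in lborel. (+) v ` \<xi> \<omega> \<in> C" by (simp add: C'_def)
      with elim(1) have "AE v in (lborel :: 'b measure). \<xi> \<omega> \<in> C" by eventually_elim simp
      \<comment> \<open>The statement no longer involves \<open>v\<close>, and Lebesgue measure is
        not zero, so holding almost everywhere means holding.\<close>
      then show "\<xi> \<omega> \<in> C" by (simp add: eventually_const_iff ae_filter_eq_bot_iff)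
    qed
  qed
  then have "prob (\<xi> -` C \<inter> space M) = prob (\<xi> -` C' \<inter> space M)"
    by (intro finite_measure_eq_AE) auto
  also have "\<dots> = measure (distr M configurations \<xi>) C'" by (simp add: measure_distr)
  finally show ?thesis using 01 by simp
qed

context birth_death_data
begin

text \<open>Equivariance of the construction pulls an invariant event of the state back to an
  invariant event of the triple. This is almost surely an event \<open>C\<close> of
  \<open>\<eta>\<^sub>0\<close>, and \<open>C\<close> inherits invariance up to null sets.\<close>

lemma ergodic_birth_death:
  assumes stat: "stationary M \<eta>\<^sub>0" and erg: "ergodic M \<eta>\<^sub>0"
  shows "ergodic M (\<lambda>\<omega>. birth_death (N \<omega>) (\<eta>\<^sub>0 \<omega>) (Z \<omega>) t)"
  unfolding ergodic_def
proof (intro ballI impI)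
  fix A :: "'a set set"
  assume A [measurable]: "A \<in> sets configurations"
    and inv: "\<forall>v. \<forall>\<zeta>\<in>space configurations. (+) v ` \<zeta> \<in> A \<longleftrightarrow> \<zeta> \<in> A"
  let ?b = "\<lambda>x. birth_death (fst x) (fst (snd x)) (snd (snd x)) t"
  have b [measurable]: "?b \<in> configurations3 \<rightarrow>\<^sub>M configurations" by measurable
  define A' where "A' = ?b -` A \<inter> space configurations3"
  have A' [measurable]: "A' \<in> sets configurations3" unfolding A'_def by measurable
  have inv': "shift3 v (X \<omega>) \<in> A' \<longleftrightarrow> X \<omega> \<in> A'" if \<omega>: "\<omega> \<in> space M" for v \<omega>
  proof -
    have x: "X \<omega> \<in> space configurations3" by (rule measurable_space[OF measurable_X \<omega>])
    then have "shift3 v (X \<omega>) \<in> space configurations3" "?b (X \<omega>) \<in> space configurations"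
      using measurable_space[OF measurable_shift3] measurable_space[OF b] by blast+
    then show ?thesis using x inv by (simp add: A'_def shift3_birth_death)
  qed
  from invariant_event_initial[OF stat A' inv'] obtain C
    where C [measurable]: "C \<in> sets configurations" and AC: "AE \<omega> in M. X \<omega> \<in> A' \<longleftrightarrow> \<eta>\<^sub>0 \<omega> \<in> C" by blast
  \<comment> \<open>The almost sure equivalence is a property of the law of \<open>X\<close>, so it
    also holds for the shifted triple; there \<open>A'\<close> is unchanged while
    \<open>\<eta>\<^sub>0\<close> is translated.\<close>
  have "AE \<omega> in M. (+) v ` \<eta>\<^sub>0 \<omega> \<in> C \<longleftrightarrow> \<eta>\<^sub>0 \<omega> \<in> C" for v
  proof -
    have "AE x in distr M configurations3 X. x \<in> A' \<longleftrightarrow> fst (snd x) \<in> C"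
      using AC by (subst AE_distr_iff) (simp_all add: X_def)
    then have "AE x in distr M configurations3 (\<lambda>\<omega>. shift3 v (X \<omega>)). x \<in> A' \<longleftrightarrow> fst (snd x) \<in> C"
      unfolding distr_X_shift[OF stat] .
    then have "AE \<omega> in M. shift3 v (X \<omega>) \<in> A' \<longleftrightarrow> fst (snd (shift3 v (X \<omega>))) \<in> C"
      by (subst (asm) AE_distr_iff) simp_all
    then show ?thesis using AC AE_space
      by eventually_elim (use inv' in \<open>simp add: shift3_def X_def\<close>)
  qed
  from ergodic_AE_invariant[OF measurable_initial erg C this]
  have "prob (\<eta>\<^sub>0 -` C \<inter> space M) \<in> {0, 1}" .
  moreover have "prob (X -` A' \<inter> space M) = prob (\<eta>\<^sub>0 -` C \<inter> space M)"
    using AC by (intro finite_measure_eq_AE) auto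
  moreover have "(\<lambda>\<omega>. birth_death (N \<omega>) (\<eta>\<^sub>0 \<omega>) (Z \<omega>) t) -` A \<inter> space M = X -` A' \<inter> space M"
    using measurable_space[OF measurable_X] by (auto simp: A'_def X_def)
  ultimately show "measure (distr M configurations (\<lambda>\<omega>. birth_death (N \<omega>) (\<eta>\<^sub>0 \<omega>) (Z \<omega>) t)) A \<in> {0, 1}"
    by (simp add: measure_distr)
qed

end

theorem corollary2p2:
  fixes M :: "'w measure"
    and N :: "'w \<Rightarrow> ((real ^ 'd) \<times> real) set"
    and \<eta>\<^sub>0 :: "'w \<Rightarrow> (real ^ 'd) set"
    and I :: "'w \<Rightarrow> (real ^ 'd) \<times> real \<Rightarrow> (real ^ 'd) \<times> real \<Rightarrow> bool"
    and \<rho> :: real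
  assumes "prob_space M"
    and "0 \<le> \<rho>" and "\<rho> \<le> 1"
    and "unit_poisson_process M N"
    and "hard_core_point_process M \<eta>\<^sub>0"
    and "prob_space.indep_set M
           (sets (vimage_algebra (space M) \<eta>\<^sub>0 configurations))
           (sets (vimage_algebra (space M) N configurations))"
    and "independent_marks M \<rho> N \<eta>\<^sub>0 I"
  shows "\<exists>\<eta> :: real \<Rightarrow> 'w \<Rightarrow> (real ^ 'd) set.
           (\<forall>t\<ge>0. \<eta> t \<in> M \<rightarrow>\<^sub>M configurations) \<and>
           (AE \<omega> in M. hard_core_birth_death (N \<omega>) (\<eta>\<^sub>0 \<omega>) (I \<omega>) (\<lambda>t. \<eta> t \<omega>)) \<and>
           (stationary M \<eta>\<^sub>0 \<and> ergodic M \<eta>\<^sub>0 \<longrightarrow>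
              (\<forall>t>0. stationary M (\<eta> t) \<and> ergodic M (\<eta> t)))"
proof -
  interpret prob_space M by fact
  interpret birth_death_data M N \<eta>\<^sub>0 I \<rho> using assms by unfold_locales
  show ?thesis
  proof (intro exI[of _ "\<lambda>t \<omega>. birth_death (N \<omega>) (\<eta>\<^sub>0 \<omega>) (Z \<omega>) t"] conjI allI impI)
    show "(\<lambda>\<omega>. birth_death (N \<omega>) (\<eta>\<^sub>0 \<omega>) (Z \<omega>) t) \<in> M \<rightarrow>\<^sub>M configurations" for t by measurable
    show "AE \<omega> in M. hard_core_birth_death (N \<omega>) (\<eta>\<^sub>0 \<omega>) (I \<omega>) (birth_death (N \<omega>) (\<eta>\<^sub>0 \<omega>) (Z \<omega>))"
      by (rule AE_hard_core_birth_death)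
  qed (auto intro: stationary_birth_death ergodic_birth_death)
qed

end
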